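(* Let $R$ be a ring and let $A=\sigma(R)\langle x_1,\dots,x_n\rangle$ be a skew $PBW$ extension of derivation type of $R$, with associated system of derivations $\Delta=\{\delta_1,\dots,\delta_n\}$ of $R$. Let $I$ be a proper $\Delta$-invariant ideal of $R$. Then $I$ is a $\Delta$-prime ideal of $R$ if and only if $IA$ is a prime ideal of $A$. In such case, $IA=AI$ and $IA\cap R=I$.
   Context: Rings are associative with unit, not necessarily commutative; "ideal" means two-sided ideal. Skew $PBW$ extension: let $R\subseteq A$ be rings. $A$ is a skew $PBW$ extension of $R$, written $A=\sigma(R)\langle x_1,\dots,x_n\rangle$, if there are finitely many elements $x_1,\dots,x_n\in A$ such that: (1) $A$ is a free left $R$-module with basis $\{x^{\alpha}=x_1^{\alpha_1}\cdots x_n^{\alpha_n}\mid \alpha\in\mathbb{N}^n\}$ (with $x_1^0\cdots x_n^0=1$); (2) for every $1\le i\le n$ and $r\in R\setminus\{0\}$ there is $c_{i,r}\in R\setminus\{0\}$ with $x_ir-c_{i,r}x_i\in R$; (3) for all $1\le i,j\le n$ there is $c_{i,j}\in R\setminus\{0\}$ with $x_jx_i-c_{i,j}x_ix_j\in R+Rx_1+\cdots+Rx_n$. For such $A$ there are, for each $i$, an injective ring endomorphism $\sigma_i:R\to R$ and a $\sigma_i$-derivation $\delta_i:R\to R$ (additive, $\delta_i(rs)=\sigma_i(r)\delta_i(s)+\delta_i(r)s$) with $x_ir=\sigma_i(r)x_i+\delta_i(r)$ for all $r\in R$. $A$ is of derivation type if $\sigma_i=\mathrm{id}_R$ for every $i$.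 Put $\Delta=\{\delta_1,\dots,\delta_n\}$. An ideal $I$ of $R$ is $\Delta$-invariant if $\delta_i(I)\subseteq I$ for every $i$. A proper $\Delta$-invariant ideal $I$ of $R$ is $\Delta$-prime if whenever a product of two $\Delta$-invariant ideals of $R$ is contained in $I$, one of these ideals is contained in $I$. *)

theory Defs
  imports "HOL-Algebra.Algebra"
begin

text \<open>
  A subring \<open>R\<close> of \<open>A\<close> is a subset of \<open>carrier A\<close>; as a ring in its own right it is
  \<open>A\<lparr>carrier := R\<rparr>\<close>. The library predicate \<open>ideal\<close> means two-sided ideal in a possibly
  noncommutative ring. The variables of a skew PBW extension are \<open>x 1, \<dots>, x n\<close>; values of
  \<open>x\<close>, \<open>\<sigma>\<close> and \<open>\<delta>\<close> at other indices are irrelevant.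
\<close>


section \<open>Skew PBW extensions\<close>

text \<open>
  \<open>\<nat>\<^sup>n\<close> is encoded by the functions on \<open>nat\<close> vanishing outside \<open>{1..n}\<close>.
\<close>

definition exponents :: "nat \<Rightarrow> (nat \<Rightarrow> nat) set" where
  "exponents n = {\<alpha>. \<forall>i. i \<notin> {1..n} \<longrightarrow> \<alpha> i = 0}"

definition monomial ::
    "('a, 'b) ring_scheme \<Rightarrow> nat \<Rightarrow> (nat \<Rightarrow> 'a) \<Rightarrow> (nat \<Rightarrow> nat) \<Rightarrow> 'a" where
  "monomial A n x \<alpha> =
     foldr (\<lambda>a b. a \<otimes>\<^bsub>A\<^esub> b) (map (\<lambda>i. x i [^]\<^bsub>A\<^esub> \<alpha> i) [1..<Suc n]) \<one>\<^bsub>A\<^esub>"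

text \<open>
  The family \<open>b\<close> indexed by \<open>J\<close> is a basis of \<open>A\<close> as a left \<open>R\<close>-module: every element is a
  left \<open>R\<close>-linear combination of the family for exactly one finitely supported coefficient
  family. Coefficient families are extensional, so that uniqueness only concerns their values
  on \<open>J\<close>.
\<close>

definition free_left_basis ::
    "('a, 'b) ring_scheme \<Rightarrow> 'a set \<Rightarrow> 'i set \<Rightarrow> ('i \<Rightarrow> 'a) \<Rightarrow> bool" where
  "free_left_basis A R J b \<longleftrightarrow>
     b \<in> J \<rightarrow> carrier A \<and>
     (\<forall>a \<in> carrier A. \<exists>!c. c \<in> J \<rightarrow>\<^sub>E R \<and> finite {j \<in> J. c j \<noteq> \<zero>\<^bsub>A\<^esub>} \<and>
        a = finsum A (\<lambda>j. c j \<otimes>\<^bsub>A\<^esub> b j) {j \<in> J. c j \<noteq> \<zero>\<^bsub>A\<^esub>})"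

text \<open>The left \<open>R\<close>-submodule \<open>R + R x\<^sub>1 + \<dots> + R x\<^sub>n\<close>.\<close>

definition affine_part ::
    "('a, 'b) ring_scheme \<Rightarrow> 'a set \<Rightarrow> nat \<Rightarrow> (nat \<Rightarrow> 'a) \<Rightarrow> 'a set" where
  "affine_part A R n x =
     {r0 \<oplus>\<^bsub>A\<^esub> finsum A (\<lambda>i. r i \<otimes>\<^bsub>A\<^esub> x i) {1..n} | r0 r. r0 \<in> R \<and> r \<in> {1..n} \<rightarrow> R}"

definition skew_PBW_extension ::
    "('a, 'b) ring_scheme \<Rightarrow> 'a set \<Rightarrow> nat \<Rightarrow> (nat \<Rightarrow> 'a) \<Rightarrow> bool" where
  "skew_PBW_extension A R n x \<longleftrightarrow>
     ring A \<and> subring R A \<and> x \<in> {1..n} \<rightarrow> carrier A \<and>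
     free_left_basis A R (exponents n) (monomial A n x) \<and>
     (\<forall>i \<in> {1..n}. \<forall>r \<in> R - {\<zero>\<^bsub>A\<^esub>}. \<exists>c \<in> R - {\<zero>\<^bsub>A\<^esub>}.
        (x i \<otimes>\<^bsub>A\<^esub> r) \<ominus>\<^bsub>A\<^esub> (c \<otimes>\<^bsub>A\<^esub> x i) \<in> R) \<and>
     (\<forall>i \<in> {1..n}. \<forall>j \<in> {1..n}. \<exists>c \<in> R - {\<zero>\<^bsub>A\<^esub>}.
        (x j \<otimes>\<^bsub>A\<^esub> x i) \<ominus>\<^bsub>A\<^esub> (c \<otimes>\<^bsub>A\<^esub> (x i \<otimes>\<^bsub>A\<^esub> x j)) \<in> affine_part A R n x)"


section \<open>The associated endomorphisms and derivations\<close>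

definition skew_derivation ::
    "('a, 'b) ring_scheme \<Rightarrow> ('a \<Rightarrow> 'a) \<Rightarrow> ('a \<Rightarrow> 'a) \<Rightarrow> bool" where
  "skew_derivation S s d \<longleftrightarrow>
     d \<in> carrier S \<rightarrow> carrier S \<and>
     (\<forall>a \<in> carrier S. \<forall>b \<in> carrier S. d (a \<oplus>\<^bsub>S\<^esub> b) = d a \<oplus>\<^bsub>S\<^esub> d b) \<and>
     (\<forall>a \<in> carrier S. \<forall>b \<in> carrier S.
        d (a \<otimes>\<^bsub>S\<^esub> b) = (s a \<otimes>\<^bsub>S\<^esub> d b) \<oplus>\<^bsub>S\<^esub> (d a \<otimes>\<^bsub>S\<^esub> b))"

text \<open>
  For a skew PBW extension, freeness determines \<open>\<sigma> i\<close> and \<open>\<delta> i\<close> on \<open>R\<close> uniquely for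
  \<open>i \<in> {1..n}\<close>.
\<close>

definition associated_system ::
    "('a, 'b) ring_scheme \<Rightarrow> 'a set \<Rightarrow> nat \<Rightarrow> (nat \<Rightarrow> 'a) \<Rightarrow>
     (nat \<Rightarrow> 'a \<Rightarrow> 'a) \<Rightarrow> (nat \<Rightarrow> 'a \<Rightarrow> 'a) \<Rightarrow> bool" where
  "associated_system A R n x \<sigma> \<delta> \<longleftrightarrow>
     (\<forall>i \<in> {1..n}.
        \<sigma> i \<in> ring_hom (A\<lparr>carrier := R\<rparr>) (A\<lparr>carrier := R\<rparr>) \<and> inj_on (\<sigma> i) R \<and>
        skew_derivation (A\<lparr>carrier := R\<rparr>) (\<sigma> i) (\<delta> i) \<and>
        (\<forall>r \<in> R. x i \<otimes>\<^bsub>A\<^esub> r = (\<sigma> i r \<otimes>\<^bsub>A\<^esub> x i) \<oplus>\<^bsub>A\<^esub> \<delta> i r))"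

definition derivation_type :: "'a set \<Rightarrow> nat \<Rightarrow> (nat \<Rightarrow> 'a \<Rightarrow> 'a) \<Rightarrow> bool" where
  "derivation_type R n \<sigma> \<longleftrightarrow> (\<forall>i \<in> {1..n}. \<forall>r \<in> R. \<sigma> i r = r)"


section \<open>Invariant and prime ideals\<close>

definition invariant_ideal ::
    "('a, 'b) ring_scheme \<Rightarrow> ('a \<Rightarrow> 'a) set \<Rightarrow> 'a set \<Rightarrow> bool" where
  "invariant_ideal S D I \<longleftrightarrow> ideal I S \<and> (\<forall>d \<in> D. d ` I \<subseteq> I)"

definition invariant_prime_ideal ::
    "('a, 'b) ring_scheme \<Rightarrow> ('a \<Rightarrow> 'a) set \<Rightarrow> 'a set \<Rightarrow> bool" where
  "invariant_prime_ideal S D I \<longleftrightarrow>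
     invariant_ideal S D I \<and> I \<noteq> carrier S \<and>
     (\<forall>J K. invariant_ideal S D J \<longrightarrow> invariant_ideal S D K \<longrightarrow>
        ideal_prod S J K \<subseteq> I \<longrightarrow> J \<subseteq> I \<or> K \<subseteq> I)"

text \<open>
  Primeness in the noncommutative sense; the library's \<open>primeideal\<close> is elementwise and
  restricted to commutative rings.
\<close>

definition nc_prime_ideal :: "('a, 'b) ring_scheme \<Rightarrow> 'a set \<Rightarrow> bool" where
  "nc_prime_ideal S P \<longleftrightarrow>
     ideal P S \<and> P \<noteq> carrier S \<and>
     (\<forall>J K. ideal J S \<longrightarrow> ideal K S \<longrightarrow>
        ideal_prod S J K \<subseteq> P \<longrightarrow> J \<subseteq> P \<or> K \<subseteq> P)"

end

theory Submission
  imports Defs "HOL-Library.Fun_Lexorder"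
begin

text \<open>
  Suppose \<open>J K \<subseteq> I A\<close> for ideals \<open>J\<close>, \<open>K\<close> of \<open>A\<close> not contained in \<open>I A\<close>, where \<open>I\<close> is
  \<open>\<Delta>\<close>-prime. As in McCoy's theorem on annihilators of polynomials, an element of \<open>K\<close> with few top
  coefficients yields some \<open>b \<notin> I\<close> that is annihilated modulo \<open>I\<close> by all top coefficients of
  elements of \<open>J\<close> of a suitable degree. If the set of such \<open>b\<close> is \<open>\<Delta>\<close>-invariant, then
  \<open>\<Delta>\<close>-primeness gives a contradiction.

  For \<open>\<delta>\<^sub>i\<close> this is clear when \<open>x\<^sub>i\<close> commutes with all \<open>x\<^sub>j\<close> up to lower degree, because then
  taking commutators with \<open>x\<^sub>i\<close> does not raise the degree. Otherwise let \<open>\<tau>\<^sub>i\<^sub>j\<close> be the leading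
  coefficient of \<open>[x\<^sub>i, x\<^sub>j]\<close>. It is central in \<open>R\<close>, and \<open>\<tau>\<^sub>i\<^sub>j \<delta>\<^sub>i\<close> is an inner derivation. By the
  Jacobi identity and \<open>\<Delta>\<close>-primeness, a product \<open>s\<close> of such coefficients is regular modulo \<open>I\<close> and
  makes \<open>s \<delta>\<^sub>i\<close> inner for all remaining \<open>i\<close>. Inner derivations preserve ideals, so the regularity
  of \<open>s\<close> gives the invariance under these \<open>\<delta>\<^sub>i\<close> as well.
\<close>

section \<open>Exponents\<close>

text \<open>The relations only provide a nonzero \<open>c\<close> in \<open>R\<close> with
  \<open>x\<^sub>j x\<^sub>i = c x\<^sub>i x\<^sub>j + ...\<close>. Because all
  \<open>\<sigma>\<^sub>i\<close> are the identity, comparing coordinates for \<open>i < j\<close>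
  shows that \<open>c\<close> is central and invertible. Hence monomials multiply up to central
  units and lower terms, and \<open>\<tau>\<^sub>i\<^sub>j = 1 - c\<close>.

  The obstacle is that the \<open>\<tau>\<^sub>i\<^sub>j\<close> need not be constants of the
  derivations, so lying outside \<open>I\<close> does not by itself make them regular modulo
  \<open>I\<close>. Two facts help. Inner derivations vanish on the centre, so a product of such
  coefficients annihilates the values on the centre of each \<open>\<delta>\<^sub>i\<close> that it
  makes inner. For any other \<open>\<delta>\<^sub>k\<close>, the Jacobi identity trades a factor
  \<open>\<tau>\<^sub>i\<^sub>j\<close> for factors with first index \<open>k\<close>. If the
  product already has as many first indices as possible outside \<open>I\<close>, there is no room
  for \<open>k\<close>.

  In this direction primeness enters through one dichotomy: if the right annihilator of a set modulo
  \<open>I\<close> is an invariant two-sided ideal, then the set or this annihilator lies in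
  \<open>I\<close>.\<close>

definition mdeg :: "nat \<Rightarrow> (nat \<Rightarrow> nat) \<Rightarrow> nat" where
  "mdeg n \<alpha> = sum \<alpha> {1..n}"

definition bump :: "nat \<Rightarrow> (nat \<Rightarrow> nat) \<Rightarrow> nat \<Rightarrow> nat" where
  "bump i \<alpha> = \<alpha>(i := Suc (\<alpha> i))"

lemma bump_commute: "bump i (bump j \<alpha>) = bump j (bump i \<alpha>)"
  by (auto simp: bump_def fun_eq_iff)

lemma bump_inject [simp]: "bump i \<alpha> = bump i \<beta> \<longleftrightarrow> \<alpha> = \<beta>"
  by (auto simp: bump_def fun_eq_iff split: if_splits)

lemma bump_neq_zero [simp]: "bump i \<alpha> \<noteq> (\<lambda>_. 0)" "(\<lambda>_. 0) \<noteq> bump i \<alpha>"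
  by (auto simp: bump_def fun_eq_iff)

lemma bump_add: "(\<lambda>k. bump i \<alpha> k + \<beta> k) = bump i (\<lambda>k. \<alpha> k + \<beta> k)"
  by (auto simp: bump_def)

lemma bump_in_exponents [simp]: "\<alpha> \<in> exponents n \<Longrightarrow> i \<in> {1..n} \<Longrightarrow> bump i \<alpha> \<in> exponents n"
  by (auto simp: exponents_def bump_def)

lemma zero_in_exponents [simp]: "(\<lambda>_. 0) \<in> exponents n"
  by (auto simp: exponents_def)

lemma add_in_exponents [simp]:
  "\<alpha> \<in> exponents n \<Longrightarrow> \<beta> \<in> exponents n \<Longrightarrow> (\<lambda>k. \<alpha> k + \<beta> k) \<in> exponents n"
  by (auto simp: exponents_def)

lemma mdeg_zero [simp]: "mdeg n (\<lambda>_. 0) = 0"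
  by (simp add: mdeg_def)

lemma mdeg_add: "mdeg n (\<lambda>k. \<alpha> k + \<beta> k) = mdeg n \<alpha> + mdeg n \<beta>"
  by (simp add: mdeg_def sum.distrib)

lemma mdeg_bump [simp]: "i \<in> {1..n} \<Longrightarrow> mdeg n (bump i \<alpha>) = Suc (mdeg n \<alpha>)"
proof -
  assume i: "i \<in> {1..n}"
  have "(\<lambda>k. bump i (\<lambda>_. 0) k + \<alpha> k) = bump i \<alpha>"
    by (auto simp: bump_def)
  moreover have "mdeg n (bump i (\<lambda>_. 0)) = 1"
    using i by (simp add: mdeg_def bump_def)
  ultimately show ?thesis
    using mdeg_add[of n "bump i (\<lambda>_. 0)" \<alpha>] by simp
qed

text \<open>The least index of the support is split off, so that \<open>bump i\<close> corresponds
  to left multiplication of the ordered monomial by \<open>x i\<close>; see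
  \<open>xpow_bump\<close>.\<close>

lemma exponents_cases:
  assumes "\<alpha> \<in> exponents n"
  obtains "\<alpha> = (\<lambda>_. 0)"
  | i \<beta> where "\<beta> \<in> exponents n" "i \<in> {1..n}" "\<And>j. j < i \<Longrightarrow> \<beta> j = 0" "\<alpha> = bump i \<beta>"
proof (cases "\<alpha> = (\<lambda>_. 0)")
  case False
  then have ex: "\<exists>i. \<alpha> i \<noteq> 0" by (auto simp: fun_eq_iff)
  define i where "i = (LEAST i. \<alpha> i \<noteq> 0)"
  have i: "\<alpha> i \<noteq> 0"
    unfolding i_def by (rule LeastI_ex[OF ex])
  have lt: "\<alpha> j = 0" if "j < i" for j
    using not_less_Least[of j "\<lambda>i. \<alpha> i \<noteq> 0"] that unfolding i_def by blast
  from i assms have "i \<in> {1..n}" by (auto simp: exponents_def)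
  moreover have "\<alpha>(i := \<alpha> i - 1) \<in> exponents n"
    using assms by (auto simp: exponents_def)
  moreover have "\<alpha> = bump i (\<alpha>(i := \<alpha> i - 1))"
    using i by (auto simp: bump_def)
  ultimately show thesis using that(2) lt by auto
qed auto

lemma exponents_induct [consumes 1, case_names zero bump]:
  assumes "\<alpha> \<in> exponents n" "P (\<lambda>_. 0)"
    and "\<And>i \<beta>. \<beta> \<in> exponents n \<Longrightarrow> i \<in> {1..n} \<Longrightarrow> (\<And>j. j < i \<Longrightarrow> \<beta> j = 0) \<Longrightarrow> P \<beta> \<Longrightarrow> P (bump i \<beta>)"
  shows "P \<alpha>"
  using assms(1)
proof (induction "mdeg n \<alpha>" arbitrary: \<alpha> rule: less_induct)
  case less
  from less.prems show ?case
  proof (cases rule: exponents_cases)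
    case 1
    then show ?thesis using assms(2) by simp
  next
    case (2 i \<beta>)
    then show ?thesis using less.hyps[of \<beta>] assms(3) by auto
  qed
qed

lemma mdeg_0_iff: "\<alpha> \<in> exponents n \<Longrightarrow> mdeg n \<alpha> = 0 \<longleftrightarrow> \<alpha> = (\<lambda>_. 0)"
  by (auto simp: mdeg_def exponents_def fun_eq_iff)

lemma mdeg_1_cases:
  assumes "\<alpha> \<in> exponents n" "mdeg n \<alpha> = Suc 0"
  obtains i where "i \<in> {1..n}" "\<alpha> = bump i (\<lambda>_. 0)"
  using assms(1)
proof (cases rule: exponents_cases)
  case 1
  then show ?thesis using assms by simp
next
  case (2 i \<beta>)
  then show ?thesis using that assms by (auto simp: mdeg_0_iff)
qed

lemma finite_exponents_deg: "finite {\<alpha> \<in> exponents n. mdeg n \<alpha> = d}"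
proof (rule finite_subset)
  show "{\<alpha> \<in> exponents n. mdeg n \<alpha> = d} \<subseteq> {f. (f ` {1..n} \<subseteq> {..d}) \<and> (\<forall>x. x \<notin> {1..n} \<longrightarrow> f x = 0)}"
    by (auto simp: exponents_def mdeg_def intro!: member_le_sum)
  show "finite {f. (f ` {1..n} \<subseteq> {..d}) \<and> (\<forall>x. x \<notin> {1..n} \<longrightarrow> f x = (0::nat))}"
    by (rule finite_subset[OF _ finite_set_of_finite_funs[of "{1..n}" "{..d}" 0]]) (auto simp: image_subset_iff)
qed

text \<open>Exponents of degree two are unordered pairs. As a simp rule this decides the coordinate
  comparisons at quadratic monomials.\<close>

lemma pair_eq_iff [simp]:
  "bump i (bump j (\<lambda>_. 0)) = bump a (bump b (\<lambda>_. 0)) \<longleftrightarrow> i = a \<and> j = b \<or> i = b \<and> j = a"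
proof
  assume *: "bump i (bump j (\<lambda>_. 0)) = bump a (bump b (\<lambda>_. 0))"
  have "i = a \<or> i = b"
    using fun_cong[OF *, of i] by (auto simp: bump_def split: if_splits)
  then show "i = a \<and> j = b \<or> i = b \<and> j = a"
  proof
    assume "i = a"
    with * have "bump j (\<lambda>_. 0) = bump b (\<lambda>_. 0)" by simp
    from fun_cong[OF this, of j] \<open>i = a\<close> show ?thesis by (auto simp: bump_def split: if_splits)
  next
    assume "i = b"
    with * have "bump j (\<lambda>_. 0) = bump a (\<lambda>_. 0)" by (simp add: bump_commute[of a])
    from fun_cong[OF this, of j] \<open>i = b\<close> show ?thesis by (auto simp: bump_def split: if_splits)
  qed
qed (auto simp: bump_commute)

lemma exponents_trichotomy:
  assumes "\<alpha> \<in> exponents n" "\<beta> \<in> exponents n"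
  shows "less_fun \<alpha> \<beta> \<or> \<alpha> = \<beta> \<or> less_fun \<beta> \<alpha>"
proof (rule less_fun_trichotomy)
  have "{k. \<alpha> k \<noteq> \<beta> k} \<subseteq> {1..n}"
  proof (rule subsetI, rule ccontr)
    fix k assume "k \<in> {k. \<alpha> k \<noteq> \<beta> k}" "k \<notin> {1..n}"
    then show False using assms by (simp add: exponents_def)
  qed
  then show "finite {k. \<alpha> k \<noteq> \<beta> k}" by (rule finite_subset) simp
qed

lemma finite_lex_max:
  assumes "finite S" "S \<noteq> {}" "S \<subseteq> exponents n"
  shows "\<exists>m \<in> S. \<forall>s \<in> S. s = m \<or> less_fun s m"
  using assms
proof (induction rule: finite_ne_induct)
  case (insert a S)
  then obtain m where m: "m \<in> S" "\<forall>s \<in> S. s = m \<or> less_fun s m" by auto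
  consider "less_fun a m" | "a = m" | "less_fun m a"
    using exponents_trichotomy[of a n m] insert.prems m(1) by blast
  then show ?case
  proof cases
    case 3
    have "s = a \<or> less_fun s a" if "s \<in> insert a S" for s
      using that m 3 less_fun_trans[of s m a] by auto
    then show ?thesis by blast
  qed (use m in auto)
qed auto

text \<open>Isolates one pair of terms in a product: any other decomposition of
  \<open>\<alpha>\<^sub>0 + \<beta>\<^sub>1\<close> has a first summand larger than
  \<open>\<alpha>\<^sub>0\<close> or a second one larger than
  \<open>\<beta>\<^sub>1\<close>.\<close>

lemma less_fun_add_cancel:
  fixes \<alpha> \<beta> \<gamma> \<epsilon> :: "nat \<Rightarrow> nat"
  assumes eq: "(\<lambda>k. \<alpha> k + \<beta> k) = (\<lambda>k. \<gamma> k + \<epsilon> k)" and "less_fun \<alpha> \<gamma>"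
  shows "less_fun \<epsilon> \<beta>"
proof -
  obtain k where k: "\<alpha> k < \<gamma> k" "\<forall>k' < k. \<alpha> k' = \<gamma> k'"
    using assms(2) by (auto simp: less_fun_def)
  have "\<alpha> j + \<beta> j = \<gamma> j + \<epsilon> j" for j using fun_cong[OF eq] by simp
  then have "\<epsilon> k < \<beta> k" "\<forall>k' < k. \<epsilon> k' = \<beta> k'"
    using k by (metis add_less_le_mono leI less_irrefl, metis add_left_cancel)
  then show ?thesis by (auto simp: less_fun_def)
qed

section \<open>Coordinates in the standard basis\<close>

locale pbw_derivation_type = ring A for A (structure) +
  fixes R :: "'a set" and n :: nat and x :: "nat \<Rightarrow> 'a" and \<delta> :: "nat \<Rightarrow> 'a \<Rightarrow> 'a"
  assumes subring_R: "subring R A"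
    and x_funcset: "x \<in> {1..n} \<rightarrow> carrier A"
    and basis: "free_left_basis A R (exponents n) (monomial A n x)"
    and commutation: "\<And>i j. i \<in> {1..n} \<Longrightarrow> j \<in> {1..n} \<Longrightarrow>
          \<exists>c \<in> R. (x j \<otimes> x i) \<ominus> (c \<otimes> (x i \<otimes> x j)) \<in> affine_part A R n x"
    and \<delta>_closed [simp]: "\<And>i r. i \<in> {1..n} \<Longrightarrow> r \<in> R \<Longrightarrow> \<delta> i r \<in> R"
    and \<delta>_add: "\<And>i r s. i \<in> {1..n} \<Longrightarrow> r \<in> R \<Longrightarrow> s \<in> R \<Longrightarrow> \<delta> i (r \<oplus> s) = \<delta> i r \<oplus> \<delta> i s"
    and \<delta>_mult: "\<And>i r s. i \<in> {1..n} \<Longrightarrow> r \<in> R \<Longrightarrow> s \<in> R \<Longrightarrow>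
          \<delta> i (r \<otimes> s) = (r \<otimes> \<delta> i s) \<oplus> (\<delta> i r \<otimes> s)"
    and x_scalar: "\<And>i r. i \<in> {1..n} \<Longrightarrow> r \<in> R \<Longrightarrow> x i \<otimes> r = (r \<otimes> x i) \<oplus> \<delta> i r"
begin

abbreviation "E \<equiv> exponents n"
abbreviation "xpow \<equiv> monomial A n x"
abbreviation "dg \<equiv> mdeg n"

lemma R_carrier [simp]: "r \<in> R \<Longrightarrow> r \<in> carrier A"
  using subringE(1)[OF subring_R] by auto

lemma R_closed [simp]:
  "\<zero> \<in> R" "\<one> \<in> R" "r \<in> R \<Longrightarrow> \<ominus> r \<in> R"
  "r \<in> R \<Longrightarrow> s \<in> R \<Longrightarrow> r \<oplus> s \<in> R" "r \<in> R \<Longrightarrow> s \<in> R \<Longrightarrow> r \<otimes> s \<in> R"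
  "r \<in> R \<Longrightarrow> s \<in> R \<Longrightarrow> r \<ominus> s \<in> R"
  using subringE(2-7)[OF subring_R] by (auto simp: a_minus_def)

lemma x_closed [simp]: "i \<in> {1..n} \<Longrightarrow> x i \<in> carrier A"
  using x_funcset by auto

lemma xpow_closed [simp]: "\<alpha> \<in> E \<Longrightarrow> xpow \<alpha> \<in> carrier A"
  using basis by (auto simp: free_left_basis_def)

lemma \<delta>_zero [simp]: "i \<in> {1..n} \<Longrightarrow> \<delta> i \<zero> = \<zero>"
  using \<delta>_add[of i \<zero> \<zero>] by (metis R_carrier R_closed(1) \<delta>_closed add.r_cancel_one' r_zero)

lemma \<delta>_minus: "i \<in> {1..n} \<Longrightarrow> r \<in> R \<Longrightarrow> \<delta> i (\<ominus> r) = \<ominus> \<delta> i r"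
  using \<delta>_add[of i "\<ominus> r" r] by (metis R_carrier R_closed(3) \<delta>_closed \<delta>_zero l_neg minus_equality)

lemma xpow_zero [simp]: "xpow (\<lambda>_. 0) = \<one>"
proof -
  have "foldr (\<lambda>a b. a \<otimes> b) (map (\<lambda>i. x i [^] (0::nat)) is) \<one> = \<one>" for "is" :: "nat list"
    by (induction "is") auto
  then show ?thesis by (simp add: monomial_def)
qed

text \<open>The powers of the variables before \<open>x i\<close> are trivial, so the new factor
  comes to the front without commuting anything.\<close>

lemma xpow_bump:
  assumes \<alpha>: "\<alpha> \<in> E" and i: "i \<in> {1..n}" and lt: "\<And>j. j < i \<Longrightarrow> \<alpha> j = 0"
  shows "xpow (bump i \<alpha>) = x i \<otimes> xpow \<alpha>"
proof -
  define F where "F \<beta> js = foldr (\<lambda>a b. a \<otimes> b) (map (\<lambda>i. x i [^] (\<beta> i :: nat)) js) \<one>" for \<beta> js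
  have split: "[1..<Suc n] = [1..<i] @ i # [Suc i..<Suc n]"
  proof -
    have "[1..<Suc n] = [1..<i] @ [i..<Suc n]"
      using i upt_add_eq_append[of 1 i "Suc n - i"] by (simp del: upt_Suc)
    then show ?thesis
      using i by (simp add: upt_conv_Cons del: upt_Suc)
  qed
  have cl: "F \<beta> js \<in> carrier A" if "set js \<subseteq> {1..n}" for \<beta> js
    using that by (induction js) (auto simp: F_def)
  have app: "F \<beta> (js @ ks) = F \<beta> ks"
    if "set ks \<subseteq> {1..n}" "set js \<subseteq> {1..n}" "\<And>j. j \<in> set js \<Longrightarrow> \<beta> j = 0" for \<beta> js ks
    using that(2,3)
  proof (induction js)
    case (Cons j js)
    then show ?case using cl[OF that(1)] by (auto simp: F_def)
  qed simp
  have cong: "F \<beta> js = F \<gamma> js" if "\<And>j. j \<in> set js \<Longrightarrow> \<beta> j = \<gamma> j" for \<beta> \<gamma> js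
  proof -
    have "map (\<lambda>i. x i [^] \<beta> i) js = map (\<lambda>i. x i [^] \<gamma> i) js" using that by simp
    then show ?thesis by (simp only: F_def)
  qed
  have s1: "set (i # [Suc i..<Suc n]) \<subseteq> {1..n}" "set [1..<i] \<subseteq> {1..n}" "set [Suc i..<Suc n] \<subseteq> {1..n}"
    using i by auto
  have "xpow (bump i \<alpha>) = F (bump i \<alpha>) ([1..<i] @ i # [Suc i..<Suc n])"
    unfolding monomial_def F_def split ..
  also have "\<dots> = F (bump i \<alpha>) (i # [Suc i..<Suc n])"
    using lt by (intro app s1) (auto simp: bump_def)
  also have "\<dots> = x i [^] Suc (\<alpha> i) \<otimes> F (bump i \<alpha>) [Suc i..<Suc n]"
    by (simp add: F_def bump_def del: upt_Suc nat_pow_Suc)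
  also have "F (bump i \<alpha>) [Suc i..<Suc n] = F \<alpha> [Suc i..<Suc n]"
    by (rule cong) (auto simp: bump_def)
  also have "x i [^] Suc (\<alpha> i) \<otimes> F \<alpha> [Suc i..<Suc n] = x i \<otimes> (x i [^] \<alpha> i \<otimes> F \<alpha> [Suc i..<Suc n])"
    using i cl[OF s1(3)] by (subst nat_pow_Suc2) (auto simp: m_assoc simp del: nat_pow_Suc upt_Suc)
  also have "x i [^] \<alpha> i \<otimes> F \<alpha> [Suc i..<Suc n] = F \<alpha> (i # [Suc i..<Suc n])"
    by (simp add: F_def del: upt_Suc)
  also have "\<dots> = F \<alpha> ([1..<i] @ i # [Suc i..<Suc n])"
    using lt by (intro app[symmetric] s1) auto
  also have "\<dots> = xpow \<alpha>"
    unfolding monomial_def F_def split ..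
  finally show ?thesis .
qed

definition coef :: "'a \<Rightarrow> (nat \<Rightarrow> nat) \<Rightarrow> 'a" where
  "coef a = (THE c. c \<in> E \<rightarrow>\<^sub>E R \<and> finite {\<alpha> \<in> E. c \<alpha> \<noteq> \<zero>} \<and>
     a = finsum A (\<lambda>\<alpha>. c \<alpha> \<otimes> xpow \<alpha>) {\<alpha> \<in> E. c \<alpha> \<noteq> \<zero>})"

lemma coef_props:
  assumes "a \<in> carrier A"
  shows "coef a \<in> E \<rightarrow>\<^sub>E R" "finite {\<alpha> \<in> E. coef a \<alpha> \<noteq> \<zero>}"
    "a = finsum A (\<lambda>\<alpha>. coef a \<alpha> \<otimes> xpow \<alpha>) {\<alpha> \<in> E. coef a \<alpha> \<noteq> \<zero>}"
proof -
  have "\<exists>!c. c \<in> E \<rightarrow>\<^sub>E R \<and> finite {\<alpha> \<in> E. c \<alpha> \<noteq> \<zero>} \<and>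
     a = finsum A (\<lambda>\<alpha>. c \<alpha> \<otimes> xpow \<alpha>) {\<alpha> \<in> E. c \<alpha> \<noteq> \<zero>}"
    using basis assms by (simp add: free_left_basis_def)
  from theI'[OF this] show "coef a \<in> E \<rightarrow>\<^sub>E R" "finite {\<alpha> \<in> E. coef a \<alpha> \<noteq> \<zero>}"
    "a = finsum A (\<lambda>\<alpha>. coef a \<alpha> \<otimes> xpow \<alpha>) {\<alpha> \<in> E. coef a \<alpha> \<noteq> \<zero>}"
    unfolding coef_def[symmetric] by blast+
qed

lemma coef_in_R [simp]: "a \<in> carrier A \<Longrightarrow> \<alpha> \<in> E \<Longrightarrow> coef a \<alpha> \<in> R"
  using coef_props(1) by (auto simp: PiE_iff)

text \<open>The use of uniqueness on which the coordinate computations rest. Any finite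
  \<open>S\<close> containing the support is allowed, so that two elements can be expanded over a
  common set.\<close>

lemma coef_finsum:
  assumes S: "finite S" "S \<subseteq> E" and c: "\<And>\<alpha>. \<alpha> \<in> E \<Longrightarrow> c \<alpha> \<in> R"
    and out: "\<And>\<alpha>. \<alpha> \<in> E \<Longrightarrow> \<alpha> \<notin> S \<Longrightarrow> c \<alpha> = \<zero>" and "\<alpha> \<in> E"
  shows "coef (finsum A (\<lambda>\<alpha>. c \<alpha> \<otimes> xpow \<alpha>) S) \<alpha> = c \<alpha>"
proof -
  define a where "a = finsum A (\<lambda>\<alpha>. c \<alpha> \<otimes> xpow \<alpha>) S"
  define c' where "c' = restrict c E"
  have a: "a \<in> carrier A"
    unfolding a_def using S c by (intro finsum_closed) auto
  have supp: "{\<alpha> \<in> E. c' \<alpha> \<noteq> \<zero>} \<subseteq> S"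
    using out by (auto simp: c'_def)
  have 1: "a = finsum A (\<lambda>\<alpha>. c' \<alpha> \<otimes> xpow \<alpha>) {\<alpha> \<in> E. c' \<alpha> \<noteq> \<zero>}"
    unfolding a_def
    using S c supp by (intro add.finprod_mono_neutral_cong_right) (auto simp: c'_def)
  have ex1: "\<exists>!c. c \<in> E \<rightarrow>\<^sub>E R \<and> finite {\<alpha> \<in> E. c \<alpha> \<noteq> \<zero>} \<and>
     a = finsum A (\<lambda>\<alpha>. c \<alpha> \<otimes> xpow \<alpha>) {\<alpha> \<in> E. c \<alpha> \<noteq> \<zero>}"
    using basis a by (simp add: free_left_basis_def)
  have "c' \<in> E \<rightarrow>\<^sub>E R" "finite {\<alpha> \<in> E. c' \<alpha> \<noteq> \<zero>}"
    using c finite_subset[OF supp S(1)] by (auto simp: c'_def)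
  then have "coef a = c'"
    using ex1 coef_props[OF a] 1 by blast
  then show ?thesis using \<open>\<alpha> \<in> E\<close> by (simp add: a_def c'_def)
qed

lemma coef_expand:
  assumes "a \<in> carrier A" "finite S" "S \<subseteq> E" "{\<alpha> \<in> E. coef a \<alpha> \<noteq> \<zero>} \<subseteq> S"
  shows "a = finsum A (\<lambda>\<alpha>. coef a \<alpha> \<otimes> xpow \<alpha>) S"
  by (subst coef_props(3)[OF assms(1)])
     (use assms in \<open>intro add.finprod_mono_neutral_cong_left; auto\<close>)

lemma coef_add [simp]:
  assumes "a \<in> carrier A" "b \<in> carrier A" "\<alpha> \<in> E"
  shows "coef (a \<oplus> b) \<alpha> = coef a \<alpha> \<oplus> coef b \<alpha>"
proof -
  define S where "S = {\<alpha> \<in> E. coef a \<alpha> \<noteq> \<zero>} \<union> {\<alpha> \<in> E. coef b \<alpha> \<noteq> \<zero>}"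
  have S: "finite S" "S \<subseteq> E" using coef_props(2) assms by (auto simp: S_def)
  have "a \<oplus> b = finsum A (\<lambda>\<alpha>. coef a \<alpha> \<otimes> xpow \<alpha>) S \<oplus> finsum A (\<lambda>\<alpha>. coef b \<alpha> \<otimes> xpow \<alpha>) S"
    using coef_expand[OF assms(1) S] coef_expand[OF assms(2) S] by (auto simp: S_def)
  also have "\<dots> = finsum A (\<lambda>\<alpha>. (coef a \<alpha> \<otimes> xpow \<alpha>) \<oplus> (coef b \<alpha> \<otimes> xpow \<alpha>)) S"
    using S assms by (intro finsum_addf[symmetric]) auto
  also have "\<dots> = finsum A (\<lambda>\<alpha>. (coef a \<alpha> \<oplus> coef b \<alpha>) \<otimes> xpow \<alpha>) S"
    using S assms by (intro finsum_cong') (auto simp: l_distr)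
  finally have *: "a \<oplus> b = \<dots>" .
  show ?thesis
    unfolding * by (rule coef_finsum) (use S assms in \<open>auto simp: S_def\<close>)
qed

lemma coef_scalar [simp]:
  assumes "r \<in> R" "a \<in> carrier A" "\<alpha> \<in> E"
  shows "coef (r \<otimes> a) \<alpha> = r \<otimes> coef a \<alpha>"
proof -
  define S where "S = {\<alpha> \<in> E. coef a \<alpha> \<noteq> \<zero>}"
  have S: "finite S" "S \<subseteq> E" using coef_props(2) assms by (auto simp: S_def)
  have "r \<otimes> a = r \<otimes> finsum A (\<lambda>\<alpha>. coef a \<alpha> \<otimes> xpow \<alpha>) S"
    using coef_expand[OF assms(2) S] by (auto simp: S_def)
  also have "\<dots> = finsum A (\<lambda>\<alpha>. r \<otimes> (coef a \<alpha> \<otimes> xpow \<alpha>)) S"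
    using S assms by (intro finsum_rdistr) auto
  also have "\<dots> = finsum A (\<lambda>\<alpha>. (r \<otimes> coef a \<alpha>) \<otimes> xpow \<alpha>) S"
    using S assms by (intro finsum_cong') (auto simp: m_assoc)
  finally have *: "r \<otimes> a = \<dots>" .
  show ?thesis
    unfolding * by (rule coef_finsum) (use S assms in \<open>auto simp: S_def\<close>)
qed

lemma coef_zero [simp]: "\<alpha> \<in> E \<Longrightarrow> coef \<zero> \<alpha> = \<zero>"
  using coef_scalar[of \<zero> \<zero> \<alpha>] by simp

lemma coef_neg [simp]: "a \<in> carrier A \<Longrightarrow> \<alpha> \<in> E \<Longrightarrow> coef (\<ominus> a) \<alpha> = \<ominus> coef a \<alpha>"
  using coef_scalar[of "\<ominus> \<one>" a \<alpha>] by (simp add: l_minus)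

lemma coef_minus [simp]:
  "a \<in> carrier A \<Longrightarrow> b \<in> carrier A \<Longrightarrow> \<alpha> \<in> E \<Longrightarrow> coef (a \<ominus> b) \<alpha> = coef a \<alpha> \<ominus> coef b \<alpha>"
  by (simp add: a_minus_def)

lemma coef_xpow [simp]:
  assumes "\<alpha> \<in> E" "\<beta> \<in> E"
  shows "coef (xpow \<beta>) \<alpha> = (if \<alpha> = \<beta> then \<one> else \<zero>)"
  using coef_finsum[of "{\<beta>}" "\<lambda>\<alpha>. if \<alpha> = \<beta> then \<one> else \<zero>" \<alpha>] assms by simp

lemma coef_one [simp]: "\<alpha> \<in> E \<Longrightarrow> coef \<one> \<alpha> = (if \<alpha> = (\<lambda>_. 0) then \<one> else \<zero>)"
  using coef_xpow[of \<alpha> "\<lambda>_. 0"] by simp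

lemma coef_R [simp]: "r \<in> R \<Longrightarrow> \<alpha> \<in> E \<Longrightarrow> coef r \<alpha> = (if \<alpha> = (\<lambda>_. 0) then r else \<zero>)"
  using coef_scalar[of r \<one> \<alpha>] by simp

text \<open>Replaces finite sums by induction over terms. The summands keep the coefficients of the
  fixed \<open>a\<close>, so what is known about these stays available.\<close>

lemma coef_induct [consumes 1, case_names zero add summand]:
  assumes a: "a \<in> carrier A" and "P \<zero>"
    and add: "\<And>b c. b \<in> carrier A \<Longrightarrow> c \<in> carrier A \<Longrightarrow> P b \<Longrightarrow> P c \<Longrightarrow> P (b \<oplus> c)"
    and summand: "\<And>\<alpha>. \<alpha> \<in> E \<Longrightarrow> P (coef a \<alpha> \<otimes> xpow \<alpha>)"
  shows "P a"
proof -
  have "P (finsum A (\<lambda>\<alpha>. coef a \<alpha> \<otimes> xpow \<alpha>) S)" if "finite S" "S \<subseteq> E" for S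
    using that
  proof (induction S)
    case (insert \<alpha> S)
    then have "finsum A (\<lambda>\<alpha>. coef a \<alpha> \<otimes> xpow \<alpha>) (insert \<alpha> S)
        = (coef a \<alpha> \<otimes> xpow \<alpha>) \<oplus> finsum A (\<lambda>\<alpha>. coef a \<alpha> \<otimes> xpow \<alpha>) S"
      using a by (intro finsum_insert) auto
    moreover have "finsum A (\<lambda>\<alpha>. coef a \<alpha> \<otimes> xpow \<alpha>) S \<in> carrier A"
      using insert a by (intro finsum_closed) auto
    ultimately show ?case
      using insert summand a by (auto intro!: add)
  qed (simp add: assms)
  from this[OF coef_props(2)[OF a]] coef_props(3)[OF a] show ?thesis by auto
qed

section \<open>Ideals of the base ring and their extensions\<close>

text \<open>Ideals of the subring, expressed with the operations of \<open>A\<close> so that no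
  second ring structure has to be carried along.\<close>

definition base_ideal :: "'a set \<Rightarrow> bool" where
  "base_ideal J \<longleftrightarrow> J \<subseteq> R \<and> \<zero> \<in> J \<and> (\<forall>a \<in> J. \<forall>b \<in> J. a \<oplus> b \<in> J) \<and>
     (\<forall>r \<in> R. \<forall>a \<in> J. r \<otimes> a \<in> J \<and> a \<otimes> r \<in> J)"

definition stable_ideal :: "'a set \<Rightarrow> bool" where
  "stable_ideal J \<longleftrightarrow> base_ideal J \<and> (\<forall>i \<in> {1..n}. \<forall>a \<in> J. \<delta> i a \<in> J)"

lemma base_idealD:
  assumes "base_ideal J"
  shows "\<And>a. a \<in> J \<Longrightarrow> a \<in> R" "\<And>a. a \<in> J \<Longrightarrow> a \<in> carrier A" "\<zero> \<in> J"
    "\<And>a b. a \<in> J \<Longrightarrow> b \<in> J \<Longrightarrow> a \<oplus> b \<in> J"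
    "\<And>r a. r \<in> R \<Longrightarrow> a \<in> J \<Longrightarrow> r \<otimes> a \<in> J"
    "\<And>r a. r \<in> R \<Longrightarrow> a \<in> J \<Longrightarrow> a \<otimes> r \<in> J"
    "\<And>a. a \<in> J \<Longrightarrow> \<ominus> a \<in> J"
    "\<And>a b. a \<in> J \<Longrightarrow> b \<in> J \<Longrightarrow> a \<ominus> b \<in> J"
proof -
  show R: "a \<in> R" and "a \<in> carrier A" if "a \<in> J" for a
    using assms that by (auto simp: base_ideal_def)
  show "\<zero> \<in> J" using assms by (auto simp: base_ideal_def)
  show add: "a \<oplus> b \<in> J" if "a \<in> J" "b \<in> J" for a b
    using assms that by (auto simp: base_ideal_def)
  show l: "r \<otimes> a \<in> J" "a \<otimes> r \<in> J" if "r \<in> R" "a \<in> J" for r a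
    using assms that by (auto simp: base_ideal_def)
  show neg: "\<ominus> a \<in> J" if "a \<in> J" for a
    using l(1)[of "\<ominus> \<one>" a] that R[of a] by (simp add: l_minus)
  show "a \<ominus> b \<in> J" if "a \<in> J" "b \<in> J" for a b
    using that add neg by (simp add: a_minus_def)
qed

lemma stable_idealD:
  assumes "stable_ideal J"
  shows "base_ideal J" "\<And>i a. i \<in> {1..n} \<Longrightarrow> a \<in> J \<Longrightarrow> \<delta> i a \<in> J"
  using assms by (auto simp: stable_ideal_def)

lemma ideal_iff_base_ideal: "ideal J (A\<lparr>carrier := R\<rparr>) \<longleftrightarrow> base_ideal J"
proof
  assume "ideal J (A\<lparr>carrier := R\<rparr>)"
  then interpret J: ideal J "A\<lparr>carrier := R\<rparr>" .
  have "J \<subseteq> R" using J.Icarr by auto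
  moreover have "\<zero> \<in> J" using additive_subgroup.zero_closed[OF J.is_additive_subgroup] by simp
  ultimately show "base_ideal J"
    using additive_subgroup.a_closed[OF J.is_additive_subgroup] J.I_l_closed J.I_r_closed
    unfolding base_ideal_def by simp
next
  assume J: "base_ideal J"
  note D = base_idealD[OF J]
  interpret R: ring "A\<lparr>carrier := R\<rparr>"
    using subring_is_ring[OF subring_R] .
  show "ideal J (A\<lparr>carrier := R\<rparr>)"
  proof (rule idealI)
    show "subgroup J (add_monoid (A\<lparr>carrier := R\<rparr>))"
    proof (rule R.add.subgroupI)
      fix a assume a: "a \<in> J"
      then have "\<ominus>\<^bsub>A\<lparr>carrier := R\<rparr>\<^esub> a = \<ominus>\<^bsub>A\<lparr>carrier := R\<rparr>\<^esub> \<one> \<otimes> a"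
        using R.l_minus[of \<one> a] D(1)[OF a] by simp
      moreover have "\<ominus>\<^bsub>A\<lparr>carrier := R\<rparr>\<^esub> \<one> \<in> R"
        using R.a_inv_closed[of \<one>] by simp
      ultimately show "\<ominus>\<^bsub>A\<lparr>carrier := R\<rparr>\<^esub> a \<in> J"
        using D(5) a by simp
    qed (use D in auto)
  qed (simp_all add: D R.ring_axioms)
qed

lemma invariant_ideal_iff: "invariant_ideal (A\<lparr>carrier := R\<rparr>) (\<delta> ` {1..n}) J \<longleftrightarrow> stable_ideal J"
  unfolding invariant_ideal_def stable_ideal_def ideal_iff_base_ideal by auto

lemma stable_ideal_zero: "stable_ideal {\<zero>}"
  by (auto simp: stable_ideal_def base_ideal_def)

text \<open>Degree less than \<open>d\<close> modulo \<open>J A\<close>; thus \<open>below J 0\<close> is \<open>J A\<close> and \<open>below {\<zero>}\<close> is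
  the degree filtration.\<close>

definition below :: "'a set \<Rightarrow> nat \<Rightarrow> 'a set" where
  "below J d = {a \<in> carrier A. \<forall>\<alpha> \<in> E. d \<le> dg \<alpha> \<longrightarrow> coef a \<alpha> \<in> J}"

abbreviation "ext J \<equiv> below J 0"
abbreviation "low d \<equiv> below {\<zero>} d"

lemma below_carrier [simp]: "a \<in> below J d \<Longrightarrow> a \<in> carrier A"
  unfolding below_def by simp

lemma below_coef: "a \<in> below J d \<Longrightarrow> \<alpha> \<in> E \<Longrightarrow> d \<le> dg \<alpha> \<Longrightarrow> coef a \<alpha> \<in> J"
  unfolding below_def by simp

lemma below_mono: "a \<in> below J d \<Longrightarrow> d \<le> e \<Longrightarrow> a \<in> below J e"
  unfolding below_def by auto

context
  fixes J assumes J: "base_ideal J"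
begin

lemma below_zero [simp]: "\<zero> \<in> below J d"
  using base_idealD[OF J] unfolding below_def by simp

lemma below_add: "a \<in> below J d \<Longrightarrow> b \<in> below J d \<Longrightarrow> a \<oplus> b \<in> below J d"
  using base_idealD[OF J] unfolding below_def by simp

lemma below_minus: "a \<in> below J d \<Longrightarrow> b \<in> below J d \<Longrightarrow> a \<ominus> b \<in> below J d"
  using base_idealD[OF J] unfolding below_def by simp

lemma below_neg: "a \<in> below J d \<Longrightarrow> \<ominus> a \<in> below J d"
  using base_idealD[OF J] unfolding below_def by simp

lemma below_scalar: "r \<in> R \<Longrightarrow> a \<in> below J d \<Longrightarrow> r \<otimes> a \<in> below J d"
  using base_idealD[OF J] unfolding below_def by simp

lemma ideal_times_below: "j \<in> J \<Longrightarrow> a \<in> carrier A \<Longrightarrow> j \<otimes> a \<in> below J d"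
  using base_idealD[OF J] unfolding below_def by simp

lemma ext_below: "a \<in> ext J \<Longrightarrow> a \<in> below J d"
  using below_mono by auto

lemma low_below: "a \<in> low d \<Longrightarrow> a \<in> below J d"
  using base_idealD(3)[OF J] unfolding below_def by auto

lemma xpow_below: "\<alpha> \<in> E \<Longrightarrow> dg \<alpha> < d \<Longrightarrow> xpow \<alpha> \<in> below J d"
  using base_idealD(3)[OF J] unfolding below_def by auto

end

lemma below_induct [consumes 2, case_names zero add low ideal]:
  assumes J: "base_ideal J" and a: "a \<in> below J d" and zero: "P \<zero>"
    and add: "\<And>b c. b \<in> carrier A \<Longrightarrow> c \<in> carrier A \<Longrightarrow> P b \<Longrightarrow> P c \<Longrightarrow> P (b \<oplus> c)"
    and low: "\<And>r \<alpha>. r \<in> R \<Longrightarrow> \<alpha> \<in> E \<Longrightarrow> dg \<alpha> < d \<Longrightarrow> P (r \<otimes> xpow \<alpha>)"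
    and ideal: "\<And>j \<alpha>. j \<in> J \<Longrightarrow> \<alpha> \<in> E \<Longrightarrow> P (j \<otimes> xpow \<alpha>)"
  shows "P a"
  using below_carrier[OF a]
proof (induction rule: coef_induct)
  case (summand \<alpha>)
  show ?case
  proof (cases "dg \<alpha> < d")
    case True
    then show ?thesis using low summand below_carrier[OF a] by simp
  next
    case False
    then show ?thesis using ideal summand below_coef[OF a] by simp
  qed
qed (fact zero, fact add)

lemma x_scalar_times:
  assumes "i \<in> {1..n}" "r \<in> R" "a \<in> carrier A"
  shows "x i \<otimes> (r \<otimes> a) = r \<otimes> (x i \<otimes> a) \<oplus> \<delta> i r \<otimes> a"
proof -
  have "x i \<otimes> (r \<otimes> a) = (x i \<otimes> r) \<otimes> a" using assms by (simp add: m_assoc)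
  also have "\<dots> = r \<otimes> (x i \<otimes> a) \<oplus> \<delta> i r \<otimes> a"
    unfolding x_scalar[OF assms(1,2)] using assms by (simp add: l_distr m_assoc)
  finally show ?thesis .
qed

section \<open>Extension and contraction of invariant ideals\<close>

context
  fixes J assumes J: "stable_ideal J"
begin

text \<open>Here invariance enters: in \<open>x\<^sub>i j = j x\<^sub>i + \<delta>\<^sub>i j\<close>
  both coefficients stay in \<open>J\<close>.\<close>

lemma x_times_ext:
  assumes "a \<in> ext J" and i: "i \<in> {1..n}"
  shows "x i \<otimes> a \<in> ext J"
  using stable_idealD(1)[OF J] assms(1)
proof (induction rule: below_induct)
  case (ideal j \<alpha>)
  then show ?case
    using i stable_idealD[OF J] base_idealD(1)[OF stable_idealD(1)[OF J]]
    by (simp add: x_scalar_times below_add ideal_times_below)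
qed (use i in \<open>auto simp: r_distr below_add stable_idealD(1)[OF J]\<close>)

lemma ext_left:
  assumes "b \<in> carrier A" and a: "a \<in> ext J"
  shows "b \<otimes> a \<in> ext J"
  using assms(1)
proof (induction rule: coef_induct)
  case (summand \<alpha>)
  from summand have "xpow \<alpha> \<otimes> a \<in> ext J"
  proof (induction rule: exponents_induct)
    case (bump i \<beta>)
    then show ?case using a x_times_ext by (simp add: xpow_bump m_assoc)
  qed (use a in auto)
  then show ?case
    using summand a assms(1) below_scalar[OF stable_idealD(1)[OF J]] by (simp add: m_assoc)
qed (use a in \<open>auto simp: l_distr below_add stable_idealD(1)[OF J]\<close>)

lemma ext_right:
  assumes "a \<in> ext J" and b: "b \<in> carrier A"
  shows "a \<otimes> b \<in> ext J"
  using stable_idealD(1)[OF J] assms(1)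
proof (induction rule: below_induct)
  case (ideal j \<alpha>)
  then show ?case
    using b base_idealD(2)[OF stable_idealD(1)[OF J]]
    by (simp add: m_assoc ideal_times_below stable_idealD(1)[OF J])
qed (use b in \<open>auto simp: l_distr below_add stable_idealD(1)[OF J]\<close>)

lemma ext_ideal: "ideal (ext J) A"
proof (rule idealI)
  show "subgroup (ext J) (add_monoid A)"
  proof (rule add.subgroupI)
    show "ext J \<noteq> {}" using below_zero[OF stable_idealD(1)[OF J]] by blast
  qed (auto simp: below_add below_neg stable_idealD(1)[OF J])
qed (simp_all add: ext_left ext_right ring_axioms)

lemma ideal_prod_right_eq_ext: "ideal_prod A J (carrier A) = ext J"
proof
  note B = stable_idealD(1)[OF J]
  show "ideal_prod A J (carrier A) \<subseteq> ext J"
  proof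
    fix a assume "a \<in> ideal_prod A J (carrier A)"
    then show "a \<in> ext J"
      by induction (auto intro: ideal_times_below[OF B] below_add[OF B])
  qed
  show "ext J \<subseteq> ideal_prod A J (carrier A)"
  proof
    fix a assume a: "a \<in> ext J"
    have "\<zero> \<otimes> \<zero> \<in> ideal_prod A J (carrier A)"
      using base_idealD(3)[OF B] by (intro ideal_prod.prod) auto
    with B a show "a \<in> ideal_prod A J (carrier A)"
      by (induction rule: below_induct) (auto intro: ideal_prod.intros)
  qed
qed

lemma ideal_prod_left_eq_ext: "ideal_prod A (carrier A) J = ext J"
proof
  note B = stable_idealD(1)[OF J]
  note D = base_idealD[OF B]
  let ?P = "ideal_prod A (carrier A) J"
  show "?P \<subseteq> ext J"
  proof
    fix a assume "a \<in> ?P"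
    then show "a \<in> ext J"
    proof induction
      case (prod b j)
      moreover have "j \<in> ext J" using D prod ideal_times_below[OF B, of j \<one> 0] by simp
      ultimately show ?case by (intro ext_left) auto
    qed (auto intro: below_add[OF B])
  qed
  have car: "?P \<subseteq> carrier A"
  proof
    fix a assume "a \<in> ?P"
    then show "a \<in> carrier A" by induction (use D in auto)
  qed
  have left: "b \<otimes> a \<in> ?P" if "a \<in> ?P" "b \<in> carrier A" for a b
    using that(1)
  proof induction
    case (prod c j)
    then show ?case using that ideal_prod.prod[of "b \<otimes> c" "carrier A" j J A] D by (simp add: m_assoc)
  next
    case (sum s1 s2)
    moreover from sum car have "s1 \<in> carrier A" "s2 \<in> carrier A" by auto
    ultimately show ?case using that ideal_prod.sum by (simp add: r_distr)
  qed
  have base: "j \<in> ?P" if "j \<in> J" for j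
    using ideal_prod.prod[of \<one> "carrier A" j J A] that D by simp
  have trm: "j \<otimes> xpow \<alpha> \<in> ?P" if "\<alpha> \<in> E" "j \<in> J" for j \<alpha>
    using that
  proof (induction arbitrary: j rule: exponents_induct)
    case zero
    then show ?case using base D by simp
  next
    case (bump i \<beta>)
    have c: "j \<in> R" "\<delta> i j \<in> J" using D bump stable_idealD[OF J] by auto
    \<comment> \<open>The relation for \<open>x i\<close> is read backwards. The correction has
      coefficient \<open>- \<delta> i j\<close>, again in \<open>J\<close>, which is why the
      induction leaves \<open>j\<close> arbitrary.\<close>
    have "j \<otimes> xpow (bump i \<beta>) = x i \<otimes> (j \<otimes> xpow \<beta>) \<oplus> (\<ominus> \<delta> i j) \<otimes> xpow \<beta>"
      using bump.hyps c D by (simp add: xpow_bump x_scalar_times l_minus a_assoc r_neg)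
    also have "\<dots> \<in> ?P"
      using bump c D left by (intro ideal_prod.sum) auto
    finally show ?case .
  qed
  show "ext J \<subseteq> ?P"
  proof
    fix a assume a: "a \<in> ext J"
    with B show "a \<in> ?P"
      by (induction rule: below_induct) (auto intro: ideal_prod.sum trm base D)
  qed
qed

lemma ext_inter_R: "ext J \<inter> R = J"
proof
  note D = base_idealD[OF stable_idealD(1)[OF J]]
  show "ext J \<inter> R \<subseteq> J"
  proof
    fix a assume a: "a \<in> ext J \<inter> R"
    then show "a \<in> J" using below_coef[of a J 0 "\<lambda>_. 0"] by simp
  qed
  show "J \<subseteq> ext J \<inter> R"
    using D unfolding below_def by auto
qed

end

lemma ext_subset_iff: "stable_ideal J \<Longrightarrow> stable_ideal I \<Longrightarrow> ext J \<subseteq> ext I \<longleftrightarrow> J \<subseteq> I"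
proof -
  assume J: "stable_ideal J" and I: "stable_ideal I"
  show "ext J \<subseteq> ext I \<longleftrightarrow> J \<subseteq> I"
  proof
    assume "ext J \<subseteq> ext I"
    then show "J \<subseteq> I" using ext_inter_R[OF J] ext_inter_R[OF I] by blast
  next
    assume "J \<subseteq> I"
    then show "ext J \<subseteq> ext I" unfolding below_def by blast
  qed
qed

text \<open>Extension carries a product of invariant ideals inside \<open>I\<close> to one inside
  \<open>I A\<close>, and contraction to \<open>R\<close> recovers the inclusions.\<close>

lemma nc_prime_imp_invariant_prime:
  assumes I: "stable_ideal I" "I \<noteq> R" and prime: "nc_prime_ideal A (ext I)"
  shows "invariant_prime_ideal (A\<lparr>carrier := R\<rparr>) (\<delta> ` {1..n}) I"
  unfolding invariant_prime_ideal_def invariant_ideal_iff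
proof (intro conjI allI impI)
  fix J K assume J: "stable_ideal J" and K: "stable_ideal K"
    and JK: "ideal_prod (A\<lparr>carrier := R\<rparr>) J K \<subseteq> I"
  note BI = stable_idealD(1)[OF I(1)] and BJ = stable_idealD(1)[OF J] and BK = stable_idealD(1)[OF K]
  have prod: "j \<otimes> k \<in> I" if "j \<in> J" "k \<in> K" for j k
    using ideal_prod.prod[of j J k K "A\<lparr>carrier := R\<rparr>"] that JK by auto
  have fg: "f \<otimes> g \<in> ext I" if f: "f \<in> ext J" and g: "g \<in> ext K" for f g
    using BJ f
  proof (induction rule: below_induct)
    case (ideal j \<alpha>)
    \<comment> \<open>Since \<open>ext K\<close> absorbs the monomial, only products of
      \<open>j\<close> with coefficients in \<open>K\<close> remain.\<close>
    have "xpow \<alpha> \<otimes> g \<in> ext K" using ext_left[OF K] ideal g by simp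
    then have "j \<otimes> (xpow \<alpha> \<otimes> g) \<in> ext I"
      using ideal prod base_idealD[OF BJ] unfolding below_def by simp
    then show ?case using ideal g base_idealD[OF BJ] by (simp add: m_assoc)
  qed (use g below_carrier[OF g] in \<open>auto simp: l_distr below_add[OF BI] below_zero[OF BI]\<close>)
  have "ideal_prod A (ext J) (ext K) \<subseteq> ext I"
  proof
    fix a assume "a \<in> ideal_prod A (ext J) (ext K)"
    then show "a \<in> ext I" by induction (auto simp: fg below_add[OF BI])
  qed
  then have "ext J \<subseteq> ext I \<or> ext K \<subseteq> ext I"
    using prime ext_ideal[OF J] ext_ideal[OF K] by (simp add: nc_prime_ideal_def)
  then show "J \<subseteq> I \<or> K \<subseteq> I"
    using ext_subset_iff I J K by simp
qed (use I in auto)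

section \<open>Commutation and leading terms\<close>

abbreviation "unit1 i \<equiv> bump i (\<lambda>_. 0)"
abbreviation "unit2 i j \<equiv> bump i (bump j (\<lambda>_. 0))"

section \<open>Centre and central units of the base ring\<close>

definition center :: "'a set" where
  "center = {z \<in> R. \<forall>r \<in> R. z \<otimes> r = r \<otimes> z}"

definition central_units :: "'a set" where
  "central_units = {u \<in> center. \<exists>v \<in> R. u \<otimes> v = \<one>}"

lemma centerD:
  assumes "z \<in> center"
  shows "z \<in> R" "z \<in> carrier A" "\<And>r. r \<in> R \<Longrightarrow> z \<otimes> r = r \<otimes> z"
  using assms by (auto simp: center_def)

lemma center_zero [simp]: "\<zero> \<in> center"
  by (simp add: center_def)

lemma center_one [simp]: "\<one> \<in> center"
  by (simp add: center_def)

lemma center_neg: "z \<in> center \<Longrightarrow> \<ominus> z \<in> center"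
  by (simp add: center_def l_minus r_minus)

lemma center_add: "y \<in> center \<Longrightarrow> z \<in> center \<Longrightarrow> y \<oplus> z \<in> center"
  by (simp add: center_def l_distr r_distr)

lemma center_minus: "y \<in> center \<Longrightarrow> z \<in> center \<Longrightarrow> y \<ominus> z \<in> center"
  by (simp add: a_minus_def center_add center_neg)

lemma center_mult: "y \<in> center \<Longrightarrow> z \<in> center \<Longrightarrow> y \<otimes> z \<in> center"
proof -
  assume yz: "y \<in> center" "z \<in> center"
  have "y \<otimes> z \<otimes> r = r \<otimes> (y \<otimes> z)" if r: "r \<in> R" for r
  proof -
    have "y \<otimes> z \<otimes> r = (y \<otimes> r) \<otimes> z"
      using centerD(3)[OF yz(2) r] centerD(2)[OF yz(1)] centerD(2)[OF yz(2)] r by (simp add: m_assoc)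
    also have "\<dots> = r \<otimes> (y \<otimes> z)"
      unfolding centerD(3)[OF yz(1) r]
      using centerD(2)[OF yz(1)] centerD(2)[OF yz(2)] r by (simp add: m_assoc)
    finally show ?thesis .
  qed
  then show ?thesis using centerD(1)[OF yz(1)] centerD(1)[OF yz(2)] by (simp add: center_def)
qed

lemma one_central_unit [simp]: "\<one> \<in> central_units"
  by (auto simp: central_units_def intro!: bexI[of _ \<one>])

lemma central_units_mult:
  assumes "u \<in> central_units" "v \<in> central_units"
  shows "u \<otimes> v \<in> central_units"
proof -
  obtain u' v' where *: "u' \<in> R" "u \<otimes> u' = \<one>" "v' \<in> R" "v \<otimes> v' = \<one>"
    using assms by (auto simp: central_units_def)
  have c: "u \<in> center" "v \<in> center" using assms by (auto simp: central_units_def)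
  have "(u \<otimes> v) \<otimes> (v' \<otimes> u') = u \<otimes> ((v \<otimes> v') \<otimes> u')"
    using c *(1,3) by (simp add: m_assoc centerD)
  also have "\<dots> = \<one>" using * by simp
  finally show ?thesis
    using R_closed(5)[OF *(3,1)] center_mult[OF c] unfolding central_units_def by blast
qed

lemma zero_base_ideal: "base_ideal {\<zero>}"
  using stable_idealD(1)[OF stable_ideal_zero] .

lemmas low_simps = below_add[OF zero_base_ideal] below_minus[OF zero_base_ideal]
  below_neg[OF zero_base_ideal] below_scalar[OF zero_base_ideal] xpow_below[OF zero_base_ideal]
  below_zero[OF zero_base_ideal]

lemma coef_low: "a \<in> low d \<Longrightarrow> \<alpha> \<in> E \<Longrightarrow> d \<le> dg \<alpha> \<Longrightarrow> coef a \<alpha> = \<zero>"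
  using below_coef[of a "{\<zero>}" d \<alpha>] by simp

section \<open>Elements of degree at most one and quadratic monomials\<close>

lemma xpow_unit1: "i \<in> {1..n} \<Longrightarrow> xpow (unit1 i) = x i"
  by (subst xpow_bump) auto

lemma xpow_unit2: "i \<in> {1..n} \<Longrightarrow> j \<in> {1..n} \<Longrightarrow> i \<le> j \<Longrightarrow> xpow (unit2 i j) = x i \<otimes> x j"
  by (subst xpow_bump) (auto simp: xpow_unit1, auto simp: bump_def)

lemma x_low: "i \<in> {1..n} \<Longrightarrow> 2 \<le> d \<Longrightarrow> x i \<in> low d"
  using low_simps(5)[of "unit1 i" d] by (simp add: xpow_unit1)

lemma R_low: "r \<in> R \<Longrightarrow> 1 \<le> d \<Longrightarrow> r \<in> low d"
  using low_simps(4)[OF _ low_simps(5)[of "\<lambda>_. 0" d], of r] by simp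

lemma coef_x_unit2 [simp]:
  "i \<in> {1..n} \<Longrightarrow> j \<in> {1..n} \<Longrightarrow> k \<in> {1..n} \<Longrightarrow> coef (x i) (unit2 j k) = \<zero>"
  by (rule coef_low[OF x_low[of i 2]]) auto

lemma coef_x_unit1: "i \<in> {1..n} \<Longrightarrow> j \<in> {1..n} \<Longrightarrow> coef (x i) (unit1 j) = (if i = j then \<one> else \<zero>)"
  using coef_xpow[of "unit1 j" "unit1 i"] by (simp add: xpow_unit1) (auto simp: bump_def fun_eq_iff)

lemma coef_R_units [simp]:
  "r \<in> R \<Longrightarrow> i \<in> {1..n} \<Longrightarrow> coef r (unit1 i) = \<zero>"
  "r \<in> R \<Longrightarrow> i \<in> {1..n} \<Longrightarrow> j \<in> {1..n} \<Longrightarrow> coef r (unit2 i j) = \<zero>"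
  by (rule coef_low[OF R_low[of r 1]]; simp)+

lemma low2_induct [consumes 1, case_names add const lin]:
  assumes a: "a \<in> low 2"
    and add: "\<And>b c. b \<in> carrier A \<Longrightarrow> c \<in> carrier A \<Longrightarrow> P b \<Longrightarrow> P c \<Longrightarrow> P (b \<oplus> c)"
    and const: "\<And>r. r \<in> R \<Longrightarrow> P r"
    and lin: "\<And>r i. r \<in> R \<Longrightarrow> i \<in> {1..n} \<Longrightarrow> P (r \<otimes> x i)"
  shows "P a"
  using zero_base_ideal a
proof (induction rule: below_induct)
  case (low r \<alpha>)
  then have "dg \<alpha> = 0 \<or> dg \<alpha> = Suc 0" by auto
  then show ?case
  proof
    assume "dg \<alpha> = 0"
    then show ?thesis using low const by (simp add: mdeg_0_iff)
  next
    assume "dg \<alpha> = Suc 0"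
    then obtain i where "i \<in> {1..n}" "\<alpha> = unit1 i" using low by (auto elim: mdeg_1_cases)
    then show ?thesis using low lin by (simp add: xpow_unit1)
  qed
qed (use add const[of \<zero>] in auto)

lemma affine_part_low: "l \<in> affine_part A R n x \<Longrightarrow> l \<in> low 2"
proof -
  have "finsum A (\<lambda>i. r i \<otimes> x i) S \<in> low 2" if "finite S" "S \<subseteq> {1..n}" "r \<in> {1..n} \<rightarrow> R" for r S
    using that
  proof (induction S)
    case (insert i S)
    have "finsum A (\<lambda>i. r i \<otimes> x i) (insert i S) = (r i \<otimes> x i) \<oplus> finsum A (\<lambda>i. r i \<otimes> x i) S"
      using insert by (intro finsum_insert) (auto simp: Pi_iff subset_iff)
    then show ?case using insert by (auto intro!: low_simps x_low)
  qed (simp add: low_simps)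
  moreover assume "l \<in> affine_part A R n x"
  then obtain r0 r where "l = r0 \<oplus> finsum A (\<lambda>i. r i \<otimes> x i) {1..n}" "r0 \<in> R" "r \<in> {1..n} \<rightarrow> R"
    by (auto simp: affine_part_def)
  ultimately show "l \<in> low 2"
    using R_low[of r0 2] by (simp add: low_simps(1))
qed

lemma x_x_commute:
  assumes "i \<in> {1..n}" "j \<in> {1..n}"
  obtains c l where "c \<in> R" "l \<in> low 2" "x j \<otimes> x i = c \<otimes> (x i \<otimes> x j) \<oplus> l"
proof -
  obtain c where c: "c \<in> R" "(x j \<otimes> x i) \<ominus> (c \<otimes> (x i \<otimes> x j)) \<in> affine_part A R n x"
    using commutation[OF assms] by auto
  have "x j \<otimes> x i = c \<otimes> (x i \<otimes> x j) \<oplus> ((x j \<otimes> x i) \<ominus> (c \<otimes> (x i \<otimes> x j)))"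
    using assms c by (simp add: a_minus_def a_lcomm r_neg)
  then show thesis using that c affine_part_low by blast
qed

lemma x_x_scalar:
  assumes "i \<in> {1..n}" "j \<in> {1..n}" "r \<in> R"
  shows "(x i \<otimes> x j) \<otimes> r =
    r \<otimes> (x i \<otimes> x j) \<oplus> (\<delta> i r \<otimes> x j \<oplus> (\<delta> j r \<otimes> x i \<oplus> \<delta> i (\<delta> j r)))"
proof -
  have "(x i \<otimes> x j) \<otimes> r = x i \<otimes> (r \<otimes> x j) \<oplus> x i \<otimes> \<delta> j r"
    using assms x_scalar[of j r] by (simp add: m_assoc r_distr)
  then show ?thesis
    using assms by (simp add: x_scalar_times x_scalar a_assoc)
qed

lemma low2_scalar:
  assumes "a \<in> low 2" "r \<in> R"
  shows "a \<otimes> r \<in> low 2 \<and> (\<forall>i \<in> {1..n}. coef (a \<otimes> r) (unit1 i) = coef a (unit1 i) \<otimes> r)"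
  using assms(1)
proof (induction rule: low2_induct)
  case (add b c)
  then show ?case using assms(2) by (simp add: l_distr low_simps)
next
  case (const s)
  then show ?case using assms(2) R_low[of "s \<otimes> r"] by simp
next
  case (lin s i)
  have "s \<otimes> x i \<otimes> r = (s \<otimes> r) \<otimes> x i \<oplus> s \<otimes> \<delta> i r"
    using lin assms(2) by (simp add: m_assoc x_scalar r_distr)
  then show ?case
    using lin assms(2) by (auto simp: coef_x_unit1 low_simps x_low R_low)
qed

text \<open>Moving \<open>r\<close> to the left through \<open>x\<^sub>j x\<^sub>i\<close> or
  \<open>x\<^sub>i x\<^sub>j\<close> does not change its leading coefficient, so the coordinate at
  \<open>x\<^sub>i x\<^sub>j\<close> gives \<open>c r = r c\<close>. The relation for the exchanged
  pair, read at the same coordinate, supplies the inverse.\<close>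

lemma commutation_coefficient:
  assumes "i \<in> {1..n}" "j \<in> {1..n}" "i < j" "c \<in> R" "l \<in> low 2"
    and eq: "x j \<otimes> x i = c \<otimes> (x i \<otimes> x j) \<oplus> l"
  shows "c \<in> central_units"
proof -
  let ?p = "unit2 i j"
  note l = below_carrier[OF assms(5)]
  have m: "xpow ?p = x i \<otimes> x j" using assms by (simp add: xpow_unit2)
  have cm: "coef (x i \<otimes> x j) ?p = \<one>" unfolding m[symmetric] using assms by simp
  have cl: "coef l ?p = \<zero>" using assms by (intro coef_low) auto
  have cent: "c \<otimes> r = r \<otimes> c" if r: "r \<in> R" for r
  proof -
    have lr: "l \<otimes> r \<in> low 2" using low2_scalar[OF assms(5) r] by simp
    then have clr: "coef (l \<otimes> r) ?p = \<zero>" using assms by (intro coef_low) auto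
    have "coef (x j \<otimes> x i \<otimes> r) ?p = r \<otimes> c"
      unfolding x_x_scalar[OF assms(2,1) r] using assms r l by (simp add: eq cm cl)
    moreover have "x j \<otimes> x i \<otimes> r = c \<otimes> (x i \<otimes> x j \<otimes> r) \<oplus> l \<otimes> r"
      unfolding eq using assms r l by (simp add: l_distr m_assoc)
    then have "coef (x j \<otimes> x i \<otimes> r) ?p = c \<otimes> r"
      unfolding x_x_scalar[OF assms(1,2) r] using assms r l by (simp add: cm clr)
    ultimately show ?thesis by simp
  qed
  obtain c' l' where c': "c' \<in> R" "l' \<in> low 2" "x i \<otimes> x j = c' \<otimes> (x j \<otimes> x i) \<oplus> l'"
    using x_x_commute[OF assms(2,1)] by blast
  have cl': "coef l' ?p = \<zero>" using assms(1,2) c'(2) by (intro coef_low) auto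
  have "coef (x j \<otimes> x i) ?p = c"
    unfolding eq using assms l by (simp add: cm cl)
  then have "coef (c' \<otimes> (x j \<otimes> x i) \<oplus> l') ?p = c' \<otimes> c"
    using assms c'(1) below_carrier[OF c'(2)] by (simp add: cl')
  then have "c \<otimes> c' = \<one>" using cm cent c'(1,3) by simp
  then show ?thesis using cent c'(1) assms(4) by (auto simp: central_units_def center_def)
qed

text \<open>Induction on the degree for all variables at once: exchanging \<open>x\<^sub>i\<close>
  with the first variable of the monomial leaves a remainder of degree at most one, in which any
  variable may occur.\<close>

lemma x_xpow:
  assumes "i \<in> {1..n}" "\<alpha> \<in> E"
  shows "\<exists>u \<in> central_units. \<exists>f \<in> low (Suc (dg \<alpha>)). x i \<otimes> xpow \<alpha> = u \<otimes> xpow (bump i \<alpha>) \<oplus> f"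
  using assms
proof (induction "dg \<alpha>" arbitrary: i \<alpha> rule: less_induct)
  case (less \<alpha> i)
  \<comment> \<open>The induction hypothesis, extended from monomials of degree below
    \<open>dg \<alpha>\<close> to their linear combinations.\<close>
  have x_low_IH: "x j \<otimes> a \<in> low (Suc d)" if a: "a \<in> low d" and j: "j \<in> {1..n}" and d: "d \<le> dg \<alpha>" for a d j
    using zero_base_ideal a
  proof (induction rule: below_induct)
    case (low r \<beta>)
    obtain u f where "u \<in> central_units" "f \<in> low (Suc (dg \<beta>))" "x j \<otimes> xpow \<beta> = u \<otimes> xpow (bump j \<beta>) \<oplus> f"
      using less.hyps[of \<beta> j] j d low by auto
    moreover from this have "f \<in> low (Suc d)" "u \<in> R"
      using low below_mono by (auto simp: central_units_def center_def)
    ultimately show ?case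
      using low j by (auto simp: x_scalar_times intro!: low_simps)
  qed (use j in \<open>auto simp: r_distr low_simps\<close>)
  from less.prems(2) show ?case
  proof (cases rule: exponents_cases)
    case 1
    then show ?thesis
      using less.prems
      by (intro bexI[OF _ one_central_unit] bexI[OF _ low_simps(6)]) (simp add: xpow_unit1)
  next
    case (2 j \<beta>)
    show ?thesis
    proof (cases "i \<le> j")
      case True
      have "xpow (bump i \<alpha>) = x i \<otimes> xpow \<alpha>"
        using less.prems 2 True by (intro xpow_bump) (auto simp: bump_def)
      then show ?thesis
        using less.prems by (intro bexI[OF _ one_central_unit] bexI[OF _ low_simps(6)]) simp
    next
      case False
      note i = less.prems(1) and j = \<open>j \<in> {1..n}\<close> and \<beta> = \<open>\<beta> \<in> E\<close>
      have d: "dg \<alpha> = Suc (dg \<beta>)" using 2 by simp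
      obtain c l where c: "c \<in> R" "l \<in> low 2" "x i \<otimes> x j = c \<otimes> (x j \<otimes> x i) \<oplus> l"
        using x_x_commute[OF j i] by blast
      have cu: "c \<in> central_units"
        using commutation_coefficient[OF j i _ c] False by simp
      obtain u f where u: "u \<in> central_units" "f \<in> low (Suc (dg \<beta>))"
        "x i \<otimes> xpow \<beta> = u \<otimes> xpow (bump i \<beta>) \<oplus> f"
        using less.hyps[of \<beta> i] i \<beta> d by auto
      have uR: "u \<in> R" using u by (auto simp: central_units_def center_def)
      have \<beta>0: "\<And>k. k < j \<Longrightarrow> bump i \<beta> k = 0" using 2 False by (auto simp: bump_def)
      have b: "xpow (bump i \<alpha>) = x j \<otimes> xpow (bump i \<beta>)"
        using xpow_bump[of "bump i \<beta>" j] \<beta>0 i j \<beta> 2(4) by (simp add: bump_commute)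
      note f = below_carrier[OF u(2)] and l = below_carrier[OF c(2)]
      define g where "g = c \<otimes> (\<delta> j u \<otimes> xpow (bump i \<beta>)) \<oplus> (c \<otimes> (x j \<otimes> f) \<oplus> l \<otimes> xpow \<beta>)"
      have "x i \<otimes> xpow \<alpha> = (x i \<otimes> x j) \<otimes> xpow \<beta>"
        using 2 i j \<beta> by (simp add: xpow_bump m_assoc)
      also have "\<dots> = c \<otimes> (x j \<otimes> (x i \<otimes> xpow \<beta>)) \<oplus> l \<otimes> xpow \<beta>"
        unfolding c(3) using i j \<beta> c(1) l by (simp add: l_distr m_assoc)
      also have "x j \<otimes> (x i \<otimes> xpow \<beta>) = u \<otimes> xpow (bump i \<alpha>) \<oplus> \<delta> j u \<otimes> xpow (bump i \<beta>) \<oplus> x j \<otimes> f"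
        unfolding u(3) b using i j \<beta> uR f by (simp add: r_distr x_scalar_times)
      also have "c \<otimes> \<dots> \<oplus> l \<otimes> xpow \<beta> = (c \<otimes> u) \<otimes> xpow (bump i \<alpha>) \<oplus> g"
        unfolding g_def using i j \<beta> uR f c(1) l less.prems(2)
        by (simp add: r_distr m_assoc a_assoc)
      finally have 1: "x i \<otimes> xpow \<alpha> = (c \<otimes> u) \<otimes> xpow (bump i \<alpha>) \<oplus> g" .
      have "l \<otimes> xpow \<beta> \<in> low (Suc (dg \<alpha>))"
        using c(2)
      proof (induction rule: low2_induct)
        case (lin r k)
        have "x k \<otimes> xpow \<beta> \<in> low (Suc (dg \<alpha>))"
          using x_low_IH[of "xpow \<beta>" "Suc (dg \<beta>)" k] lin \<beta> d by (simp add: low_simps)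
        then show ?case using lin \<beta> by (simp add: m_assoc low_simps)
      qed (use \<beta> d in \<open>auto simp: l_distr low_simps\<close>)
      moreover have "x j \<otimes> f \<in> low (Suc (dg \<alpha>))"
        using x_low_IH[of f "Suc (dg \<beta>)" j] u j d by simp
      ultimately have "g \<in> low (Suc (dg \<alpha>))"
        unfolding g_def using c(1) uR i j \<beta> d by (auto intro!: low_simps)
      then show ?thesis using 1 central_units_mult[OF cu u(1)] by blast
    qed
  qed
qed

lemma central_unitsD: "u \<in> central_units \<Longrightarrow> u \<in> R" "u \<in> central_units \<Longrightarrow> u \<in> center"
  by (auto simp: central_units_def center_def)

lemma x_below:
  assumes J: "stable_ideal J" and a: "a \<in> below J d" and i: "i \<in> {1..n}"
  shows "x i \<otimes> a \<in> below J (Suc d)"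
  using stable_idealD(1)[OF J] a
proof (induction rule: below_induct)
  case (low r \<alpha>)
  obtain u f where "u \<in> central_units" "f \<in> low (Suc (dg \<alpha>))" "x i \<otimes> xpow \<alpha> = u \<otimes> xpow (bump i \<alpha>) \<oplus> f"
    using x_xpow[OF i, of \<alpha>] low by auto
  moreover from this have "f \<in> low (Suc d)" "u \<in> R"
    using low below_mono central_unitsD by auto
  ultimately have "x i \<otimes> (r \<otimes> xpow \<alpha>) \<in> low (Suc d)"
    using low i by (auto simp: x_scalar_times intro!: low_simps)
  then show ?case by (rule low_below[OF stable_idealD(1)[OF J]])
next
  case (ideal j \<alpha>)
  then have "j \<otimes> xpow \<alpha> \<in> ext J" by (simp add: ideal_times_below stable_idealD(1)[OF J])
  then show ?case using x_times_ext[OF J _ i] ext_below[OF stable_idealD(1)[OF J]] by blast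
qed (use i in \<open>auto simp: r_distr below_add[OF stable_idealD(1)[OF J]] below_zero[OF stable_idealD(1)[OF J]]\<close>)

lemma xpow_scalar:
  assumes "\<alpha> \<in> E" "r \<in> R"
  shows "\<exists>f \<in> low (dg \<alpha>). xpow \<alpha> \<otimes> r = r \<otimes> xpow \<alpha> \<oplus> f"
  using assms(1)
proof (induction rule: exponents_induct)
  case zero
  then show ?case using assms by (auto intro!: bexI[of _ \<zero>] low_simps)
next
  case (bump i \<beta>)
  then obtain f where f: "f \<in> low (dg \<beta>)" "xpow \<beta> \<otimes> r = r \<otimes> xpow \<beta> \<oplus> f" by blast
  note fc = below_carrier[OF f(1)]
  have "xpow (bump i \<beta>) \<otimes> r = x i \<otimes> (r \<otimes> xpow \<beta> \<oplus> f)"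
    unfolding f(2)[symmetric] using bump assms by (simp add: xpow_bump m_assoc)
  also have "\<dots> = r \<otimes> xpow (bump i \<beta>) \<oplus> (\<delta> i r \<otimes> xpow \<beta> \<oplus> x i \<otimes> f)"
    using bump assms fc by (simp add: xpow_bump r_distr x_scalar_times a_assoc)
  finally have "xpow (bump i \<beta>) \<otimes> r
      = r \<otimes> xpow (bump i \<beta>) \<oplus> (\<delta> i r \<otimes> xpow \<beta> \<oplus> x i \<otimes> f)" .
  moreover have "\<delta> i r \<otimes> xpow \<beta> \<oplus> x i \<otimes> f \<in> low (dg (bump i \<beta>))"
    using bump assms x_below[OF stable_ideal_zero f(1), of i] by (auto intro!: low_simps)
  ultimately show ?case by blast
qed

lemma xpow_mult:
  assumes "\<alpha> \<in> E" "\<beta> \<in> E"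
  shows "\<exists>u \<in> central_units. \<exists>f \<in> low (dg \<alpha> + dg \<beta>).
    xpow \<alpha> \<otimes> xpow \<beta> = u \<otimes> xpow (\<lambda>k. \<alpha> k + \<beta> k) \<oplus> f"
  using assms(1)
proof (induction rule: exponents_induct)
  case zero
  then show ?case using assms by (intro bexI[OF _ one_central_unit] bexI[OF _ low_simps(6)]) simp
next
  case (bump i \<gamma>)
  let ?s = "\<lambda>k. \<gamma> k + \<beta> k"
  obtain u f where u: "u \<in> central_units" "f \<in> low (dg \<gamma> + dg \<beta>)" "xpow \<gamma> \<otimes> xpow \<beta> = u \<otimes> xpow ?s \<oplus> f"
    using bump by blast
  obtain v g where v: "v \<in> central_units" "g \<in> low (Suc (dg ?s))" "x i \<otimes> xpow ?s = v \<otimes> xpow (bump i ?s) \<oplus> g"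
    using x_xpow[of i ?s] bump assms by auto
  have R: "u \<in> R" "v \<in> R" using u v central_unitsD by auto
  note c = below_carrier[OF u(2)] below_carrier[OF v(2)]
  have "xpow (bump i \<gamma>) \<otimes> xpow \<beta> = x i \<otimes> (u \<otimes> xpow ?s \<oplus> f)"
    unfolding u(3)[symmetric] using bump assms by (simp add: xpow_bump m_assoc)
  also have "\<dots> = u \<otimes> (x i \<otimes> xpow ?s) \<oplus> \<delta> i u \<otimes> xpow ?s \<oplus> x i \<otimes> f"
    using bump assms R c by (simp add: r_distr x_scalar_times)
  also have "\<dots> = (u \<otimes> v) \<otimes> xpow (bump i ?s) \<oplus> (u \<otimes> g \<oplus> (\<delta> i u \<otimes> xpow ?s \<oplus> x i \<otimes> f))"
    unfolding v(3) using bump assms R c by (simp add: r_distr m_assoc a_assoc)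
  finally have "xpow (bump i \<gamma>) \<otimes> xpow \<beta>
      = (u \<otimes> v) \<otimes> xpow (\<lambda>k. bump i \<gamma> k + \<beta> k) \<oplus> (u \<otimes> g \<oplus> (\<delta> i u \<otimes> xpow ?s \<oplus> x i \<otimes> f))"
    by (simp add: bump_add)
  moreover have "u \<otimes> g \<oplus> (\<delta> i u \<otimes> xpow ?s \<oplus> x i \<otimes> f) \<in> low (dg (bump i \<gamma>) + dg \<beta>)"
    using bump assms R v(2) x_below[OF stable_ideal_zero u(2), of i]
    by (auto simp: mdeg_add intro!: low_simps)
  ultimately show ?case using central_units_mult[OF u(1) v(1)] by blast
qed

lemma low_times_xpow:
  assumes a: "a \<in> low d" and \<beta>: "\<beta> \<in> E"
  shows "a \<otimes> xpow \<beta> \<in> low (d + dg \<beta>)"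
  using zero_base_ideal a
proof (induction rule: below_induct)
  case (low r \<alpha>)
  obtain u f where u: "u \<in> central_units" "f \<in> low (dg \<alpha> + dg \<beta>)"
      "xpow \<alpha> \<otimes> xpow \<beta> = u \<otimes> xpow (\<lambda>k. \<alpha> k + \<beta> k) \<oplus> f"
    using xpow_mult low \<beta> by blast
  have "f \<in> low (d + dg \<beta>)" using below_mono[OF u(2)] low by simp
  then have "r \<otimes> (xpow \<alpha> \<otimes> xpow \<beta>) \<in> low (d + dg \<beta>)"
    unfolding u(3) using low \<beta> central_unitsD[OF u(1)] by (auto simp: mdeg_add intro!: low_simps)
  then show ?case using low \<beta> by (simp add: m_assoc)
qed (use \<beta> in \<open>auto simp: l_distr low_simps\<close>)

text \<open>All coordinates of at least the total degree are covered: in a product of sums, a pair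
  of terms must also be seen not to contribute to the coordinate of another pair.\<close>

lemma coef_product_of_terms:
  assumes "\<alpha> \<in> E" "\<beta> \<in> E" "a \<in> R" "s \<in> R"
  obtains u where "u \<in> central_units"
    "\<And>\<gamma>. \<gamma> \<in> E \<Longrightarrow> dg \<alpha> + dg \<beta> \<le> dg \<gamma> \<Longrightarrow>
      coef ((a \<otimes> xpow \<alpha>) \<otimes> (s \<otimes> xpow \<beta>)) \<gamma> = (if \<gamma> = (\<lambda>k. \<alpha> k + \<beta> k) then a \<otimes> s \<otimes> u else \<zero>)"
proof -
  obtain f where f: "f \<in> low (dg \<alpha>)" "xpow \<alpha> \<otimes> s = s \<otimes> xpow \<alpha> \<oplus> f"
    using xpow_scalar assms by blast
  obtain u g where u: "u \<in> central_units" "g \<in> low (dg \<alpha> + dg \<beta>)"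
      "xpow \<alpha> \<otimes> xpow \<beta> = u \<otimes> xpow (\<lambda>k. \<alpha> k + \<beta> k) \<oplus> g"
    using xpow_mult assms by blast
  note c = below_carrier[OF f(1)] below_carrier[OF u(2)] central_unitsD(1)[OF u(1)]
  have "(a \<otimes> xpow \<alpha>) \<otimes> (s \<otimes> xpow \<beta>) = a \<otimes> ((xpow \<alpha> \<otimes> s) \<otimes> xpow \<beta>)"
    using assms by (simp add: m_assoc)
  also have "\<dots> = a \<otimes> (s \<otimes> (xpow \<alpha> \<otimes> xpow \<beta>) \<oplus> f \<otimes> xpow \<beta>)"
    unfolding f(2) using assms c by (simp add: l_distr m_assoc)
  also have "\<dots> = (a \<otimes> s \<otimes> u) \<otimes> xpow (\<lambda>k. \<alpha> k + \<beta> k) \<oplus> (a \<otimes> (s \<otimes> g) \<oplus> a \<otimes> (f \<otimes> xpow \<beta>))"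
    unfolding u(3) using assms c by (simp add: r_distr m_assoc a_assoc)
  finally have eq: "(a \<otimes> xpow \<alpha>) \<otimes> (s \<otimes> xpow \<beta>) = \<dots>" .
  have "a \<otimes> (s \<otimes> g) \<oplus> a \<otimes> (f \<otimes> xpow \<beta>) \<in> low (dg \<alpha> + dg \<beta>)"
    using assms u(2) low_times_xpow[OF f(1) assms(2)] by (auto intro!: low_simps)
  note cl = coef_low[OF this] below_carrier[OF this]
  show thesis
  proof (rule that[OF u(1)])
    fix \<gamma> assume \<gamma>: "\<gamma> \<in> E" "dg \<alpha> + dg \<beta> \<le> dg \<gamma>"
    show "coef ((a \<otimes> xpow \<alpha>) \<otimes> (s \<otimes> xpow \<beta>)) \<gamma> = (if \<gamma> = (\<lambda>k. \<alpha> k + \<beta> k) then a \<otimes> s \<otimes> u else \<zero>)"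
      unfolding eq using \<gamma> assms c(3) cl(2) by (subst coef_add) (auto simp: cl(1)[OF \<gamma>])
  qed
qed

section \<open>Commutators of the variables\<close>

definition brk :: "'a \<Rightarrow> 'a \<Rightarrow> 'a" where
  "brk a b = a \<otimes> b \<ominus> b \<otimes> a"

text \<open>Since \<open>unit2 i j\<close> is symmetric in \<open>i\<close> and \<open>j\<close>,
  the coordinate is taken at the ordered product of the two variables. This makes \<open>tau\<close>
  antisymmetric.\<close>

definition tau :: "nat \<Rightarrow> nat \<Rightarrow> 'a" where
  "tau i j = coef (brk (x i) (x j)) (unit2 i j)"

definition lin :: "nat \<Rightarrow> nat \<Rightarrow> 'a" where
  "lin i j = brk (x i) (x j) \<ominus> tau i j \<otimes> xpow (unit2 i j)"

lemma minus_self [simp]: "a \<in> carrier A \<Longrightarrow> a \<ominus> a = \<zero>"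
  by (simp add: a_minus_def r_neg)

lemma add_minus_cancel: "a \<in> carrier A \<Longrightarrow> b \<in> carrier A \<Longrightarrow> (a \<oplus> b) \<ominus> a = b"
  by (simp add: a_minus_def a_comm[of a b] a_assoc r_neg)

lemma add_minus_add:
  "a \<in> carrier A \<Longrightarrow> b \<in> carrier A \<Longrightarrow> c \<in> carrier A \<Longrightarrow> d \<in> carrier A \<Longrightarrow>
    (a \<oplus> b) \<ominus> (c \<oplus> d) = (a \<ominus> c) \<oplus> (b \<ominus> d)"
  by (simp add: a_minus_def minus_add a_assoc a_comm a_lcomm)

lemma minus_telescope:
  assumes "a \<in> carrier A" "b \<in> carrier A" "c \<in> carrier A"
  shows "(a \<ominus> b) \<oplus> (b \<ominus> c) = a \<ominus> c"
  using assms by (simp add: a_minus_def a_assoc r_neg1)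

lemma R_times_x: "r \<in> R \<Longrightarrow> i \<in> {1..n} \<Longrightarrow> r \<otimes> x i \<in> carrier A"
  by simp

lemma brk_closed [simp]: "a \<in> carrier A \<Longrightarrow> b \<in> carrier A \<Longrightarrow> brk a b \<in> carrier A"
  by (simp add: brk_def)

lemma brk_swap: "a \<in> carrier A \<Longrightarrow> b \<in> carrier A \<Longrightarrow> brk b a = \<ominus> brk a b"
  by (simp add: brk_def a_minus_def minus_add a_comm)

lemma brk_add:
  "a \<in> carrier A \<Longrightarrow> b \<in> carrier A \<Longrightarrow> c \<in> carrier A \<Longrightarrow> brk a (b \<oplus> c) = brk a b \<oplus> brk a c"
  by (simp add: brk_def a_minus_def l_distr r_distr minus_add a_assoc a_lcomm)

lemma brk_mult:
  "a \<in> carrier A \<Longrightarrow> b \<in> carrier A \<Longrightarrow> c \<in> carrier A \<Longrightarrow> brk a (b \<otimes> c) = brk a b \<otimes> c \<oplus> b \<otimes> brk a c"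
  by (simp add: brk_def a_minus_def l_distr r_distr m_assoc l_minus r_minus a_assoc r_neg2)
     (simp add: a_lcomm r_neg1 r_neg2)

lemma brk_x_R: "i \<in> {1..n} \<Longrightarrow> r \<in> R \<Longrightarrow> brk (x i) r = \<delta> i r"
  by (simp add: brk_def x_scalar add_minus_cancel)

lemma brk_x_scalar:
  "i \<in> {1..n} \<Longrightarrow> r \<in> R \<Longrightarrow> a \<in> carrier A \<Longrightarrow> brk (x i) (r \<otimes> a) = \<delta> i r \<otimes> a \<oplus> r \<otimes> brk (x i) a"
  by (simp add: brk_mult brk_x_R)

lemma jacobi:
  assumes "a \<in> carrier A" "b \<in> carrier A" "c \<in> carrier A"
  shows "brk a (brk b c) \<oplus> (brk b (brk c a) \<oplus> brk c (brk a b)) = \<zero>"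
proof -
  \<comment> \<open>The six triple products form two cyclic families, grouped so that each
    telescopes in the cyclic sum.\<close>
  have expand: "brk a (brk b c) = (a \<otimes> (b \<otimes> c) \<ominus> b \<otimes> (c \<otimes> a)) \<ominus> (a \<otimes> (c \<otimes> b) \<ominus> c \<otimes> (b \<otimes> a))"
    if "a \<in> carrier A" "b \<in> carrier A" "c \<in> carrier A" for a b c
    using that
    by (simp add: brk_def a_minus_def l_distr r_distr m_assoc l_minus r_minus minus_add a_assoc a_comm a_lcomm)
  have cycle: "(p \<ominus> q) \<oplus> ((q \<ominus> r) \<oplus> (r \<ominus> p)) = \<zero>"
    if "p \<in> carrier A" "q \<in> carrier A" "r \<in> carrier A" for p q r
    using that by (simp add: minus_telescope)
  let ?p = "a \<otimes> (b \<otimes> c)" and ?q = "b \<otimes> (c \<otimes> a)" and ?r = "c \<otimes> (a \<otimes> b)"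
  let ?s = "a \<otimes> (c \<otimes> b)" and ?t = "c \<otimes> (b \<otimes> a)" and ?u = "b \<otimes> (a \<otimes> c)"
  have "brk a (brk b c) \<oplus> (brk b (brk c a) \<oplus> brk c (brk a b))
      = ((?p \<ominus> ?q) \<oplus> ((?q \<ominus> ?r) \<oplus> (?r \<ominus> ?p))) \<ominus> ((?s \<ominus> ?t) \<oplus> ((?u \<ominus> ?s) \<oplus> (?t \<ominus> ?u)))"
    using assms by (simp add: expand add_minus_add)
  also have "(?u \<ominus> ?s) \<oplus> (?t \<ominus> ?u) = (?t \<ominus> ?u) \<oplus> (?u \<ominus> ?s)"
    using assms by (simp add: a_comm)
  finally show ?thesis using assms by (simp add: cycle)
qed

lemma tau_closed [simp]: "i \<in> {1..n} \<Longrightarrow> j \<in> {1..n} \<Longrightarrow> tau i j \<in> R"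
  by (simp add: tau_def)

lemma lin_closed [simp]: "i \<in> {1..n} \<Longrightarrow> j \<in> {1..n} \<Longrightarrow> lin i j \<in> carrier A"
  by (simp add: lin_def)

lemma tau_swap: "i \<in> {1..n} \<Longrightarrow> j \<in> {1..n} \<Longrightarrow> tau j i = \<ominus> tau i j"
  unfolding tau_def by (simp add: brk_swap[of "x i" "x j"] bump_commute[of j i])

lemma lin_swap: "i \<in> {1..n} \<Longrightarrow> j \<in> {1..n} \<Longrightarrow> lin j i = \<ominus> lin i j"
  unfolding lin_def tau_swap[of i j]
  by (simp add: brk_swap[of "x i" "x j"] bump_commute[of j i] tau_swap[of i j] a_minus_def l_minus minus_add a_comm)

lemma tau_self [simp]: "i \<in> {1..n} \<Longrightarrow> tau i i = \<zero>"
  by (simp add: tau_def brk_def a_minus_def r_neg)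

lemma lin_self [simp]: "i \<in> {1..n} \<Longrightarrow> lin i i = \<zero>"
  by (simp add: lin_def brk_def)

text \<open>Read as a commutator, \<open>x\<^sub>j x\<^sub>i = c x\<^sub>i x\<^sub>j + l\<close>
  gives \<open>tau i j = 1 - c\<close> and \<open>lin i j = - l\<close>.\<close>

lemma tau_lin_less:
  assumes ij: "i \<in> {1..n}" "j \<in> {1..n}" and "i < j"
  shows "tau i j \<in> center \<and> lin i j \<in> low 2"
proof -
  obtain c l where c: "c \<in> R" "l \<in> low 2" "x j \<otimes> x i = c \<otimes> (x i \<otimes> x j) \<oplus> l"
    using x_x_commute[OF ij] by blast
  note l = below_carrier[OF c(2)]
  have cc: "c \<in> center"
    using commutation_coefficient[OF ij \<open>i < j\<close> c] central_unitsD by blast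
  have m: "xpow (unit2 i j) = x i \<otimes> x j" using ij \<open>i < j\<close> by (simp add: xpow_unit2)
  have b: "brk (x i) (x j) = (\<one> \<ominus> c) \<otimes> xpow (unit2 i j) \<oplus> \<ominus> l"
    unfolding brk_def c(3) m using ij c(1) l
    by (simp add: a_minus_def l_distr l_minus minus_add a_assoc)
  have cl: "coef l (unit2 i j) = \<zero>"
    using ij c(2) by (intro coef_low) auto
  have t: "tau i j = \<one> \<ominus> c"
    unfolding tau_def b using ij c(1) l by (simp add: cl)
  have "lin i j = \<ominus> l"
    unfolding lin_def t b using ij c(1) l by (simp add: add_minus_cancel)
  then show ?thesis
    using cc c(2) by (simp add: t center_minus low_simps)
qed

lemma tau_center [simp]: "i \<in> {1..n} \<Longrightarrow> j \<in> {1..n} \<Longrightarrow> tau i j \<in> center"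
  using tau_lin_less[of i j] tau_lin_less[of j i] tau_swap[of j i] center_neg
  by (cases i j rule: linorder_cases) auto

lemma lin_low: "i \<in> {1..n} \<Longrightarrow> j \<in> {1..n} \<Longrightarrow> lin i j \<in> low 2"
  using tau_lin_less[of i j] tau_lin_less[of j i] lin_swap[of j i] low_simps(3,6)
  by (cases i j rule: linorder_cases) auto

lemma brk_x_x:
  "i \<in> {1..n} \<Longrightarrow> j \<in> {1..n} \<Longrightarrow> brk (x i) (x j) = tau i j \<otimes> xpow (unit2 i j) \<oplus> lin i j"
  by (simp add: lin_def a_minus_def a_comm a_lcomm r_neg)

lemma unit1_neq_unit2 [simp]: "unit1 k \<noteq> unit2 i j"
proof
  assume *: "unit1 k = unit2 i j"
  have "k = i" using fun_cong[OF *, of i] by (auto simp: bump_def split: if_splits)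
  with * show False by simp
qed

text \<open>In either order of the two variables, moving \<open>r\<close> to the left past
  \<open>x\<^sub>i\<close> alone produces the term
  \<open>\<delta>\<^sub>i r x\<^sub>j\<close>.\<close>

lemma coef_xpow_unit2_scalar:
  assumes "i \<in> {1..n}" "j \<in> {1..n}" "i \<noteq> j" "r \<in> R"
  shows "coef (xpow (unit2 i j) \<otimes> r) (unit1 j) = \<delta> i r"
proof -
  have *: "coef (x a \<otimes> x b \<otimes> r) (unit1 j) = \<delta> i r"
    if ab: "a \<in> {1..n}" "b \<in> {1..n}" "a < b" "a = i \<and> b = j \<or> a = j \<and> b = i" for a b
  proof -
    have "coef (xpow (unit2 a b)) (unit1 j) = \<zero>" using ab assms by simp
    then have "coef (x a \<otimes> x b) (unit1 j) = \<zero>"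
      using xpow_unit2[OF ab(1,2) less_imp_le[OF ab(3)]] by simp
    then show ?thesis
      unfolding x_x_scalar[OF ab(1,2) assms(4)] using ab assms by (auto simp: coef_x_unit1)
  qed
  show ?thesis
  proof (cases "i < j")
    case True
    then show ?thesis using *[of i j] assms by (simp add: xpow_unit2)
  next
    case False
    then have "xpow (unit2 i j) = x j \<otimes> x i"
      using assms xpow_unit2[of j i] by (simp add: bump_commute[of i j])
    then show ?thesis using *[of j i] assms False by simp
  qed
qed

text \<open>Comparing coordinates in \<open>[x\<^sub>i, x\<^sub>j] r = r [x\<^sub>i, x\<^sub>j] + [\<delta>\<^sub>i, \<delta>\<^sub>j] r\<close> shows that a
  noncommuting leading term makes \<open>\<delta>\<^sub>i\<close> inner up to the factor \<open>tau i j\<close>.\<close>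

lemma tau_derivation_inner:
  assumes ij: "i \<in> {1..n}" "j \<in> {1..n}"
  shows "\<exists>q \<in> R. \<forall>r \<in> R. tau i j \<otimes> \<delta> i r = q \<otimes> r \<ominus> r \<otimes> q"
proof (cases "i = j")
  case True
  then show ?thesis using ij by (auto intro!: bexI[of _ \<zero>] simp: a_minus_def)
next
  case False
  \<comment> \<open>The coordinate at \<open>x\<^sub>j\<close> of the commutator is going to be
    computed in two ways; \<open>- p\<close> becomes the element that induces the inner
    derivation.\<close>
  define p where "p = coef (lin i j) (unit1 j)"
  have p: "p \<in> R" using ij by (simp add: p_def)
  note l = below_carrier[OF lin_low[OF ij]]
  have "tau i j \<otimes> \<delta> i r = (\<ominus> p) \<otimes> r \<ominus> r \<otimes> (\<ominus> p)" if r: "r \<in> R" for r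
  proof -
    let ?d = "\<delta> i (\<delta> j r) \<ominus> \<delta> j (\<delta> i r)"
    let ?M = "xpow (unit2 i j)"
    have "brk (x i) (x j) \<otimes> r = (x i \<otimes> x j) \<otimes> r \<ominus> (x j \<otimes> x i) \<otimes> r"
      using ij r by (simp add: brk_def a_minus_def l_distr l_minus)
    \<comment> \<open>The mixed terms \<open>\<delta>\<^sub>i r x\<^sub>j\<close> and
      \<open>\<delta>\<^sub>j r x\<^sub>i\<close> occur in both expansions and cancel. What remains
      besides \<open>r [x\<^sub>i, x\<^sub>j]\<close> is a constant, invisible at
      \<open>x\<^sub>j\<close>.\<close>
    also have "\<dots> = r \<otimes> brk (x i) (x j) \<oplus> ?d"
      unfolding x_x_scalar[OF ij r] x_x_scalar[OF ij(2,1) r] brk_def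
        a_lcomm[OF R_times_x[OF \<delta>_closed[OF ij(2) r] ij(1)] R_times_x[OF \<delta>_closed[OF ij(1) r] ij(2)]
          R_carrier[OF \<delta>_closed[OF ij(2) \<delta>_closed[OF ij(1) r]]]]
      using ij r by (simp add: add_minus_add) (simp add: a_minus_def r_distr r_minus)
    finally have "coef (brk (x i) (x j) \<otimes> r) (unit1 j) = r \<otimes> coef (brk (x i) (x j)) (unit1 j)"
      using ij r by simp
    moreover have "coef (brk (x i) (x j)) (unit1 j) = p"
      unfolding brk_x_x[OF ij] using ij l by (simp add: p_def)
    moreover have "brk (x i) (x j) \<otimes> r = tau i j \<otimes> (?M \<otimes> r) \<oplus> lin i j \<otimes> r"
      unfolding brk_x_x[OF ij] using ij r l by (simp add: l_distr m_assoc)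
    then have "coef (brk (x i) (x j) \<otimes> r) (unit1 j) = tau i j \<otimes> \<delta> i r \<oplus> p \<otimes> r"
      using ij r l False low2_scalar[OF lin_low[OF ij] r]
      by (simp add: coef_xpow_unit2_scalar p_def)
    ultimately have "tau i j \<otimes> \<delta> i r \<oplus> p \<otimes> r = r \<otimes> p" by simp
    then have "tau i j \<otimes> \<delta> i r = r \<otimes> p \<ominus> p \<otimes> r"
      using ij r p by (metis R_carrier R_closed(5) \<delta>_closed add.inv_solve_right a_minus_def tau_closed)
    then show ?thesis
      using p r by (simp add: a_minus_def l_minus r_minus a_comm)
  qed
  then show ?thesis using p by (intro bexI[of _ "\<ominus> p"]) auto
qed

text \<open>Differentiate \<open>z r = r z\<close> and cancel
  \<open>z \<delta>\<^sub>i r = \<delta>\<^sub>i r z\<close>.\<close>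

lemma \<delta>_center:
  assumes i: "i \<in> {1..n}" and z: "z \<in> center"
  shows "\<delta> i z \<in> center"
proof -
  have "\<delta> i z \<otimes> r = r \<otimes> \<delta> i z" if r: "r \<in> R" for r
  proof -
    note zR = centerD(1)[OF z]
    have "z \<otimes> \<delta> i r \<oplus> \<delta> i z \<otimes> r = r \<otimes> \<delta> i z \<oplus> \<delta> i r \<otimes> z"
      using \<delta>_mult[OF i zR r] \<delta>_mult[OF i r zR] centerD(3)[OF z r] by simp
    then have "\<delta> i r \<otimes> z \<oplus> \<delta> i z \<otimes> r = \<delta> i r \<otimes> z \<oplus> r \<otimes> \<delta> i z"
      using centerD(3)[OF z \<delta>_closed[OF i r]] i r zR by (simp add: a_comm)
    then show ?thesis using i r zR by (simp add: add.l_cancel)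
  qed
  then show ?thesis using i centerD(1)[OF z] by (simp add: center_def)
qed

text \<open>An inner derivation vanishes on the centre.\<close>

lemma tau_derivation_center:
  assumes "i \<in> {1..n}" "j \<in> {1..n}" "z \<in> center"
  shows "tau i j \<otimes> \<delta> i z = \<zero>"
proof -
  obtain q where q: "q \<in> R" "tau i j \<otimes> \<delta> i z = q \<otimes> z \<ominus> z \<otimes> q"
    using tau_derivation_inner[OF assms(1,2)] centerD(1)[OF assms(3)] by blast
  then show ?thesis
    using centerD(1)[OF assms(3)] by (simp add: centerD(3)[OF assms(3)] a_minus_def r_neg)
qed

section \<open>The Jacobi identity at the coordinate of a quadratic monomial\<close>

context
  fixes a b assumes ab: "a \<in> {1..n}" "b \<in> {1..n}" "a < b"
begin

text \<open>The reversed pair is excluded because its coordinate is the commutation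
  coefficient.\<close>

lemma coef_x_x:
  assumes ij: "i \<in> {1..n}" "j \<in> {1..n}" and "\<not> (i = b \<and> j = a)"
  shows "coef (x i \<otimes> x j) (unit2 a b) = (if i = a \<and> j = b then \<one> else \<zero>)"
proof (cases "i \<le> j")
  case True
  have "coef (xpow (unit2 i j)) (unit2 a b) = (if i = a \<and> j = b then \<one> else \<zero>)"
    using assms ab by auto
  then show ?thesis by (simp only: xpow_unit2[OF ij True])
next
  case False
  obtain c l where c: "c \<in> R" "l \<in> low 2" "x i \<otimes> x j = c \<otimes> (x j \<otimes> x i) \<oplus> l"
    using x_x_commute[OF ij(2,1)] by blast
  have "coef (xpow (unit2 j i)) (unit2 a b) = \<zero>"
    using assms ab False by auto
  then have 1: "coef (x j \<otimes> x i) (unit2 a b) = \<zero>"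
    using False by (simp add: xpow_unit2[OF ij(2,1)])
  have "coef l (unit2 a b) = \<zero>"
    using ab by (intro coef_low[OF c(2)]) auto
  then have "coef (c \<otimes> (x j \<otimes> x i) \<oplus> l) (unit2 a b) = \<zero>"
    using 1 ij ab c(1) below_carrier[OF c(2)] by simp
  then show ?thesis unfolding c(3) using False ab by auto
qed

text \<open>Among the products \<open>x\<^sub>i x\<^sub>b\<close> only
  \<open>x\<^sub>a x\<^sub>b\<close> reaches this coordinate, and the constant part of
  \<open>l\<close> stays in degree one.\<close>

lemma coef_low2_times_x:
  assumes "l \<in> low 2"
  shows "coef (l \<otimes> x b) (unit2 a b) = coef l (unit1 a)"
  using assms
proof (induction rule: low2_induct)
  case (lin r i)
  then have "coef (r \<otimes> x i \<otimes> x b) (unit2 a b) = r \<otimes> coef (x i \<otimes> x b) (unit2 a b)"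
    using ab by (simp add: m_assoc)
  then show ?case using lin ab by (simp add: coef_x_x coef_x_unit1)
qed (use ab in \<open>simp_all add: l_distr\<close>)

lemma coef_x_times_low2:
  assumes "l \<in> low 2"
  shows "coef (x a \<otimes> l) (unit2 a b) = coef l (unit1 b)"
  using assms
proof (induction rule: low2_induct)
  case (const r)
  then show ?case using ab by (simp add: x_scalar)
next
  case (lin r i)
  then show ?case using ab by (simp add: x_scalar_times coef_x_x coef_x_unit1)
qed (use ab in \<open>simp_all add: r_distr\<close>)

lemma coef_brk_x_x:
  assumes "i \<in> {1..n}" "j \<in> {1..n}"
  shows "coef (brk (x i) (x j)) (unit2 a b) =
    (if i = a \<and> j = b \<or> i = b \<and> j = a then tau i j else \<zero>)"
proof -
  have "coef (lin i j) (unit2 a b) = \<zero>"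
    using ab by (intro coef_low[OF lin_low[OF assms]]) auto
  then show ?thesis unfolding brk_x_x[OF assms] using assms ab by simp
qed

lemma coef_brk_x_low2:
  assumes k: "k \<in> {1..n}" and l: "l \<in> low 2"
  shows "coef (brk (x k) l) (unit2 a b) =
    (if k = a then coef l (unit1 b) \<otimes> tau a b
     else if k = b then coef l (unit1 a) \<otimes> tau b a else \<zero>)"
  using l
proof (induction rule: low2_induct)
  case (add c d)
  then show ?case using ab k by (simp add: brk_add l_distr)
next
  case (const r)
  then show ?case using ab k by (simp add: brk_x_R)
next
  case (lin r i)
  then show ?case using ab k by (auto simp: brk_x_scalar coef_brk_x_x coef_x_unit1)
qed

text \<open>The coordinate at \<open>x\<^sub>a x\<^sub>b\<close> of the Jacobi identity for \<open>x\<^sub>k, x\<^sub>a, x\<^sub>b\<close>: the linear parts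
  of the inner commutators cancel.\<close>

lemma derivation_tau_less:
  assumes k: "k \<in> {1..n}" "k \<noteq> a" "k \<noteq> b"
  shows "\<exists>y \<in> R. \<exists>y' \<in> R. \<delta> k (tau a b) = tau k a \<otimes> y \<oplus> tau k b \<otimes> y'"
proof -
  let ?f = "\<lambda>y. coef y (unit2 a b)"
  let ?t = "tau a b" and ?ka = "tau k a" and ?kb = "tau k b"
  let ?M = "\<lambda>i j. xpow (unit2 i j)"
  \<comment> \<open>\<open>P\<close> and \<open>Q\<close> are the linear coefficients that have to
    cancel. For the four coordinates after them, all that matters is the factor
    \<open>tau k a\<close> or \<open>tau k b\<close> with which they occur.\<close>
  define P where "P = coef (lin k a) (unit1 a)"
  define Q where "Q = coef (lin k b) (unit1 b)"
  define y1 where "y1 = ?f (?M k a \<otimes> x b)"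
  define y2 where "y2 = ?f (x a \<otimes> ?M k b)"
  define y3 where "y3 = ?f (brk (x a) (?M k b))"
  define y4 where "y4 = ?f (brk (x b) (?M k a))"
  have R: "P \<in> R" "Q \<in> R" "y1 \<in> R" "y2 \<in> R" "y3 \<in> R" "y4 \<in> R"
    using ab k by (simp_all add: P_def Q_def y1_def y2_def y3_def y4_def)
  have T: "?t \<in> R" "?ka \<in> R" "?kb \<in> R" using ab k by simp_all
  have lowka: "lin k a \<in> low 2" and lowkb: "lin k b \<in> low 2" and lowab: "lin a b \<in> low 2"
    using ab k by (simp_all add: lin_low)
  have mab: "?M a b = x a \<otimes> x b" using ab by (simp add: xpow_unit2)
  have e1: "brk (x k) (x a) \<otimes> x b = ?ka \<otimes> (?M k a \<otimes> x b) \<oplus> lin k a \<otimes> x b"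
    unfolding brk_x_x[OF k(1) ab(1)] using ab k by (simp add: l_distr m_assoc)
  have f1: "?f (brk (x k) (x a) \<otimes> x b) = ?ka \<otimes> y1 \<oplus> P"
    unfolding e1 using ab k T by (simp add: coef_low2_times_x[OF lowka] P_def y1_def)
  have e2: "x a \<otimes> brk (x k) (x b) = ?kb \<otimes> (x a \<otimes> ?M k b) \<oplus> \<delta> a ?kb \<otimes> ?M k b \<oplus> x a \<otimes> lin k b"
    unfolding brk_x_x[OF k(1) ab(2)] using ab k by (simp add: r_distr x_scalar_times)
  have f2: "?f (x a \<otimes> brk (x k) (x b)) = ?kb \<otimes> y2 \<oplus> Q"
    unfolding e2 using ab k T by (simp add: coef_x_times_low2[OF lowkb] Q_def y2_def)
  have e3: "brk (x k) (brk (x a) (x b)) = \<delta> k ?t \<otimes> ?M a b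
      \<oplus> ?t \<otimes> (brk (x k) (x a) \<otimes> x b \<oplus> x a \<otimes> brk (x k) (x b)) \<oplus> brk (x k) (lin a b)"
    unfolding brk_x_x[OF ab(1,2)] using ab k T
    by (simp add: brk_add brk_x_scalar) (simp add: mab brk_mult)
  have g1: "?f (brk (x k) (brk (x a) (x b))) = \<delta> k ?t \<oplus> ?t \<otimes> ((?ka \<otimes> y1 \<oplus> P) \<oplus> (?kb \<otimes> y2 \<oplus> Q))"
    unfolding e3 using ab k T R by (simp add: f1 f2 coef_brk_x_low2[OF _ lowab])
  have "brk (x b) (x k) = \<ominus> ?kb \<otimes> ?M k b \<oplus> \<ominus> lin k b"
    using ab k brk_x_x[OF ab(2) k(1)]
    by (simp add: tau_swap[of k b] lin_swap[of k b] bump_commute[of b k])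
  then have e4: "brk (x a) (brk (x b) (x k))
      = \<delta> a (\<ominus> ?kb) \<otimes> ?M k b \<oplus> \<ominus> ?kb \<otimes> brk (x a) (?M k b) \<oplus> brk (x a) (\<ominus> lin k b)"
    using ab k T by (simp add: brk_add brk_x_scalar)
  have g2: "?f (brk (x a) (brk (x b) (x k))) = \<ominus> ?kb \<otimes> y3 \<oplus> \<ominus> Q \<otimes> ?t"
    unfolding e4 using ab k T R coef_brk_x_low2[OF ab(1) low_simps(3)[OF lowkb]]
    by (simp add: y3_def Q_def)
  have e5: "brk (x b) (brk (x k) (x a))
      = \<delta> b ?ka \<otimes> ?M k a \<oplus> ?ka \<otimes> brk (x b) (?M k a) \<oplus> brk (x b) (lin k a)"
    unfolding brk_x_x[OF k(1) ab(1)] using ab k T by (simp add: brk_add brk_x_scalar)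
  have g3: "?f (brk (x b) (brk (x k) (x a))) = ?ka \<otimes> y4 \<oplus> P \<otimes> \<ominus> ?t"
    unfolding e5 using ab k T R coef_brk_x_low2[OF ab(2) lowka]
    by (simp add: y4_def P_def tau_swap[of a b])
  define y where "y = \<ominus> (?t \<otimes> y1) \<oplus> \<ominus> y4"
  define y' where "y' = \<ominus> (?t \<otimes> y2) \<oplus> y3"
  have yR: "y \<in> R" "y' \<in> R" using R T by (simp_all add: y_def y'_def)
  have tc: "?t \<in> center" using ab by simp
  have comm: "P \<otimes> ?t = ?t \<otimes> P" "Q \<otimes> ?t = ?t \<otimes> Q"
    "?t \<otimes> (?ka \<otimes> y1) = ?ka \<otimes> (?t \<otimes> y1)" "?t \<otimes> (?kb \<otimes> y2) = ?kb \<otimes> (?t \<otimes> y2)"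
    using centerD(3)[OF tc] R T m_assoc[of ?t ?ka y1] m_assoc[of ?ka ?t y1]
      m_assoc[of ?t ?kb y2] m_assoc[of ?kb ?t y2] by simp_all
  have "?f (brk (x k) (brk (x a) (x b)) \<oplus> (brk (x a) (brk (x b) (x k)) \<oplus> brk (x b) (brk (x k) (x a)))) = \<zero>"
    using ab k by (simp add: jacobi)
  then have "(\<delta> k ?t \<oplus> ?t \<otimes> ((?ka \<otimes> y1 \<oplus> P) \<oplus> (?kb \<otimes> y2 \<oplus> Q)))
      \<oplus> ((\<ominus> ?kb \<otimes> y3 \<oplus> \<ominus> Q \<otimes> ?t) \<oplus> (?ka \<otimes> y4 \<oplus> P \<otimes> \<ominus> ?t)) = \<zero>"
    using ab k by (simp add: g1 g2 g3)
  \<comment> \<open>\<open>P\<close> and \<open>Q\<close> occur once with the factor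
    \<open>tau a b\<close> and once with its negative on the other side; centrality of
    \<open>tau a b\<close> makes them cancel.\<close>
  moreover have "(\<delta> k ?t \<oplus> ?t \<otimes> ((?ka \<otimes> y1 \<oplus> P) \<oplus> (?kb \<otimes> y2 \<oplus> Q)))
      \<oplus> ((\<ominus> ?kb \<otimes> y3 \<oplus> \<ominus> Q \<otimes> ?t) \<oplus> (?ka \<otimes> y4 \<oplus> P \<otimes> \<ominus> ?t))
    = (\<delta> k ?t \<ominus> (?ka \<otimes> y \<oplus> ?kb \<otimes> y')) \<oplus> ((?t \<otimes> P \<ominus> ?t \<otimes> P) \<oplus> (?t \<otimes> Q \<ominus> ?t \<otimes> Q))"
    unfolding y_def y'_def using R T k
    by (simp add: a_minus_def r_distr l_minus r_minus minus_add comm a_assoc a_comm a_lcomm del: minus_self r_neg)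
  ultimately have "\<delta> k ?t \<ominus> (?ka \<otimes> y \<oplus> ?kb \<otimes> y') = \<zero>"
    using R T k yR by simp
  then have "\<delta> k ?t = ?ka \<otimes> y \<oplus> ?kb \<otimes> y'"
    using R T k yR by (simp add: r_right_minus_eq)
  then show ?thesis using yR by blast
qed

end

lemma derivation_tau:
  assumes ab: "a \<in> {1..n}" "b \<in> {1..n}" and k: "k \<in> {1..n}" "k \<noteq> a" "k \<noteq> b"
  shows "\<exists>y \<in> R. \<exists>y' \<in> R. \<delta> k (tau a b) = tau k a \<otimes> y \<oplus> tau k b \<otimes> y'"
proof (cases a b rule: linorder_cases)
  case less
  then show ?thesis using derivation_tau_less assms by blast
next
  case equal
  then show ?thesis using assms by (auto intro!: bexI[of _ \<zero>])
next
  case greater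
  then obtain y y' where y: "y \<in> R" "y' \<in> R" "\<delta> k (tau b a) = tau k b \<otimes> y \<oplus> tau k a \<otimes> y'"
    using derivation_tau_less[of b a k] assms by blast
  have "\<delta> k (tau a b) = tau k a \<otimes> (\<ominus> y') \<oplus> tau k b \<otimes> (\<ominus> y)"
    using assms y by (simp add: tau_swap[of b a] \<delta>_minus minus_add r_minus a_comm)
  then show ?thesis using R_closed(3)[OF y(1)] R_closed(3)[OF y(2)] by blast
qed

text \<open>Degree \<open>dg \<beta> + 1\<close> could be reached only through the quadratic terms
  of the \<open>[x\<^sub>k, x\<^sub>j]\<close>, whose coefficients lie in \<open>J\<close>. So the
  commutator does not raise the degree modulo \<open>J A\<close>.\<close>

lemma brk_x_xpow_below:
  assumes J: "stable_ideal J" and k: "k \<in> {1..n}" and tau: "\<And>j. j \<in> {1..n} \<Longrightarrow> tau k j \<in> J"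
    and \<beta>: "\<beta> \<in> E"
  shows "brk (x k) (xpow \<beta>) \<in> below J (Suc (dg \<beta>))"
  using \<beta>
proof (induction rule: exponents_induct)
  case zero
  have "brk (x k) \<one> = \<zero>" using k by (simp add: brk_def)
  then show ?case by (simp add: below_zero[OF stable_idealD(1)[OF J]])
next
  case (bump j \<beta>)
  note B = stable_idealD(1)[OF J]
  let ?d = "Suc (dg (bump j \<beta>))"
  have "tau k j \<otimes> (xpow (unit2 k j) \<otimes> xpow \<beta>) \<in> below J ?d"
    using bump k tau by (intro ideal_times_below[OF B]) auto
  moreover have "lin k j \<otimes> xpow \<beta> \<in> below J ?d"
    using bump k low_times_xpow[OF lin_low[OF k bump(2)] bump(1)] low_below[OF B] by simp
  moreover have "x j \<otimes> brk (x k) (xpow \<beta>) \<in> below J ?d"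
    using bump x_below[OF J bump.IH] by simp
  moreover have "brk (x k) (xpow (bump j \<beta>))
      = tau k j \<otimes> (xpow (unit2 k j) \<otimes> xpow \<beta>) \<oplus> lin k j \<otimes> xpow \<beta> \<oplus> x j \<otimes> brk (x k) (xpow \<beta>)"
    using bump k by (simp add: xpow_bump brk_mult brk_x_x l_distr m_assoc)
  ultimately show ?case by (simp add: below_add[OF B])
qed

section \<open>A regular central element\<close>

text \<open>The set records the first indices, since \<open>tau i j\<close> is what makes
  \<open>\<delta> i\<close> inner. Repeated indices count once, so its cardinality is bounded by
  \<open>n\<close> and can be maximized.\<close>

inductive tau_product :: "nat set \<Rightarrow> 'a \<Rightarrow> bool" where
  one: "tau_product {} \<one>"
| step: "i \<in> {1..n} \<Longrightarrow> j \<in> {1..n} \<Longrightarrow> tau_product Y p \<Longrightarrow> tau_product (insert i Y) (tau i j \<otimes> p)"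

lemma tau_product_center: "tau_product Y p \<Longrightarrow> p \<in> center"
  by (induction rule: tau_product.induct) (auto intro: center_mult)

lemma tau_product_subset: "tau_product Y p \<Longrightarrow> Y \<subseteq> {1..n}"
  by (induction rule: tau_product.induct) auto

lemma tau_product_mult:
  assumes "tau_product Y p" "tau_product Y' p'"
  shows "tau_product (Y \<union> Y') (p \<otimes> p')"
  using assms(1)
proof induction
  case one
  then show ?case using assms(2) centerD(2)[OF tau_product_center[OF assms(2)]] by simp
next
  case (step i j Y p)
  have "p \<in> carrier A" "p' \<in> carrier A" "tau i j \<in> carrier A"
    using step centerD(2) tau_product_center assms(2) by auto
  then show ?case using tau_product.step[OF step(1,2,4)] by (simp add: m_assoc)
qed

text \<open>The other factors are central, so multiplying \<open>q\<close> for a factor with first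
  index \<open>k\<close> by them gives an element for the whole product.\<close>

lemma tau_product_inner:
  assumes "tau_product Y p" "k \<in> Y"
  shows "\<exists>q \<in> R. \<forall>r \<in> R. p \<otimes> \<delta> k r = q \<otimes> r \<ominus> r \<otimes> q"
  using assms
proof (induction rule: tau_product.induct)
  case (step i j Y p)
  have pc: "p \<in> center" using tau_product_center step by blast
  have tc: "tau i j \<in> center" using step by simp
  have shift: "\<exists>q \<in> R. \<forall>r \<in> R. c \<otimes> t \<otimes> \<delta> k r = q \<otimes> r \<ominus> r \<otimes> q"
    if c: "c \<in> center" and t: "t \<in> center" and q: "q \<in> R" "\<forall>r \<in> R. t \<otimes> \<delta> k r = q \<otimes> r \<ominus> r \<otimes> q"
      and k: "k \<in> {1..n}" for c t q
  proof (intro bexI ballI)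
    note C = centerD[OF c] and T = centerD[OF t]
    show "c \<otimes> q \<in> R" using C q by simp
    fix r assume r: "r \<in> R"
    have "c \<otimes> t \<otimes> \<delta> k r = c \<otimes> (q \<otimes> r \<ominus> r \<otimes> q)"
      using C(2) T(2) k q r by (simp add: m_assoc)
    also have "\<dots> = c \<otimes> q \<otimes> r \<ominus> (c \<otimes> r) \<otimes> q"
      using C(2) q(1) r by (simp add: a_minus_def r_distr r_minus m_assoc)
    also have "\<dots> = c \<otimes> q \<otimes> r \<ominus> r \<otimes> (c \<otimes> q)"
      unfolding C(3)[OF r] using C(2) q(1) r by (simp add: m_assoc)
    finally show "c \<otimes> t \<otimes> \<delta> k r = c \<otimes> q \<otimes> r \<ominus> r \<otimes> (c \<otimes> q)" .
  qed
  show ?case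
  proof (cases "k = i")
    case True
    obtain q where "q \<in> R" "\<forall>r \<in> R. tau i j \<otimes> \<delta> k r = q \<otimes> r \<ominus> r \<otimes> q"
      using tau_derivation_inner[OF step(1,2)] True by blast
    then have "\<exists>q \<in> R. \<forall>r \<in> R. p \<otimes> tau i j \<otimes> \<delta> k r = q \<otimes> r \<ominus> r \<otimes> q"
      using shift[OF pc tc] True step by blast
    then show ?thesis using centerD(3)[OF pc centerD(1)[OF tc]] by simp
  next
    case False
    then have "k \<in> Y" using step by simp
    then have "k \<in> {1..n}" using tau_product_subset step by blast
    then show ?thesis using shift[OF tc pc] step.IH \<open>k \<in> Y\<close> by blast
  qed
qed simp

lemma inner_center:
  assumes "z \<in> center" "\<exists>q \<in> R. \<forall>r \<in> R. p \<otimes> \<delta> k r = q \<otimes> r \<ominus> r \<otimes> q"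
  shows "p \<otimes> \<delta> k z = \<zero>"
proof -
  obtain q where q: "q \<in> R" "p \<otimes> \<delta> k z = q \<otimes> z \<ominus> z \<otimes> q"
    using assms centerD(1)[OF assms(1)] by blast
  then show ?thesis using centerD(1)[OF assms(1)] by (simp add: centerD(3)[OF assms(1)])
qed

text \<open>By the product rule the two elements add up to \<open>\<delta> k (r s)\<close>, which
  lies in the invariant ideal.\<close>

lemma \<delta>_ideal_product:
  assumes I: "stable_ideal I" and "k \<in> {1..n}" "r \<in> R" "s \<in> R" "r \<otimes> s \<in> I"
  shows "r \<otimes> \<delta> k s \<in> I \<longleftrightarrow> \<delta> k r \<otimes> s \<in> I"
proof -
  note D = base_idealD[OF stable_idealD(1)[OF I]]
  have *: "r \<otimes> \<delta> k s \<oplus> \<delta> k r \<otimes> s \<in> I"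
    using stable_idealD(2)[OF I assms(2,5)] assms by (simp add: \<delta>_mult)
  have c: "r \<otimes> \<delta> k s \<in> carrier A" "\<delta> k r \<otimes> s \<in> carrier A" using assms by simp_all
  show ?thesis
  proof
    assume "r \<otimes> \<delta> k s \<in> I"
    from D(8)[OF * this] show "\<delta> k r \<otimes> s \<in> I" using c by (simp add: add_minus_cancel)
  next
    assume "\<delta> k r \<otimes> s \<in> I"
    from D(8)[OF * this] show "r \<otimes> \<delta> k s \<in> I"
      using c by (simp add: a_comm[OF c] add_minus_cancel)
  qed
qed

text \<open>Differentiating a factor \<open>tau i j\<close> exchanges its first index for
  \<open>k\<close> by \<open>derivation_tau\<close>, and \<open>w\<close> annihilates the resulting
  products modulo \<open>I\<close> by hypothesis. In the induction \<open>w\<close> absorbs the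
  factors already passed and therefore varies.\<close>

lemma tau_product_derivation:
  assumes I: "stable_ideal I" and "tau_product Y p" and k: "k \<in> {1..n}" "k \<notin> Y" and "w \<in> center"
    and "\<And>i Y' q. i \<in> Y \<Longrightarrow> tau_product Y' q \<Longrightarrow> Y - {i} \<union> {k} \<subseteq> Y' \<Longrightarrow> w \<otimes> q \<in> I"
  shows "w \<otimes> \<delta> k p \<in> I"
  using assms(2,4-)
proof (induction arbitrary: w rule: tau_product.induct)
  case one
  note D = base_idealD[OF stable_idealD(1)[OF I]]
  have "\<delta> k \<one> \<oplus> \<delta> k \<one> = \<delta> k \<one>"
    using \<delta>_mult[OF k(1) R_closed(2,2)] k(1) by simp
  then have "\<delta> k \<one> = \<zero>"
    using add.r_cancel_one[of "\<delta> k \<one>" "\<delta> k \<one>"] k(1) by simp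
  then show ?case using one centerD(2) D(3) by simp
next
  case (step i j Y p w)
  note D = base_idealD[OF stable_idealD(1)[OF I]]
  note hyp = step.prems(3)
  have pc: "p \<in> center" and tc: "tau i j \<in> center" and wc: "w \<in> center"
    using tau_product_center step by auto
  note P = centerD[OF pc] and T = centerD[OF tc] and W = centerD[OF wc]
  have ki: "k \<noteq> i" "k \<notin> Y" using step by auto
  have swap: "w \<otimes> p \<otimes> tau k l \<in> I" if l: "l \<in> {1..n}" for l
  proof -
    have "w \<otimes> (tau k l \<otimes> p) \<in> I"
      using hyp[of i "insert k Y" "tau k l \<otimes> p"] tau_product.step[OF k(1) l step.hyps(3)] by auto
    then show ?thesis
      using W(2) P(2) k(1) l centerD(3)[OF pc tau_closed[OF k(1) l]] by (simp add: m_assoc)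
  qed
  show ?case
  proof (cases "k = j")
    \<comment> \<open>\<open>derivation_tau\<close> does not cover \<open>k = j\<close>. But then
      the factor is \<open>- tau k i\<close> itself, so \<open>w\<close> annihilates the product
      modulo \<open>I\<close>; the derivation moves over to \<open>w\<close>, and
      \<open>tau k i\<close> annihilates \<open>\<delta> k w\<close>.\<close>
    case True
    have tk: "tau i j = \<ominus> tau k i" using tau_swap[of k i] step True by simp
    have "w \<otimes> (tau i j \<otimes> p) = \<ominus> (w \<otimes> p \<otimes> tau k i)"
      unfolding tk using W(2) P(2) k(1) step.hyps(1) centerD(3)[OF pc tau_closed[OF k(1) step.hyps(1)]]
      by (simp add: l_minus r_minus m_assoc)
    then have 1: "w \<otimes> (tau i j \<otimes> p) \<in> I" using swap[OF step.hyps(1)] D(7) by simp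
    have "tau k i \<otimes> \<delta> k w = \<zero>" using tau_derivation_center[OF k(1) step.hyps(1) wc] .
    then have "\<delta> k w \<otimes> tau k i = \<zero>"
      using centerD(3)[OF tau_center[OF k(1) step.hyps(1)] \<delta>_closed[OF k(1) W(1)]] by simp
    then have "\<delta> k w \<otimes> (tau i j \<otimes> p) = \<zero>"
      unfolding tk using k(1) W(1) P(2) step.hyps(1)
      by (simp add: l_minus r_minus m_assoc[symmetric])
    then have "\<delta> k w \<otimes> (tau i j \<otimes> p) \<in> I" using D(3) by simp
    then show ?thesis
      using \<delta>_ideal_product[OF I k(1) W(1) _ 1] T(1) P(1) by simp
  next
    case False
    obtain y y' where y: "y \<in> R" "y' \<in> R" "\<delta> k (tau i j) = tau k i \<otimes> y \<oplus> tau k j \<otimes> y'"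
      using derivation_tau[OF step.hyps(1,2) k(1)] ki False by blast
    have "w \<otimes> (\<delta> k (tau i j) \<otimes> p) = w \<otimes> (p \<otimes> \<delta> k (tau i j))"
      using P(3) k(1) T(1) by simp
    also have "\<dots> = w \<otimes> p \<otimes> tau k i \<otimes> y \<oplus> w \<otimes> p \<otimes> tau k j \<otimes> y'"
      unfolding y(3) using W(2) P(2) k(1) step.hyps(1,2) y(1,2) by (simp add: r_distr m_assoc)
    also have "\<dots> \<in> I"
      using D(4)[OF D(6)[OF y(1) swap[OF step.hyps(1)]] D(6)[OF y(2) swap[OF step.hyps(2)]]] .
    finally have 1: "w \<otimes> (\<delta> k (tau i j) \<otimes> p) \<in> I" .
    have "w \<otimes> tau i j \<otimes> \<delta> k p \<in> I"
    proof (rule step.IH)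
      show "k \<notin> Y" by fact
      show "w \<otimes> tau i j \<in> center" using wc tc by (rule center_mult)
      fix i' Y' q assume *: "i' \<in> Y" "tau_product Y' q" "Y - {i'} \<union> {k} \<subseteq> Y'"
      have "w \<otimes> (tau i j \<otimes> q) \<in> I"
        using hyp[of i' "insert i Y'" "tau i j \<otimes> q"] * tau_product.step[OF step.hyps(1,2) *(2)] by auto
      then show "w \<otimes> tau i j \<otimes> q \<in> I"
        using W(2) T(2) centerD(2)[OF tau_product_center[OF *(2)]] by (simp add: m_assoc)
    qed
    moreover have "w \<otimes> \<delta> k (tau i j \<otimes> p) = w \<otimes> tau i j \<otimes> \<delta> k p \<oplus> w \<otimes> (\<delta> k (tau i j) \<otimes> p)"
      using k(1) T(1) P(1) W(2) by (simp add: \<delta>_mult r_distr m_assoc)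
    ultimately show ?thesis using 1 D(4) by simp
  qed
qed

context
  fixes I
  assumes I: "stable_ideal I" and one: "\<one> \<notin> I"
    and prime: "\<And>J K. stable_ideal J \<Longrightarrow> stable_ideal K \<Longrightarrow> (\<And>j k. j \<in> J \<Longrightarrow> k \<in> K \<Longrightarrow> j \<otimes> k \<in> I) \<Longrightarrow>
      J \<subseteq> I \<or> K \<subseteq> I"
begin

text \<open>\<open>V\<close> is the right annihilator of \<open>S\<close> modulo \<open>I\<close>,
  an invariant ideal by the two hypotheses. Its left annihilator \<open>W\<close> is then an
  invariant ideal that contains \<open>S\<close>, and primeness applies to \<open>W\<close> and
  \<open>V\<close>.\<close>

lemma annihilator_dichotomy:
  assumes S: "S \<subseteq> R"
    and left: "\<And>b r. b \<in> R \<Longrightarrow> (\<And>s. s \<in> S \<Longrightarrow> s \<otimes> b \<in> I) \<Longrightarrow> r \<in> R \<Longrightarrow> \<forall>s \<in> S. s \<otimes> (r \<otimes> b) \<in> I"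
    and der: "\<And>b i. b \<in> R \<Longrightarrow> (\<And>s. s \<in> S \<Longrightarrow> s \<otimes> b \<in> I) \<Longrightarrow> i \<in> {1..n} \<Longrightarrow> \<forall>s \<in> S. s \<otimes> \<delta> i b \<in> I"
  shows "S \<subseteq> I \<or> (\<forall>b \<in> R. (\<forall>s \<in> S. s \<otimes> b \<in> I) \<longrightarrow> b \<in> I)"
proof -
  note D = base_idealD[OF stable_idealD(1)[OF I]]
  define V where "V = {b \<in> R. \<forall>s \<in> S. s \<otimes> b \<in> I}"
  define W where "W = {e \<in> R. \<forall>b \<in> V. e \<otimes> b \<in> I}"
  have SC: "s \<in> carrier A" if "s \<in> S" for s using S that by auto
  have VR: "b \<in> R" if "b \<in> V" for b using that by (simp add: V_def)
  have lV: "r \<otimes> b \<in> V" if "b \<in> V" "r \<in> R" for b r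
    using that left[of b r] by (simp add: V_def)
  have dV: "\<delta> i b \<in> V" if "b \<in> V" "i \<in> {1..n}" for b i
    using that der[of b i] by (simp add: V_def)
  have V: "stable_ideal V"
    unfolding stable_ideal_def base_ideal_def
  proof (intro conjI ballI)
    show "V \<subseteq> R" using VR by auto
    show "\<zero> \<in> V" using SC D(3) by (simp add: V_def)
    show "a \<oplus> b \<in> V" if "a \<in> V" "b \<in> V" for a b
      using that SC D(4) by (simp add: V_def r_distr)
    show "a \<otimes> r \<in> V" if "r \<in> R" "a \<in> V" for r a
      using that SC D(6) by (simp add: V_def m_assoc[symmetric])
  qed (use lV dV in auto)
  have W: "stable_ideal W"
    unfolding stable_ideal_def base_ideal_def
  proof (intro conjI ballI)
    show "W \<subseteq> R" by (auto simp: W_def)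
    show "\<zero> \<in> W" using VR D(3) by (simp add: W_def)
    show "a \<oplus> b \<in> W" if "a \<in> W" "b \<in> W" for a b
      using that VR D(4) by (simp add: W_def l_distr)
    show "a \<otimes> r \<in> W" if "r \<in> R" "a \<in> W" for r a
      using that VR lV by (simp add: W_def m_assoc)
    show "r \<otimes> a \<in> W" if "r \<in> R" "a \<in> W" for r a
      using that VR D(5) by (simp add: W_def m_assoc)
    show "\<delta> i a \<in> W" if i: "i \<in> {1..n}" and a: "a \<in> W" for i a
    proof -
      have aW: "a \<in> R" "\<And>b. b \<in> V \<Longrightarrow> a \<otimes> b \<in> I" using a by (auto simp: W_def)
      have "\<delta> i a \<otimes> b \<in> I" if b: "b \<in> V" for b
        using \<delta>_ideal_product[OF I i aW(1) VR[OF b] aW(2)[OF b]] aW(2)[OF dV[OF b i]] by simp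
      then show ?thesis using aW(1) i by (simp add: W_def)
    qed
  qed
  have "W \<subseteq> I \<or> V \<subseteq> I" using prime[OF W V] by (simp add: W_def)
  moreover have "S \<subseteq> W" using S by (auto simp: W_def V_def)
  ultimately show ?thesis by (auto simp: V_def)
qed

text \<open>Centrality makes the annihilator two-sided. Derivatives may leave \<open>S\<close> for
  \<open>I\<close>, because elements of \<open>I\<close> annihilate everything modulo
  \<open>I\<close>.\<close>

lemma central_dichotomy:
  assumes S: "S \<subseteq> center" and der: "\<And>i z. i \<in> {1..n} \<Longrightarrow> z \<in> S \<Longrightarrow> \<delta> i z \<in> S \<union> I"
  shows "S \<subseteq> I \<or> (\<forall>b \<in> R. (\<forall>s \<in> S. s \<otimes> b \<in> I) \<longrightarrow> b \<in> I)"
proof (rule annihilator_dichotomy)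
  note D = base_idealD[OF stable_idealD(1)[OF I]]
  show "S \<subseteq> R" using S centerD(1) by auto
  fix b assume b: "b \<in> R" and Sb: "\<And>s. s \<in> S \<Longrightarrow> s \<otimes> b \<in> I"
  show "\<forall>s \<in> S. s \<otimes> (r \<otimes> b) \<in> I" if r: "r \<in> R" for r
  proof
    fix s assume s: "s \<in> S"
    then have sc: "s \<in> center" using S by auto
    have "s \<otimes> (r \<otimes> b) = r \<otimes> (s \<otimes> b)"
      using m_assoc[of s r b] m_assoc[of r s b] centerD(2,3)[OF sc] r b by simp
    then show "s \<otimes> (r \<otimes> b) \<in> I" using D(5)[OF r Sb[OF s]] by simp
  qed
  show "\<forall>s \<in> S. s \<otimes> \<delta> i b \<in> I" if i: "i \<in> {1..n}" for i
  proof
    fix s assume s: "s \<in> S"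
    then have sc: "s \<in> center" using S by auto
    have "\<delta> i s \<otimes> b \<in> I" using der[OF i s] Sb D(6) b by auto
    then show "s \<otimes> \<delta> i b \<in> I"
      using \<delta>_ideal_product[OF I i centerD(1)[OF sc] b Sb[OF s]] by simp
  qed
qed

text \<open>Start from a product of \<open>tau\<close>'s outside \<open>I\<close> that involves as many variables as
  possible. By maximality a product of two such is constant modulo \<open>I\<close> for the derivations of
  the remaining variables, while it annihilates the values on the centre of the others.\<close>

lemma regular_element:
  obtains s Y where "s \<in> center" "Y \<subseteq> {1..n}"
    "\<And>r. r \<in> R \<Longrightarrow> s \<otimes> r \<in> I \<Longrightarrow> r \<in> I"
    "\<And>k. k \<in> Y \<Longrightarrow> \<exists>q \<in> R. \<forall>r \<in> R. s \<otimes> \<delta> k r = q \<otimes> r \<ominus> r \<otimes> q"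
    "\<And>k j. k \<in> {1..n} \<Longrightarrow> k \<notin> Y \<Longrightarrow> j \<in> {1..n} \<Longrightarrow> tau k j \<in> I"
proof -
  note D = base_idealD[OF stable_idealD(1)[OF I]]
  let ?P = "\<lambda>Y. \<exists>p. tau_product Y p \<and> p \<notin> I"
  have "?P {}" using tau_product.one one by blast
  moreover have "\<forall>Y. ?P Y \<longrightarrow> card Y < Suc n"
    using card_mono[OF finite_atLeastAtMost tau_product_subset] by (auto simp: less_Suc_eq_le)
  ultimately have "\<exists>Y. ?P Y \<and> (\<forall>Z. ?P Z \<longrightarrow> card Z \<le> card Y)"
    by (rule ex_has_greatest_nat)
  then obtain Y where Y: "?P Y \<and> (\<forall>Z. ?P Z \<longrightarrow> card Z \<le> card Y)" ..
  then have greatest: "card Z \<le> card Y" if "?P Z" for Z using that by simp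
  from Y obtain p where Yp: "tau_product Y p" "p \<notin> I" by blast
  have max: "q \<in> I" if "tau_product Z q" "card Y < card Z" for Z q
    using greatest[of Z] that by (meson leD)
  have fin: "finite Z" if "tau_product Z q" for Z q
    using finite_subset[OF tau_product_subset[OF that]] by simp
  have pc: "p \<in> center" using tau_product_center Yp by blast
  \<comment> \<open>The centre elements that annihilate all products with at least
    \<open>card Y\<close> first indices. Once \<open>N\<close> is known to be invariant,
    \<open>p\<close> shows that its annihilator is not inside \<open>I\<close>; so \<open>N\<close>
    lies in \<open>I\<close> and misses \<open>p\<close>, which yields a second product
    \<open>p'\<close> with \<open>p p'\<close> outside \<open>I\<close>.\<close>
  define N where "N = {z \<in> center. \<forall>Z q. tau_product Z q \<longrightarrow> card Y \<le> card Z \<longrightarrow> z \<otimes> q \<in> I}"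
  have "\<delta> k z \<in> N" if k: "k \<in> {1..n}" and z: "z \<in> N" for k z
  proof -
    have zc: "z \<in> center" using z by (simp add: N_def)
    have "\<delta> k z \<otimes> q \<in> I" if q: "tau_product Z q" and card: "card Y \<le> card Z" for Z q
    proof -
      have qc: "q \<in> center" using tau_product_center q by blast
      have zq: "z \<otimes> q \<in> I" using z q card by (simp add: N_def)
      show ?thesis
      proof (cases "k \<in> Z")
        case True
        have "q \<otimes> \<delta> k z = \<zero>" using inner_center[OF zc tau_product_inner[OF q True]] .
        then show ?thesis
          using centerD(3)[OF qc \<delta>_closed[OF k centerD(1)[OF zc]]] D(3) by simp
      next
        case False
        \<comment> \<open>Exchanging an index of \<open>Z\<close> for \<open>k\<close> does not
          decrease the number of indices, so \<open>z\<close> annihilates the new products as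
          well.\<close>
        have "z \<otimes> \<delta> k q \<in> I"
        proof (rule tau_product_derivation[OF I q k False zc])
          fix i Z' q' assume *: "i \<in> Z" "tau_product Z' q'" "Z - {i} \<union> {k} \<subseteq> Z'"
          have "card Z = card (insert k (Z - {i}))"
            using *(1) False fin[OF q] card_Suc_Diff1[of Z i] by simp
          also have "\<dots> \<le> card Z'" using *(3) fin[OF *(2)] by (intro card_mono) auto
          finally show "z \<otimes> q' \<in> I" using z * card by (simp add: N_def)
        qed
        then show ?thesis
          using \<delta>_ideal_product[OF I k centerD(1)[OF zc] centerD(1)[OF qc] zq] by simp
      qed
    qed
    then show ?thesis using \<delta>_center[OF k zc] by (simp add: N_def)
  qed
  then have "N \<subseteq> I \<or> (\<forall>b \<in> R. (\<forall>z \<in> N. z \<otimes> b \<in> I) \<longrightarrow> b \<in> I)"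
    by (intro central_dichotomy) (auto simp: N_def)
  moreover have "\<forall>z \<in> N. z \<otimes> p \<in> I" using Yp by (simp add: N_def)
  ultimately have "N \<subseteq> I" using Yp centerD(1)[OF pc] by blast
  then have "p \<notin> N" using Yp by blast
  then obtain Z p' where Z: "tau_product Z p'" "card Y \<le> card Z" "p \<otimes> p' \<notin> I"
    using pc by (auto simp: N_def)
  define s where "s = p \<otimes> p'"
  have p'c: "p' \<in> center" using tau_product_center Z by blast
  have sc: "s \<in> center" unfolding s_def using pc p'c by (rule center_mult)
  note S = centerD[OF sc] and P = centerD[OF pc] and P' = centerD[OF p'c]
  have YZ: "tau_product (Y \<union> Z) s" unfolding s_def by (rule tau_product_mult[OF Yp(1) Z(1)])
  have "card (Y \<union> Z) \<le> card Y" using max[OF YZ] Z(3) unfolding s_def by fastforce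
  then have "Y = Y \<union> Z" using fin[OF YZ] by (intro card_seteq) auto
  moreover from this Z(2) have "Z = Y" using fin[OF Yp(1)] by (intro card_seteq) auto
  ultimately have ZY: "Z = Y" "tau_product Y s" using YZ by auto
  \<comment> \<open>The factor \<open>q\<close> retains all of \<open>Y\<close> while the derivative
    of \<open>q'\<close> brings in \<open>k\<close>. The joint index set is larger than
    \<open>Y\<close>, and maximality applies.\<close>
  have outside: "q \<otimes> \<delta> k q' \<in> I"
    if q: "tau_product Y q" "tau_product Y q'" and k: "k \<in> {1..n}" "k \<notin> Y" for q q' k
  proof (rule tau_product_derivation[OF I q(2) k tau_product_center[OF q(1)]])
    fix i Z' r assume *: "i \<in> Y" "tau_product Z' r" "Y - {i} \<union> {k} \<subseteq> Z'"
    have "insert k Y \<subseteq> Y \<union> Z'" using * by auto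
    then have "card (insert k Y) \<le> card (Y \<union> Z')"
      using fin[OF Yp(1)] fin[OF *(2)] by (intro card_mono) auto
    then have "card Y < card (Y \<union> Z')" using k fin[OF Yp(1)] by simp
    then show "q \<otimes> r \<in> I" using max tau_product_mult[OF q(1) *(2)] by blast
  qed
  have der_outside: "\<delta> k s \<in> I" if k: "k \<in> {1..n}" "k \<notin> Y" for k
  proof -
    have 1: "p \<otimes> \<delta> k p' \<in> I" "p' \<otimes> \<delta> k p \<in> I" using outside Yp(1) Z(1) ZY(1) k by auto
    moreover have "\<delta> k p \<otimes> p' = p' \<otimes> \<delta> k p" using P'(3) P(1) k by simp
    ultimately show ?thesis
      unfolding s_def using P(1) P'(1) k D(4) by (simp add: \<delta>_mult)
  qed
  have inside: "s \<otimes> \<delta> k z = \<zero>" if "k \<in> Y" "z \<in> center" for k z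
    using inner_center[OF that(2) tau_product_inner[OF ZY(2) that(1)]] .
  have sI: "s \<notin> I" using Z(3) by (simp add: s_def)
  \<comment> \<open>The annihilator of \<open>s\<close> in the centre modulo \<open>I\<close>. It is
    invariant: for \<open>k\<close> in \<open>Y\<close>, \<open>s\<close> annihilates the values of
    \<open>\<delta> k\<close> on the centre, and for the other \<open>k\<close>, \<open>s\<close> is
    constant modulo \<open>I\<close>. It annihilates \<open>s\<close>, so the dichotomy puts it into
    \<open>I\<close>.\<close>
  define N' where "N' = {z \<in> center. s \<otimes> z \<in> I}"
  have "\<delta> k z \<in> N'" if k: "k \<in> {1..n}" and z: "z \<in> N'" for k z
  proof -
    have zc: "z \<in> center" "s \<otimes> z \<in> I" using z by (auto simp: N'_def)
    have "s \<otimes> \<delta> k z \<in> I"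
    proof (cases "k \<in> Y")
      case True
      then show ?thesis using inside zc D(3) by simp
    next
      case False
      then have "\<delta> k s \<otimes> z \<in> I" using der_outside k centerD(1)[OF zc(1)] D(6) by simp
      then show ?thesis using \<delta>_ideal_product[OF I k S(1) centerD(1)[OF zc(1)] zc(2)] by simp
    qed
    then show ?thesis using \<delta>_center[OF k zc(1)] by (simp add: N'_def)
  qed
  then have "N' \<subseteq> I \<or> (\<forall>b \<in> R. (\<forall>z \<in> N'. z \<otimes> b \<in> I) \<longrightarrow> b \<in> I)"
    by (intro central_dichotomy) (auto simp: N'_def)
  moreover have "\<forall>z \<in> N'. z \<otimes> s \<in> I" using S(3) centerD(1) by (auto simp: N'_def)
  ultimately have N'I: "N' \<subseteq> I" using sI S(1) by blast
  \<comment> \<open>For \<open>k\<close> in \<open>Y\<close>, \<open>s (\<delta> k s) = 0\<close>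
    places the derivative in \<open>N'\<close>. Thus \<open>{s}\<close> satisfies the invariance
    hypothesis of the dichotomy, whose conclusion is the regularity of \<open>s\<close>.\<close>
  have "\<delta> k s \<in> I" if k: "k \<in> {1..n}" for k
  proof (cases "k \<in> Y")
    case True
    then have "\<delta> k s \<in> N'" using inside[OF True sc] \<delta>_center[OF k sc] D(3) by (simp add: N'_def)
    then show ?thesis using N'I by blast
  qed (use der_outside k in auto)
  then have "{s} \<subseteq> I \<or> (\<forall>b \<in> R. (\<forall>z \<in> {s}. z \<otimes> b \<in> I) \<longrightarrow> b \<in> I)"
    using sc by (intro central_dichotomy) auto
  then have regular: "r \<in> I" if "r \<in> R" "s \<otimes> r \<in> I" for r using that sI by auto
  show thesis
  proof (rule that[OF sc tau_product_subset[OF Yp(1)] regular])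
    show "\<exists>q \<in> R. \<forall>r \<in> R. s \<otimes> \<delta> k r = q \<otimes> r \<ominus> r \<otimes> q" if "k \<in> Y" for k
      using tau_product_inner[OF ZY(2) that] .
    show "tau k j \<in> I" if k: "k \<in> {1..n}" "k \<notin> Y" and j: "j \<in> {1..n}" for k j
    proof -
      \<comment> \<open>A further factor with first index \<open>k\<close> outside \<open>Y\<close>
        exceeds the maximum.\<close>
      have "tau k j \<otimes> s \<in> I"
        using max[OF tau_product.step[OF k(1) j ZY(2)]] k(2) fin[OF Yp(1)] by simp
      then have "s \<otimes> tau k j \<in> I" using S(3) k j by simp
      then show ?thesis using regular k j by simp
    qed
  qed
qed

end

section \<open>Primeness of the extended ideal\<close>

lemma top_degree:
  assumes I: "base_ideal I" and f: "f \<in> carrier A" "f \<notin> ext I"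
  obtains \<alpha> where "\<alpha> \<in> E" "coef f \<alpha> \<notin> I" "f \<in> below I (Suc (dg \<alpha>))"
proof -
  let ?S = "{\<alpha> \<in> E. coef f \<alpha> \<notin> I}"
  have fin: "finite ?S"
    using base_idealD(3)[OF I] by (intro finite_subset[OF _ coef_props(2)[OF f(1)]]) auto
  have "?S \<noteq> {}" using f unfolding below_def by auto
  then have "Max (dg ` ?S) \<in> dg ` ?S" using fin by (intro Max_in) auto
  then obtain \<alpha> where \<alpha>: "\<alpha> \<in> ?S" "dg \<alpha> = Max (dg ` ?S)" by auto
  have "dg \<beta> \<le> dg \<alpha>" if "\<beta> \<in> ?S" for \<beta>
    unfolding \<alpha>(2) using fin that by (intro Max_ge) auto
  then have "f \<in> below I (Suc (dg \<alpha>))" using f(1) unfolding below_def by fastforce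
  then show thesis using \<alpha>(1) that by auto
qed

text \<open>The coefficient of \<open>f r g\<close> at \<open>\<alpha>\<^sub>0 + \<beta>\<^sub>1\<close> is, up to a unit, that of the two
  extreme terms.\<close>

lemma extreme_coefficients:
  assumes I: "stable_ideal I"
    and f: "f \<in> below I (Suc l)" and g: "g \<in> below I (Suc m)" and r: "r \<in> R"
    and fg: "f \<otimes> (r \<otimes> g) \<in> ext I"
    and \<alpha>0: "\<alpha>\<^sub>0 \<in> E" "dg \<alpha>\<^sub>0 = l" and \<beta>1: "\<beta>\<^sub>1 \<in> E" "dg \<beta>\<^sub>1 = m"
    and above: "\<And>\<alpha> \<beta>. \<alpha> \<in> E \<Longrightarrow> \<beta> \<in> E \<Longrightarrow> dg \<alpha> = l \<Longrightarrow> dg \<beta> = m \<Longrightarrow> less_fun \<alpha>\<^sub>0 \<alpha> \<Longrightarrow>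
      coef f \<alpha> \<otimes> (r \<otimes> coef g \<beta>) \<in> I"
    and max: "\<And>\<beta>. \<beta> \<in> E \<Longrightarrow> dg \<beta> = m \<Longrightarrow> less_fun \<beta>\<^sub>1 \<beta> \<Longrightarrow> coef g \<beta> \<in> I"
  shows "coef f \<alpha>\<^sub>0 \<otimes> (r \<otimes> coef g \<beta>\<^sub>1) \<in> I"
proof -
  note B = stable_idealD(1)[OF I]
  note D = base_idealD[OF B]
  note fc = below_carrier[OF f] and gc = below_carrier[OF g]
  define \<gamma> where "\<gamma> = (\<lambda>k. \<alpha>\<^sub>0 k + \<beta>\<^sub>1 k)"
  have \<gamma>: "\<gamma> \<in> E" "dg \<gamma> = l + m" using \<alpha>0 \<beta>1 by (simp_all add: \<gamma>_def mdeg_add)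
  have pair: "coef ((coef f \<alpha> \<otimes> xpow \<alpha>) \<otimes> (r \<otimes> (coef g \<beta> \<otimes> xpow \<beta>))) \<gamma> \<in> I"
    if \<alpha>: "\<alpha> \<in> E" and \<beta>: "\<beta> \<in> E" and ne: "\<alpha> \<noteq> \<alpha>\<^sub>0 \<or> \<beta> \<noteq> \<beta>\<^sub>1" for \<alpha> \<beta>
  proof -
    let ?c = "coef f \<alpha>" and ?s = "r \<otimes> coef g \<beta>"
    have R: "?c \<in> R" "coef g \<beta> \<in> R" "?s \<in> R" using fc gc \<alpha> \<beta> r by simp_all
    have assoc: "r \<otimes> (coef g \<beta> \<otimes> xpow \<beta>) = ?s \<otimes> xpow \<beta>" using R r \<beta> by (simp add: m_assoc)
    consider "Suc l \<le> dg \<alpha>" | "Suc m \<le> dg \<beta>" | "dg \<alpha> \<le> l" "dg \<beta> \<le> m" by linarith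
    then show ?thesis
    proof cases
      case 1
      then have "?c \<in> I" using below_coef[OF f \<alpha>] by simp
      then have "?c \<otimes> xpow \<alpha> \<in> ext I" using \<alpha> by (simp add: ideal_times_below[OF B])
      then have "(?c \<otimes> xpow \<alpha>) \<otimes> (?s \<otimes> xpow \<beta>) \<in> ext I" using ext_right[OF I, of _ "?s \<otimes> xpow \<beta>"] R \<beta> by simp
      then show ?thesis unfolding assoc using \<gamma> by (intro below_coef) auto
    next
      case 2
      then have "?s \<in> I" using below_coef[OF g \<beta>] r D(5) by simp
      then have "?s \<otimes> xpow \<beta> \<in> ext I" using \<beta> by (simp add: ideal_times_below[OF B])
      then have "(?c \<otimes> xpow \<alpha>) \<otimes> (?s \<otimes> xpow \<beta>) \<in> ext I" using ext_left[OF I, of "?c \<otimes> xpow \<alpha>"] R \<alpha> by simp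
      then show ?thesis unfolding assoc using \<gamma> by (intro below_coef) auto
    next
      case 3
      have "dg \<alpha> + dg \<beta> \<le> dg \<gamma>" using 3 \<gamma>(2) by simp
      moreover obtain u where u: "u \<in> central_units" "\<And>\<gamma>. \<gamma> \<in> E \<Longrightarrow> dg \<alpha> + dg \<beta> \<le> dg \<gamma> \<Longrightarrow>
        coef ((?c \<otimes> xpow \<alpha>) \<otimes> (?s \<otimes> xpow \<beta>)) \<gamma> = (if \<gamma> = (\<lambda>k. \<alpha> k + \<beta> k) then ?c \<otimes> ?s \<otimes> u else \<zero>)"
        by (rule coef_product_of_terms[OF \<alpha> \<beta> R(1,3)]) (rule that)
      ultimately have u2: "coef ((?c \<otimes> xpow \<alpha>) \<otimes> (?s \<otimes> xpow \<beta>)) \<gamma> =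
        (if \<gamma> = (\<lambda>k. \<alpha> k + \<beta> k) then ?c \<otimes> ?s \<otimes> u else \<zero>)"
        using \<gamma>(1) by simp
      have "?c \<otimes> ?s \<otimes> u \<in> I" if eq: "\<gamma> = (\<lambda>k. \<alpha> k + \<beta> k)"
      proof -
        have "dg \<alpha> + dg \<beta> = l + m" using \<gamma>(2) mdeg_add[of n \<alpha> \<beta>] unfolding eq by simp
        then have dg: "dg \<alpha> = l" "dg \<beta> = m" using 3 by auto
        have eq': "(\<lambda>k. \<alpha> k + \<beta> k) = (\<lambda>k. \<alpha>\<^sub>0 k + \<beta>\<^sub>1 k)" using eq by (simp add: \<gamma>_def)
        have pt: "\<alpha> k + \<beta> k = \<alpha>\<^sub>0 k + \<beta>\<^sub>1 k" for k using fun_cong[OF eq'] by simp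
        have "\<alpha> \<noteq> \<alpha>\<^sub>0"
        proof
          assume "\<alpha> = \<alpha>\<^sub>0"
          then have "\<beta> = \<beta>\<^sub>1" using pt by (auto simp: fun_eq_iff)
          then show False using ne \<open>\<alpha> = \<alpha>\<^sub>0\<close> by simp
        qed
        \<comment> \<open>Both pairs have the sum \<open>\<gamma>\<close>. If
          \<open>\<alpha>\<close> is below \<open>\<alpha>\<^sub>0\<close>, then
          \<open>\<beta>\<close> is above \<open>\<beta>\<^sub>1\<close> and \<open>max\<close>
          applies; otherwise \<open>above\<close> does.\<close>
        then consider "less_fun \<alpha> \<alpha>\<^sub>0" | "less_fun \<alpha>\<^sub>0 \<alpha>"
          using exponents_trichotomy[OF \<alpha> \<alpha>0(1)] by blast
        then have "?c \<otimes> ?s \<in> I"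
        proof cases
          case 1
          then have "coef g \<beta> \<in> I" using less_fun_add_cancel[OF eq'] max \<beta> dg by blast
          then show ?thesis using D(5) R r by simp
        next
          case 2
          then show ?thesis using above \<alpha> \<beta> dg by blast
        qed
        then show ?thesis using D(6) central_unitsD(1)[OF u(1)] by simp
      qed
      then show ?thesis unfolding assoc u2 using D(3) by simp
    qed
  qed
  let ?a = "coef f \<alpha>\<^sub>0 \<otimes> xpow \<alpha>\<^sub>0" and ?b = "coef g \<beta>\<^sub>1 \<otimes> xpow \<beta>\<^sub>1"
  have ac: "?a \<in> carrier A" "?b \<in> carrier A" using fc gc \<alpha>0 \<beta>1 by simp_all
  \<comment> \<open>Stated for general \<open>h\<close> to serve twice: for \<open>g\<close> when
    \<open>\<alpha>\<close> differs from \<open>\<alpha>\<^sub>0\<close>, and for \<open>g\<close>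
    without its extreme term when it does not.\<close>
  have inner: "coef ((coef f \<alpha> \<otimes> xpow \<alpha>) \<otimes> (r \<otimes> h)) \<gamma> \<in> I"
    if \<alpha>: "\<alpha> \<in> E" and h: "h \<in> carrier A"
      and terms: "\<And>\<beta>. \<beta> \<in> E \<Longrightarrow> coef h \<beta> = \<zero> \<or> coef h \<beta> = coef g \<beta> \<and> (\<alpha> \<noteq> \<alpha>\<^sub>0 \<or> \<beta> \<noteq> \<beta>\<^sub>1)" for \<alpha> h
    using h
  proof (induction rule: coef_induct)
    case zero
    then show ?case using \<alpha> fc r \<gamma> D(3) by simp
  next
    case (add b c)
    then show ?case using \<alpha> fc r \<gamma> D(4) by (simp add: r_distr)
  next
    case (summand \<beta>)
    show ?case
    proof (cases "coef h \<beta> = \<zero>")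
      case True
      then show ?thesis using \<alpha> fc r \<gamma> D(3) summand by simp
    next
      case False
      then show ?thesis using terms[OF summand] pair[OF \<alpha> summand] by simp
    qed
  qed
  have "coef ((f \<ominus> ?a) \<otimes> (r \<otimes> g)) \<gamma> \<in> I"
  proof -
    have "f \<ominus> ?a \<in> carrier A" using fc ac by simp
    then show ?thesis
    proof (induction rule: coef_induct)
      case zero
      then show ?case using gc r \<gamma> D(3) by simp
    next
      case (add b c)
      then show ?case using gc r \<gamma> D(4) by (simp add: l_distr)
    next
      case (summand \<alpha>)
      show ?case
      proof (cases "\<alpha> = \<alpha>\<^sub>0")
        case True
        then have "coef (f \<ominus> ?a) \<alpha> = \<zero>" using \<alpha>0 fc ac by simp
        then show ?thesis using gc r \<gamma> summand D(3) by simp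
      next
        case False
        then have "coef (f \<ominus> ?a) \<alpha> = coef f \<alpha>"
          using \<alpha>0 fc ac summand by (simp add: a_minus_def)
        then show ?thesis using inner[OF summand gc] False by simp
      qed
    qed
  qed
  moreover have "coef (?a \<otimes> (r \<otimes> (g \<ominus> ?b))) \<gamma> \<in> I"
  proof (rule inner[OF \<alpha>0(1)])
    show "g \<ominus> ?b \<in> carrier A" using gc ac by simp
    fix \<beta> assume "\<beta> \<in> E"
    then show "coef (g \<ominus> ?b) \<beta> = \<zero> \<or> coef (g \<ominus> ?b) \<beta> = coef g \<beta> \<and> (\<alpha>\<^sub>0 \<noteq> \<alpha>\<^sub>0 \<or> \<beta> \<noteq> \<beta>\<^sub>1)"
      using \<beta>1 gc ac by (cases "\<beta> = \<beta>\<^sub>1") (simp_all add: a_minus_def r_neg)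
  qed
  moreover have "coef (f \<otimes> (r \<otimes> g)) \<gamma> \<in> I" using below_coef[OF fg] \<gamma> by simp
  moreover have "f \<otimes> (r \<otimes> g) = (f \<ominus> ?a) \<otimes> (r \<otimes> g) \<oplus> (?a \<otimes> (r \<otimes> (g \<ominus> ?b)) \<oplus> ?a \<otimes> (r \<otimes> ?b))"
  proof -
    have split: "y = (y \<ominus> z) \<oplus> z" if "y \<in> carrier A" "z \<in> carrier A" for y z
      using that by (simp add: a_minus_def a_assoc l_neg)
    have "f \<otimes> (r \<otimes> g) = (f \<ominus> ?a) \<otimes> (r \<otimes> g) \<oplus> ?a \<otimes> (r \<otimes> g)"
      using split[OF fc ac(1)] l_distr[of "f \<ominus> ?a" ?a "r \<otimes> g"] fc gc ac r by simp
    moreover have "?a \<otimes> (r \<otimes> g) = ?a \<otimes> (r \<otimes> (g \<ominus> ?b)) \<oplus> ?a \<otimes> (r \<otimes> ?b)"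
      using split[OF gc ac(2)] r_distr[of "g \<ominus> ?b" ?b r]
        r_distr[of "r \<otimes> (g \<ominus> ?b)" "r \<otimes> ?b" ?a] fc gc ac r by simp
    ultimately show ?thesis by simp
  qed
  ultimately have last: "coef (?a \<otimes> (r \<otimes> ?b)) \<gamma> \<in> I"
    (is "?w \<in> I")
  proof -
    assume *: "coef ((f \<ominus> ?a) \<otimes> (r \<otimes> g)) \<gamma> \<in> I" (is "?u \<in> I")
      "coef (?a \<otimes> (r \<otimes> (g \<ominus> ?b))) \<gamma> \<in> I" (is "?v \<in> I") "coef (f \<otimes> (r \<otimes> g)) \<gamma> \<in> I"
      "f \<otimes> (r \<otimes> g) = (f \<ominus> ?a) \<otimes> (r \<otimes> g) \<oplus> (?a \<otimes> (r \<otimes> (g \<ominus> ?b)) \<oplus> ?a \<otimes> (r \<otimes> ?b))"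
    have w: "?w \<in> carrier A" using \<gamma> ac r by simp
    have cs: "(f \<ominus> ?a) \<otimes> (r \<otimes> g) \<in> carrier A" "?a \<otimes> (r \<otimes> (g \<ominus> ?b)) \<in> carrier A"
      "?a \<otimes> (r \<otimes> ?b) \<in> carrier A"
      using fc gc ac r by simp_all
    have "coef (f \<otimes> (r \<otimes> g)) \<gamma> = ?u \<oplus> (?v \<oplus> ?w)"
      unfolding *(4) coef_add[OF cs(1) a_closed[OF cs(2,3)] \<gamma>(1)] coef_add[OF cs(2,3) \<gamma>(1)] ..
    then have "?u \<oplus> (?v \<oplus> ?w) \<in> I" using *(3) by simp
    from D(8)[OF D(8)[OF this *(1)] *(2)] show ?thesis
      using D(2)[OF *(1)] D(2)[OF *(2)] w by (simp add: add_minus_cancel)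
  qed
  have R: "coef f \<alpha>\<^sub>0 \<in> R" "coef g \<beta>\<^sub>1 \<in> R" using fc gc \<alpha>0 \<beta>1 by simp_all
  have assoc: "r \<otimes> ?b = (r \<otimes> coef g \<beta>\<^sub>1) \<otimes> xpow \<beta>\<^sub>1" using R r \<beta>1 by (simp add: m_assoc)
  have "dg \<alpha>\<^sub>0 + dg \<beta>\<^sub>1 \<le> dg \<gamma>" using \<gamma>(2) \<alpha>0(2) \<beta>1(2) by simp
  moreover obtain u where u: "u \<in> central_units"
    "\<And>\<gamma>. \<gamma> \<in> E \<Longrightarrow> dg \<alpha>\<^sub>0 + dg \<beta>\<^sub>1 \<le> dg \<gamma> \<Longrightarrow>
      coef (?a \<otimes> ((r \<otimes> coef g \<beta>\<^sub>1) \<otimes> xpow \<beta>\<^sub>1)) \<gamma> =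
      (if \<gamma> = (\<lambda>k. \<alpha>\<^sub>0 k + \<beta>\<^sub>1 k) then coef f \<alpha>\<^sub>0 \<otimes> (r \<otimes> coef g \<beta>\<^sub>1) \<otimes> u else \<zero>)"
    by (rule coef_product_of_terms[OF \<alpha>0(1) \<beta>1(1) R(1) R_closed(5)[OF r R(2)]]) (rule that)
  ultimately have u2: "coef (?a \<otimes> (r \<otimes> ?b)) \<gamma> = coef f \<alpha>\<^sub>0 \<otimes> (r \<otimes> coef g \<beta>\<^sub>1) \<otimes> u"
    unfolding assoc using \<gamma>(1) u(2)[of \<gamma>] by (simp add: \<gamma>_def)
  obtain v where v: "v \<in> R" "u \<otimes> v = \<one>" using u(1) by (auto simp: central_units_def)
  have "coef f \<alpha>\<^sub>0 \<otimes> (r \<otimes> coef g \<beta>\<^sub>1) \<otimes> u \<otimes> v \<in> I" using last u2 D(6)[OF v(1)] by simp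
  moreover have "coef f \<alpha>\<^sub>0 \<otimes> (r \<otimes> coef g \<beta>\<^sub>1) \<otimes> u \<otimes> v = coef f \<alpha>\<^sub>0 \<otimes> (r \<otimes> coef g \<beta>\<^sub>1)"
    using m_assoc[of "coef f \<alpha>\<^sub>0 \<otimes> (r \<otimes> coef g \<beta>\<^sub>1)" u v] R r v central_unitsD(1)[OF u(1)] by simp
  ultimately show ?thesis by simp
qed

lemma ideal_of_A_D:
  assumes "ideal J A"
  shows "\<And>a. a \<in> J \<Longrightarrow> a \<in> carrier A" "\<And>a b. a \<in> J \<Longrightarrow> b \<in> carrier A \<Longrightarrow> b \<otimes> a \<in> J"
    "\<And>i a. a \<in> J \<Longrightarrow> i \<in> {1..n} \<Longrightarrow> brk (x i) a \<in> J"
proof -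
  interpret J: ideal J A by fact
  show "a \<in> carrier A" if "a \<in> J" for a using that J.Icarr by simp
  show "b \<otimes> a \<in> J" if "a \<in> J" "b \<in> carrier A" for a b using that J.I_l_closed by simp
  show "brk (x i) a \<in> J" if "a \<in> J" "i \<in> {1..n}" for i a
    unfolding brk_def a_minus_def using that J.I_l_closed J.I_r_closed
    by (intro additive_subgroup.a_closed[OF J.is_additive_subgroup]
        additive_subgroup.a_inv_closed[OF J.is_additive_subgroup]) auto
qed

context
  fixes I
  assumes I: "stable_ideal I" and one: "\<one> \<notin> I"
    and prime: "\<And>J K. stable_ideal J \<Longrightarrow> stable_ideal K \<Longrightarrow> (\<And>j k. j \<in> J \<Longrightarrow> k \<in> K \<Longrightarrow> j \<otimes> k \<in> I) \<Longrightarrow>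
      J \<subseteq> I \<or> K \<subseteq> I"
begin

text \<open>An element of \<open>K\<close> with as few top coefficients outside \<open>I\<close> as possible is
  annihilated, modulo \<open>I\<close>, by every top coefficient of \<open>J\<close>: otherwise multiplying it by such a
  coefficient would kill its leading one and leave a smaller element.\<close>

lemma common_right_annihilator:
  assumes J: "ideal J A" and K: "ideal K A" and JK: "ideal_prod A J K \<subseteq> ext I"
    and g0: "g\<^sub>0 \<in> K" "g\<^sub>0 \<notin> ext I"
  obtains b where "b \<in> R" "b \<notin> I"
    "\<And>f \<alpha> r. f \<in> J \<Longrightarrow> f \<in> below I (Suc l) \<Longrightarrow> \<alpha> \<in> E \<Longrightarrow> dg \<alpha> = l \<Longrightarrow> r \<in> R \<Longrightarrow>
      coef f \<alpha> \<otimes> (r \<otimes> b) \<in> I"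
proof -
  note B = stable_idealD(1)[OF I]
  note D = base_idealD[OF B]
  obtain \<beta>\<^sub>0 where \<beta>0: "\<beta>\<^sub>0 \<in> E" "coef g\<^sub>0 \<beta>\<^sub>0 \<notin> I" "g\<^sub>0 \<in> below I (Suc (dg \<beta>\<^sub>0))"
    using top_degree[OF B ideal_of_A_D(1)[OF K g0(1)] g0(2)] by blast
  define m where "m = dg \<beta>\<^sub>0"
  define top where "top g = {\<beta> \<in> E. dg \<beta> = m \<and> coef g \<beta> \<notin> I}" for g
  have fin: "finite (top g)" for g
    by (rule finite_subset[OF _ finite_exponents_deg[of n m]]) (auto simp: top_def)
  let ?P = "\<lambda>g. g \<in> K \<and> g \<in> below I (Suc m) \<and> top g \<noteq> {}"
  have "?P g\<^sub>0" using g0 \<beta>0 by (auto simp: m_def top_def)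
  then have "\<exists>g. ?P g \<and> (\<forall>h. ?P h \<longrightarrow> card (top g) \<le> card (top h))"
    by (rule ex_has_least_nat)
  then obtain g where g: "g \<in> K" "g \<in> below I (Suc m)" "top g \<noteq> {}"
    and least: "\<And>h. h \<in> K \<Longrightarrow> h \<in> below I (Suc m) \<Longrightarrow> top h \<noteq> {} \<Longrightarrow> card (top g) \<le> card (top h)"
    by blast
  note gc = below_carrier[OF g(2)]
  obtain \<beta>\<^sub>1 where \<beta>1: "\<beta>\<^sub>1 \<in> top g" "\<forall>\<beta> \<in> top g. \<beta> = \<beta>\<^sub>1 \<or> less_fun \<beta> \<beta>\<^sub>1"
    using finite_lex_max[OF fin g(3), of n] by (auto simp: top_def)
  have \<beta>1E: "\<beta>\<^sub>1 \<in> E" "dg \<beta>\<^sub>1 = m" "coef g \<beta>\<^sub>1 \<notin> I" using \<beta>1(1) by (auto simp: top_def)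
  \<comment> \<open>Badness ranges over all \<open>f\<close>, \<open>r\<close> and
    \<open>\<beta>\<close> at once, so that maximality of \<open>\<alpha>\<^sub>0\<close> settles
    the larger exponents for whichever \<open>f\<close> and \<open>r\<close> are chosen.\<close>
  let ?bad = "\<lambda>\<alpha>. \<exists>f r \<beta>. f \<in> J \<and> f \<in> below I (Suc l) \<and> r \<in> R \<and> \<beta> \<in> E \<and> dg \<beta> = m \<and>
    coef f \<alpha> \<otimes> (r \<otimes> coef g \<beta>) \<notin> I"
  have no_bad: "{\<alpha> \<in> E. dg \<alpha> = l \<and> ?bad \<alpha>} = {}" (is "?S = {}")
  proof (rule ccontr)
    assume "?S \<noteq> {}"
    moreover have "finite ?S"
      by (rule finite_subset[OF _ finite_exponents_deg[of n l]]) auto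
    ultimately obtain \<alpha>\<^sub>0 where \<alpha>0: "\<alpha>\<^sub>0 \<in> ?S" and \<alpha>0max: "\<forall>\<alpha> \<in> ?S. \<alpha> = \<alpha>\<^sub>0 \<or> less_fun \<alpha> \<alpha>\<^sub>0"
      using finite_lex_max[of ?S n] by blast
    have \<alpha>0E: "\<alpha>\<^sub>0 \<in> E" "dg \<alpha>\<^sub>0 = l" using \<alpha>0 by auto
    obtain f r \<beta> where f: "f \<in> J" "f \<in> below I (Suc l)" and r: "r \<in> R" and \<beta>: "\<beta> \<in> E" "dg \<beta> = m"
      and bad: "coef f \<alpha>\<^sub>0 \<otimes> (r \<otimes> coef g \<beta>) \<notin> I"
      using \<alpha>0 by blast
    note fc = below_carrier[OF f(2)]
    have rg: "r \<otimes> g \<in> K" using ideal_of_A_D(2)[OF K g(1)] r by simp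
    have fg: "f \<otimes> (r \<otimes> g) \<in> ext I" using ideal_prod.prod[OF f(1) rg, of A] JK by blast
    have "coef f \<alpha>\<^sub>0 \<otimes> (r \<otimes> coef g \<beta>\<^sub>1) \<in> I"
    proof (rule extreme_coefficients[OF I f(2) g(2) r fg \<alpha>0E \<beta>1E(1,2)])
      fix \<alpha> \<beta> assume *: "\<alpha> \<in> E" "\<beta> \<in> E" "dg \<alpha> = l" "dg \<beta> = m" "less_fun \<alpha>\<^sub>0 \<alpha>"
      show "coef f \<alpha> \<otimes> (r \<otimes> coef g \<beta>) \<in> I"
      proof (rule ccontr)
        assume "coef f \<alpha> \<otimes> (r \<otimes> coef g \<beta>) \<notin> I"
        then have "\<alpha> \<in> ?S" using * f r by blast
        from bspec[OF \<alpha>0max this] show False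
          using *(5) less_fun_asym[OF *(5)] less_fun_irrefl[of \<alpha>] by auto
      qed
    next
      fix \<beta> assume *: "\<beta> \<in> E" "dg \<beta> = m" "less_fun \<beta>\<^sub>1 \<beta>"
      show "coef g \<beta> \<in> I"
      proof (rule ccontr)
        assume "coef g \<beta> \<notin> I"
        then have "\<beta> \<in> top g" using * by (simp add: top_def)
        from bspec[OF \<beta>1(2) this] show False
          using *(3) less_fun_asym[OF *(3)] less_fun_irrefl[of \<beta>] by auto
      qed
    qed
    note killed = this
    define s where "s = coef f \<alpha>\<^sub>0 \<otimes> r"
    have s: "s \<in> R" using fc \<alpha>0E r by (simp add: s_def)
    have sc: "coef (s \<otimes> g) \<epsilon> = coef f \<alpha>\<^sub>0 \<otimes> (r \<otimes> coef g \<epsilon>)" if "\<epsilon> \<in> E" for \<epsilon>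
      using that s gc fc \<alpha>0E r by (simp add: s_def m_assoc)
    have "top (s \<otimes> g) \<subseteq> top g - {\<beta>\<^sub>1}"
      using sc killed D(5) fc \<alpha>0E r by (auto simp: top_def)
    moreover have "card (top g - {\<beta>\<^sub>1}) < card (top g)"
      using \<beta>1(1) fin by (intro psubset_card_mono) auto
    ultimately have "card (top (s \<otimes> g)) < card (top g)"
      using card_mono[of "top g - {\<beta>\<^sub>1}" "top (s \<otimes> g)"] fin by auto
    \<comment> \<open>Here \<open>bad\<close> is used: the smaller element keeps a top coefficient
      outside \<open>I\<close>, so it competes in the minimality of \<open>g\<close>.\<close>
    moreover have "\<beta> \<in> top (s \<otimes> g)" using \<beta> sc bad by (simp add: top_def)
    moreover have "s \<otimes> g \<in> K" using ideal_of_A_D(2)[OF K g(1)] s by simp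
    moreover have "s \<otimes> g \<in> below I (Suc m)" using below_scalar[OF B s g(2)] .
    ultimately show False using least[of "s \<otimes> g"] by auto
  qed
  show thesis
  proof (rule that[of "coef g \<beta>\<^sub>1"])
    show "coef g \<beta>\<^sub>1 \<in> R" "coef g \<beta>\<^sub>1 \<notin> I" using gc \<beta>1E by simp_all
    fix f \<alpha> r assume "f \<in> J" "f \<in> below I (Suc l)" "\<alpha> \<in> E" "dg \<alpha> = l" "r \<in> R"
    then show "coef f \<alpha> \<otimes> (r \<otimes> coef g \<beta>\<^sub>1) \<in> I" using no_bad \<beta>1E by blast
  qed
qed

text \<open>The top coefficients of \<open>[x\<^sub>i, f]\<close> are those of \<open>\<delta>\<^sub>i f\<close> up to terms already known to
  annihilate \<open>b\<close>.\<close>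

lemma top_coefficient_derivation:
  assumes J: "ideal J A" and b: "b \<in> R"
    and ann: "\<And>f \<alpha> r. f \<in> J \<Longrightarrow> f \<in> below I (Suc l) \<Longrightarrow> \<alpha> \<in> E \<Longrightarrow> dg \<alpha> = l \<Longrightarrow> r \<in> R \<Longrightarrow>
      coef f \<alpha> \<otimes> (r \<otimes> b) \<in> I"
    and i: "i \<in> {1..n}" and tau: "\<And>j. j \<in> {1..n} \<Longrightarrow> tau i j \<in> I"
    and f: "f \<in> J" "f \<in> below I (Suc l)" and \<alpha>: "\<alpha> \<in> E" "dg \<alpha> = l" and r: "r \<in> R"
  shows "\<delta> i (coef f \<alpha>) \<otimes> (r \<otimes> b) \<in> I"
proof -
  note B = stable_idealD(1)[OF I]
  note D = base_idealD[OF B]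
  note fc = below_carrier[OF f(2)]
  have x: "x i \<in> carrier A" using i by simp
  define e where "e \<beta> = coef (brk (x i) (xpow \<beta>)) \<alpha>" for \<beta>
  have eR: "e \<beta> \<in> R" if "\<beta> \<in> E" for \<beta> using that x \<alpha> by (simp add: e_def)
  have brk_term: "brk (x i) (c \<otimes> xpow \<beta>) = \<delta> i c \<otimes> xpow \<beta> \<oplus> c \<otimes> brk (x i) (xpow \<beta>)"
    if "c \<in> R" "\<beta> \<in> E" for c \<beta>
    using that i by (simp add: brk_x_scalar)
  have small: "c \<otimes> e \<beta> \<otimes> (r \<otimes> b) \<in> I" "brk (x i) (c \<otimes> xpow \<beta>) \<in> below I (Suc l)"
    if \<beta>: "\<beta> \<in> E" and c: "c = coef f \<beta>" for \<beta> c
  proof -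
    have cR: "c \<in> R" using c \<beta> fc by simp
    have bb: "brk (x i) (xpow \<beta>) \<in> below I (Suc (dg \<beta>))"
      using brk_x_xpow_below[OF I i tau \<beta>] by blast
    have rb: "r \<otimes> b \<in> R" using r b by simp
    \<comment> \<open>Above degree \<open>l\<close> the coefficient of \<open>f\<close> lies in
      \<open>I\<close>; in degree \<open>l\<close> it annihilates \<open>R b\<close> modulo
      \<open>I\<close>; below, the commutator with the monomial does not reach degree
      \<open>l\<close> modulo \<open>I A\<close>.\<close>
    consider "l < dg \<beta>" | "dg \<beta> = l" | "dg \<beta> < l" by linarith
    then show "c \<otimes> e \<beta> \<otimes> (r \<otimes> b) \<in> I"
    proof cases
      case 1
      then have "c \<in> I" using below_coef[OF f(2) \<beta>] c by simp
      then show ?thesis using D(6) eR[OF \<beta>] rb by simp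
    next
      case 2
      then have "c \<otimes> ((e \<beta> \<otimes> r) \<otimes> b) \<in> I" unfolding c using ann f \<beta> eR r by simp
      then show ?thesis using cR eR[OF \<beta>] r b by (simp add: m_assoc)
    next
      case 3
      then have "e \<beta> \<in> I" unfolding e_def using below_coef[OF bb] \<alpha> by simp
      then show ?thesis using D(5)[OF cR] D(6)[OF rb] by simp
    qed
    show "brk (x i) (c \<otimes> xpow \<beta>) \<in> below I (Suc l)"
    proof (cases "l < dg \<beta>")
      case True
      then have "c \<in> I" using below_coef[OF f(2) \<beta>] c by simp
      then show ?thesis
        unfolding brk_term[OF cR \<beta>] using stable_idealD(2)[OF I i] x \<beta>
        by (intro below_add[OF B] ideal_times_below[OF B]) auto
    next
      case False
      then have "brk (x i) (xpow \<beta>) \<in> below I (Suc l)" using below_mono[OF bb] by simp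
      moreover have "xpow \<beta> \<in> below I (Suc l)" using xpow_below[OF B \<beta>] False by simp
      ultimately show ?thesis
        unfolding brk_term[OF cR \<beta>] using cR i
        by (intro below_add[OF B] below_scalar[OF B]) auto
    qed
  qed
  let ?a = "coef f \<alpha> \<otimes> xpow \<alpha>"
  have ac: "?a \<in> carrier A" "coef f \<alpha> \<in> R" using fc \<alpha> by simp_all
  \<comment> \<open>The term at \<open>\<alpha>\<close> is split off because only there does the
    derivative of a coefficient enter the coordinate \<open>\<alpha>\<close>.\<close>
  define h where "h = f \<ominus> ?a"
  have hc: "h \<in> carrier A" using fc ac by (simp add: h_def)
  have "brk (x i) h \<in> below I (Suc l) \<and> coef (brk (x i) h) \<alpha> \<otimes> (r \<otimes> b) \<in> I"
    using hc
  proof (induction rule: coef_induct)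
    case zero
    have "brk (x i) \<zero> = \<zero>" using x by (simp add: brk_def)
    then show ?case using below_zero[OF B] \<alpha> r b D(3) by simp
  next
    case (add c d)
    then show ?case using x r b \<alpha> below_add[OF B] D(4) by (simp add: brk_add l_distr)
  next
    case (summand \<beta>)
    show ?case
    proof (cases "\<beta> = \<alpha>")
      case True
      then have "coef h \<beta> \<otimes> xpow \<beta> = \<zero>" using \<alpha> fc ac by (simp add: h_def)
      moreover have "brk (x i) \<zero> = \<zero>" using x by (simp add: brk_def)
      ultimately show ?thesis using below_zero[OF B] \<alpha> r b D(3) by simp
    next
      case False
      then have eq: "coef h \<beta> = coef f \<beta>" using summand \<alpha> fc ac by (simp add: h_def a_minus_def)
      have cR: "coef f \<beta> \<in> R" using fc summand by simp
      have "coef (brk (x i) (coef f \<beta> \<otimes> xpow \<beta>)) \<alpha> = coef f \<beta> \<otimes> e \<beta>"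
        unfolding brk_term[OF cR summand] using False summand \<alpha> cR i x by (simp add: e_def)
      then show ?thesis using small[OF summand refl] by (simp add: eq)
    qed
  qed
  note h = this
  have fh: "f = ?a \<oplus> h" using fc ac by (simp add: h_def a_minus_def a_lcomm r_neg)
  have brkf: "brk (x i) f = brk (x i) ?a \<oplus> brk (x i) h"
    by (subst fh) (rule brk_add[OF x ac(1) hc])
  have "brk (x i) f \<in> below I (Suc l)"
    unfolding brkf using small(2)[OF \<alpha>(1) refl] h below_add[OF B] by simp
  then have "coef (brk (x i) f) \<alpha> \<otimes> (r \<otimes> b) \<in> I"
    using ann[OF ideal_of_A_D(3)[OF J f(1) i]] \<alpha> r by simp
  moreover have "coef (brk (x i) f) \<alpha> = \<delta> i (coef f \<alpha>) \<oplus> (coef f \<alpha> \<otimes> e \<alpha> \<oplus> coef (brk (x i) h) \<alpha>)"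
    unfolding brkf brk_term[OF ac(2) \<alpha>(1)] using ac hc \<alpha> i x by (simp add: e_def a_assoc)
  ultimately have *: "\<delta> i (coef f \<alpha>) \<otimes> (r \<otimes> b)
      \<oplus> (coef f \<alpha> \<otimes> e \<alpha> \<otimes> (r \<otimes> b) \<oplus> coef (brk (x i) h) \<alpha> \<otimes> (r \<otimes> b)) \<in> I"
    (is "?p \<oplus> ?q \<in> I")
    using ac hc \<alpha> i x r b eR[OF \<alpha>(1)] by (simp add: l_distr)
  have q: "?q \<in> I" using D(4)[OF small(1)[OF \<alpha>(1) refl] conjunct2[OF h]] .
  have p: "?p \<in> carrier A" using ac i r b by simp
  from D(8)[OF * q] show ?thesis using p D(2)[OF q] by (simp add: a_comm[OF p D(2)[OF q]] add_minus_cancel)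
qed

lemma ext_prime:
  assumes J: "ideal J A" and K: "ideal K A" and JK: "ideal_prod A J K \<subseteq> ext I"
  shows "J \<subseteq> ext I \<or> K \<subseteq> ext I"
proof (rule ccontr)
  assume "\<not> ?thesis"
  then obtain f\<^sub>0 g\<^sub>0 where f0: "f\<^sub>0 \<in> J" "f\<^sub>0 \<notin> ext I" and g0: "g\<^sub>0 \<in> K" "g\<^sub>0 \<notin> ext I" by blast
  note B = stable_idealD(1)[OF I]
  note D = base_idealD[OF B]
  obtain \<alpha>\<^sub>0 where \<alpha>0: "\<alpha>\<^sub>0 \<in> E" "coef f\<^sub>0 \<alpha>\<^sub>0 \<notin> I" "f\<^sub>0 \<in> below I (Suc (dg \<alpha>\<^sub>0))"
    using top_degree[OF B ideal_of_A_D(1)[OF J f0(1)] f0(2)] by blast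
  \<comment> \<open>The degree of \<open>f\<^sub>0\<close> modulo \<open>I A\<close>, which gives
    the set \<open>P\<close> below an element outside \<open>I\<close>.\<close>
  define l where "l = dg \<alpha>\<^sub>0"
  obtain b where b: "b \<in> R" "b \<notin> I"
    "\<And>f \<alpha> r. f \<in> J \<Longrightarrow> f \<in> below I (Suc l) \<Longrightarrow> \<alpha> \<in> E \<Longrightarrow> dg \<alpha> = l \<Longrightarrow> r \<in> R \<Longrightarrow>
      coef f \<alpha> \<otimes> (r \<otimes> b) \<in> I"
    using common_right_annihilator[OF J K JK g0, of l] by blast
  obtain s Y where s: "s \<in> center" "Y \<subseteq> {1..n}"
    "\<And>r. r \<in> R \<Longrightarrow> s \<otimes> r \<in> I \<Longrightarrow> r \<in> I"
    "\<And>k. k \<in> Y \<Longrightarrow> \<exists>q \<in> R. \<forall>r \<in> R. s \<otimes> \<delta> k r = q \<otimes> r \<ominus> r \<otimes> q"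
    "\<And>k j. k \<in> {1..n} \<Longrightarrow> k \<notin> Y \<Longrightarrow> j \<in> {1..n} \<Longrightarrow> tau k j \<in> I"
    using regular_element[OF I one prime] by blast
  define P where "P = {coef f \<alpha> | f \<alpha>. f \<in> J \<and> f \<in> below I (Suc l) \<and> \<alpha> \<in> E \<and> dg \<alpha> = l}"
  \<comment> \<open>Right multiples of \<open>P\<close> are included so that the right annihilator
    becomes closed under left multiplication.\<close>
  define S where "S = {a \<otimes> r | a r. a \<in> P \<and> r \<in> R}"
  have PR: "a \<in> R" if "a \<in> P" for a using that by (auto simp: P_def dest: below_carrier)
  have SR: "S \<subseteq> R" using PR by (auto simp: S_def)
  have S_iff: "(\<forall>t \<in> S. t \<otimes> c \<in> I) \<longleftrightarrow> (\<forall>a \<in> P. \<forall>r \<in> R. a \<otimes> (r \<otimes> c) \<in> I)" if "c \<in> R" for c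
    using PR that by (fastforce simp: S_def m_assoc)
  have derivation: "\<delta> i a \<otimes> (r \<otimes> c) \<in> I"
    if c: "c \<in> R" and ann: "\<forall>a \<in> P. \<forall>r \<in> R. a \<otimes> (r \<otimes> c) \<in> I" and i: "i \<in> {1..n}" and a: "a \<in> P" and r: "r \<in> R"
    for c i a r
  proof (cases "i \<in> Y")
    case True
    obtain q where q: "q \<in> R" "s \<otimes> \<delta> i a = q \<otimes> a \<ominus> a \<otimes> q" using s(4)[OF True] PR[OF a] by blast
    note R = PR[OF a] centerD(1)[OF s(1)]
    \<comment> \<open>\<open>s (\<delta> i a)\<close> is the commutator of \<open>q\<close> and
      \<open>a\<close>. Both of its terms send \<open>R c\<close> into \<open>I\<close>, and
      regularity cancels \<open>s\<close>.\<close>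
    have "s \<otimes> (\<delta> i a \<otimes> (r \<otimes> c)) = (q \<otimes> a \<ominus> a \<otimes> q) \<otimes> (r \<otimes> c)"
      unfolding q(2)[symmetric] using R i r c by (simp add: m_assoc)
    also have "\<dots> = q \<otimes> (a \<otimes> (r \<otimes> c)) \<ominus> a \<otimes> ((q \<otimes> r) \<otimes> c)"
      using R q(1) r c by (simp add: a_minus_def l_distr l_minus m_assoc)
    also have "\<dots> \<in> I" using D(8)[OF D(5)[OF q(1)]] ann a r R_closed(5)[OF q(1) r] by blast
    finally show ?thesis using s(3) R i r c by simp
  next
    case False
    obtain f \<alpha> where f: "f \<in> J" "f \<in> below I (Suc l)" "\<alpha> \<in> E" "dg \<alpha> = l" "a = coef f \<alpha>"
      using a by (auto simp: P_def)
    have "coef f \<alpha> \<otimes> (r \<otimes> c) \<in> I"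
      if "f \<in> J" "f \<in> below I (Suc l)" "\<alpha> \<in> E" "dg \<alpha> = l" "r \<in> R" for f \<alpha> r
      using ann that by (auto simp: P_def)
    from top_coefficient_derivation[OF J c this i s(5)[OF i False] f(1-4) r] show ?thesis
      unfolding f(5) by blast
  qed
  have "S \<subseteq> I \<or> (\<forall>c \<in> R. (\<forall>t \<in> S. t \<otimes> c \<in> I) \<longrightarrow> c \<in> I)"
  proof (rule annihilator_dichotomy[OF I one prime SR])
    fix c assume c: "c \<in> R" and "\<And>t. t \<in> S \<Longrightarrow> t \<otimes> c \<in> I"
    then have ann: "\<forall>a \<in> P. \<forall>r \<in> R. a \<otimes> (r \<otimes> c) \<in> I" using S_iff[OF c] by blast
    show "\<forall>t \<in> S. t \<otimes> (r \<otimes> c) \<in> I" if r: "r \<in> R" for r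
    proof -
      have "a \<otimes> (q \<otimes> (r \<otimes> c)) \<in> I" if "a \<in> P" "q \<in> R" for a q
        using ann that r c m_assoc[of q r c] by (metis R_carrier R_closed(5))
      then show ?thesis using S_iff[of "r \<otimes> c"] r c by simp
    qed
    show "\<forall>t \<in> S. t \<otimes> \<delta> i c \<in> I" if i: "i \<in> {1..n}" for i
    proof -
      have "a \<otimes> (r \<otimes> \<delta> i c) \<in> I" if a: "a \<in> P" and r: "r \<in> R" for a r
      proof -
        note aR = PR[OF a]
        have "a \<otimes> r \<otimes> c \<in> I" using ann a r aR c by (simp add: m_assoc)
        \<comment> \<open>By \<open>\<delta>_ideal_product\<close> the derivation may act on
          \<open>a r\<close> instead of \<open>c\<close>; \<open>derivation\<close> treats the part
          that falls on \<open>a\<close>.\<close>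
        moreover have "\<delta> i (a \<otimes> r) \<otimes> c = a \<otimes> (\<delta> i r \<otimes> c) \<oplus> \<delta> i a \<otimes> (r \<otimes> c)"
          using aR r c i by (simp add: \<delta>_mult l_distr m_assoc)
        then have "\<delta> i (a \<otimes> r) \<otimes> c \<in> I"
          using D(4) ann a derivation[OF c ann i a r] \<delta>_closed[OF i r] by simp
        ultimately have "a \<otimes> r \<otimes> \<delta> i c \<in> I"
          using \<delta>_ideal_product[OF I i _ c, of "a \<otimes> r"] aR r by simp
        then show ?thesis using aR r c i by (simp add: m_assoc)
      qed
      then show ?thesis using S_iff[of "\<delta> i c"] i c by simp
    qed
  qed
  moreover have "a \<in> S" if "a \<in> P" for a
    unfolding S_def by (rule CollectI, rule exI[of _ a], rule exI[of _ \<one>]) (use PR[OF that] that in simp)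
  then have "coef f\<^sub>0 \<alpha>\<^sub>0 \<in> S" using f0 \<alpha>0 by (auto simp: P_def l_def)
  moreover have "\<forall>t \<in> S. t \<otimes> b \<in> I" unfolding S_iff[OF b(1)] using b(3) by (auto simp: P_def)
  ultimately show False using \<alpha>0(2) b by blast
qed

end

lemma invariant_prime_imp_nc_prime:
  assumes prime: "invariant_prime_ideal (A\<lparr>carrier := R\<rparr>) (\<delta> ` {1..n}) I"
  shows "nc_prime_ideal A (ext I)"
proof -
  have I: "stable_ideal I" and "I \<noteq> R"
    and P: "\<And>J K. stable_ideal J \<Longrightarrow> stable_ideal K \<Longrightarrow>
      ideal_prod (A\<lparr>carrier := R\<rparr>) J K \<subseteq> I \<Longrightarrow> J \<subseteq> I \<or> K \<subseteq> I"
    using prime unfolding invariant_prime_ideal_def invariant_ideal_iff by simp_all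
  note D = base_idealD[OF stable_idealD(1)[OF I]]
  have one: "\<one> \<notin> I"
  proof
    assume "\<one> \<in> I"
    then have "r \<in> I" if "r \<in> R" for r using D(5)[OF that] that by fastforce
    then have "I = R" using D(1) by (intro equalityI subsetI)
    then show False using \<open>I \<noteq> R\<close> by contradiction
  qed
  have P': "J \<subseteq> I \<or> K \<subseteq> I"
    if "stable_ideal J" "stable_ideal K" "\<And>j k. j \<in> J \<Longrightarrow> k \<in> K \<Longrightarrow> j \<otimes> k \<in> I" for J K
  proof (rule P[OF that(1,2)])
    show "ideal_prod (A\<lparr>carrier := R\<rparr>) J K \<subseteq> I"
    proof
      fix a assume "a \<in> ideal_prod (A\<lparr>carrier := R\<rparr>) J K"
      then show "a \<in> I" by induction (simp_all add: that(3) D(4))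
    qed
  qed
  have "\<one> \<notin> ext I" using ext_inter_R[OF I] one R_closed(2) by blast
  then have "ext I \<noteq> carrier A" using one_closed by blast
  show ?thesis
    unfolding nc_prime_ideal_def
  proof (intro conjI allI impI)
    show "ideal (ext I) A" by (rule ext_ideal[OF I])
    show "ext I \<noteq> carrier A" by fact
    show "J \<subseteq> ext I \<or> K \<subseteq> ext I"
      if "ideal J A" "ideal K A" "ideal_prod A J K \<subseteq> ext I" for J K
      by (rule ext_prime[OF I one _ that]) (rule P')
  qed
qed

end

theorem theorem3p3:
  fixes A :: "('a, 'b) ring_scheme" and R I :: "'a set" and n :: nat
    and x :: "nat \<Rightarrow> 'a" and \<sigma> \<delta> :: "nat \<Rightarrow> 'a \<Rightarrow> 'a"
    and \<Delta> :: "('a \<Rightarrow> 'a) set"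
  assumes "skew_PBW_extension A R n x"
    and "associated_system A R n x \<sigma> \<delta>"
    and "derivation_type R n \<sigma>"
    and "\<Delta> = \<delta> ` {1..n}"
    and "invariant_ideal (A\<lparr>carrier := R\<rparr>) \<Delta> I"
    and "I \<noteq> R"
  shows "(invariant_prime_ideal (A\<lparr>carrier := R\<rparr>) \<Delta> I \<longleftrightarrow>
            nc_prime_ideal A (ideal_prod A I (carrier A))) \<and>
         (invariant_prime_ideal (A\<lparr>carrier := R\<rparr>) \<Delta> I \<longrightarrow>
            ideal_prod A I (carrier A) = ideal_prod A (carrier A) I \<and>
            ideal_prod A I (carrier A) \<inter> R = I)"
proof -
  note pbw = assms(1)[unfolded skew_PBW_extension_def]
  note sys = assms(2)[unfolded associated_system_def skew_derivation_def]
  have \<sigma>: "\<sigma> i r = r" if "i \<in> {1..n}" "r \<in> R" for i r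
    using assms(3) that by (simp add: derivation_type_def)
  interpret A: ring A using pbw by blast
  interpret pbw_derivation_type A R n x \<delta>
  proof (intro pbw_derivation_type.intro pbw_derivation_type_axioms.intro A.ring_axioms)
    show "subring R A" "x \<in> {1..n} \<rightarrow> carrier A" "free_left_basis A R (exponents n) (monomial A n x)"
      using pbw by auto
    show "\<exists>c \<in> R. (x j \<otimes>\<^bsub>A\<^esub> x i) \<ominus>\<^bsub>A\<^esub> (c \<otimes>\<^bsub>A\<^esub> (x i \<otimes>\<^bsub>A\<^esub> x j)) \<in> affine_part A R n x"
      if "i \<in> {1..n}" "j \<in> {1..n}" for i j
      using pbw that by blast
    show "\<delta> i r \<in> R" if "i \<in> {1..n}" "r \<in> R" for i r
      using sys that by (auto simp: Pi_iff)
    show "\<delta> i (r \<oplus>\<^bsub>A\<^esub> s) = \<delta> i r \<oplus>\<^bsub>A\<^esub> \<delta> i s" if "i \<in> {1..n}" "r \<in> R" "s \<in> R" for i r s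
      using sys that by simp
    show "\<delta> i (r \<otimes>\<^bsub>A\<^esub> s) = (r \<otimes>\<^bsub>A\<^esub> \<delta> i s) \<oplus>\<^bsub>A\<^esub> (\<delta> i r \<otimes>\<^bsub>A\<^esub> s)" if "i \<in> {1..n}" "r \<in> R" "s \<in> R" for i r s
      using sys that \<sigma> by simp
    show "x i \<otimes>\<^bsub>A\<^esub> r = (r \<otimes>\<^bsub>A\<^esub> x i) \<oplus>\<^bsub>A\<^esub> \<delta> i r" if "i \<in> {1..n}" "r \<in> R" for i r
      using sys that \<sigma> by simp
  qed
  have I: "stable_ideal I" using assms(4,5) invariant_ideal_iff by simp
  show ?thesis
    unfolding assms(4) ideal_prod_right_eq_ext[OF I] ideal_prod_left_eq_ext[OF I] ext_inter_R[OF I]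
    using invariant_prime_imp_nc_prime nc_prime_imp_invariant_prime[OF I assms(6)] by blast
qed

end
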